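(* Let $G$ be a LEF group with a fixed finite generating set $S$ and a LEF approximation $\theta_n:G\to G_n$ ($n\in\mathbb{N}$). Assume that the LEF approximation $\theta_n$ is essential and by simple groups. If $G$ is amenable and Hilbert--Schmidt stable, then the associated diagonal product $\bigotimes_n G_n$ is also amenable and Hilbert--Schmidt stable.
   Context: Hilbert--Schmidt stability. For $d\in\mathbb{N}$ the unitary group $U(d)$ carries the normalized Hilbert--Schmidt distance $d_{\mathrm{HS}}(A,B)=\sqrt{\tfrac1d \mathrm{Tr}((A-B)^*(A-B))}$. Let $G$ be a group with finite generating set $S$, and let $B_S(n)$ be the ball of radius $n$ around the identity in the word metric. An $(n,\delta)$-almost representation is a map $\varphi:B_S(n)\to U(d)$, for some $d\in\mathbb{N}$, with $d_{\mathrm{HS}}(\varphi(gh),\varphi(g)\varphi(h))\le\delta$ whenever $g,h,gh\in B_S(n)$. The group $G$ is Hilbert--Schmidt stable if for every $\varepsilon>0$ there are $\delta>0$ and $n\in\mathbb{N}$ such that for every $d\in\mathbb{N}$ and every $(n,\delta)$-almost representation $\varphi:B_S(n)\to U(d)$ there is a unitary representation $\pi:G\to U(d)$ with $d_{\mathrm{HS}}(\varphi(s),\pi(s))<\varepsilon$ for all $s\in S$. (This does not depend on $S$.) LEF approximations. A LEF approximation of a countable group $G$ is a sequence of maps (not necessarily homomorphisms) $\theta_n:G\to G_n$, $n\in\mathbb{N}$, into finite groups $G_n$ such that (i) for all $g,h\in G$ one has $\theta_n(gh)=\theta_n(g)\theta_n(h)$ for all sufficiently large $n$, and (ii) for every $g\ne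 e$ one has $\theta_n(g)\neq e$ for all sufficiently large $n$. The group $G$ is LEF if it admits a LEF approximation. Given a finite generating set $S$ of $G$, the LEF approximation is called essential and by simple groups if: the finite groups $G_n$ are simple and pairwise non-isomorphic; for every $n$ the restriction $\theta_n|_S$ does not extend to a homomorphism $G\to G_n$; and for every $n$ the set $\theta_n(S)$ generates $G_n$. Diagonal product. The diagonal product $\bigotimes_n G_n$ associated to $(G,S,(\theta_n))$ is the subgroup of $\prod_n G_n$ generated by the elements $\gamma_s=(\theta_n(s))_n$, $s\in S$. *)

theory Defs
  imports
    "HOL-Algebra.SimpleGroups"
    "HOL-Algebra.Product_Groups"
    "HOL-Algebra.Elementary_Groups"
    "Jordan_Normal_Form.Schur_Decomposition"
begin

section \<open>Unitary matrices and the normalized Hilbert--Schmidt distance\<close>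

text \<open>Matrices are those of \<^theory>\<open>Jordan_Normal_Form.Matrix\<close>, whose dimension is a value rather
  than a type, because the dimension is quantified inside the definition of stability.\<close>

definition unitary_group :: "nat \<Rightarrow> complex mat monoid" where
  "unitary_group d =
    \<lparr>carrier = {A \<in> carrier_mat d d. mat_adjoint A * A = 1\<^sub>m d \<and> A * mat_adjoint A = 1\<^sub>m d},
     monoid.mult = (*),
     one = 1\<^sub>m d\<rparr>"

definition mat_trace :: "'a::comm_monoid_add mat \<Rightarrow> 'a" where
  "mat_trace A = (\<Sum>i<dim_row A. A $$ (i, i))"

text \<open>Only used for square matrices of equal size. The trace of \<open>C\<^sup>* C\<close> is a nonnegative real,
  so that \<^const>\<open>Re\<close> is a mere coercion.\<close>

definition hs_dist :: "complex mat \<Rightarrow> complex mat \<Rightarrow> real" where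
  "hs_dist A B = sqrt (1 / real (dim_row A) * Re (mat_trace (mat_adjoint (A - B) * (A - B))))"


section \<open>Hilbert--Schmidt stability\<close>

text \<open>The generating set need not be symmetric: words use generators and their inverses.\<close>

definition word_ball :: "('a, 'm) monoid_scheme \<Rightarrow> 'a set \<Rightarrow> nat \<Rightarrow> 'a set" where
  "word_ball G S n =
    {foldr (\<otimes>\<^bsub>G\<^esub>) ws \<one>\<^bsub>G\<^esub> | ws. set ws \<subseteq> S \<union> (\<lambda>s. inv\<^bsub>G\<^esub> s) ` S \<and> length ws \<le> n}"

definition finite_generating_set :: "('a, 'm) monoid_scheme \<Rightarrow> 'a set \<Rightarrow> bool" where
  "finite_generating_set G S \<longleftrightarrow> finite S \<and> S \<subseteq> carrier G \<and> generate G S = carrier G"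

text \<open>The values of \<open>\<phi>\<close> outside the ball are irrelevant.\<close>

definition almost_representation ::
    "('a, 'm) monoid_scheme \<Rightarrow> 'a set \<Rightarrow> nat \<Rightarrow> real \<Rightarrow> nat \<Rightarrow> ('a \<Rightarrow> complex mat) \<Rightarrow> bool" where
  "almost_representation G S n \<delta> d \<phi> \<longleftrightarrow>
    \<phi> \<in> word_ball G S n \<rightarrow> carrier (unitary_group d) \<and>
    (\<forall>g \<in> word_ball G S n. \<forall>h \<in> word_ball G S n.
       g \<otimes>\<^bsub>G\<^esub> h \<in> word_ball G S n \<longrightarrow> hs_dist (\<phi> (g \<otimes>\<^bsub>G\<^esub> h)) (\<phi> g * \<phi> h) \<le> \<delta>)"

text \<open>The condition \<open>n \<ge> 1\<close> ensures that the ball contains \<open>S\<close>, so that \<open>\<phi>\<close> is constrained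
  on \<open>S\<close>. It is no restriction, since \<open>n\<close> may always be enlarged.\<close>

definition hs_stable_wrt :: "('a, 'm) monoid_scheme \<Rightarrow> 'a set \<Rightarrow> bool" where
  "hs_stable_wrt G S \<longleftrightarrow>
    (\<forall>\<epsilon>>0. \<exists>\<delta>>0. \<exists>n\<ge>1. \<forall>d\<ge>1. \<forall>\<phi>. almost_representation G S n \<delta> d \<phi> \<longrightarrow>
       (\<exists>\<pi> \<in> hom G (unitary_group d). \<forall>s\<in>S. hs_dist (\<phi> s) (\<pi> s) < \<epsilon>))"

text \<open>For a finitely generated group, \<^const>\<open>hs_stable_wrt\<close> does not depend on the choice of the
  finite generating set.\<close>

definition hs_stable :: "('a, 'm) monoid_scheme \<Rightarrow> bool" where
  "hs_stable G \<longleftrightarrow> (\<exists>S. finite_generating_set G S \<and> hs_stable_wrt G S)"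


section \<open>Amenability\<close>

text \<open>Amenability as a discrete group: there is a left-invariant finitely additive probability
  measure defined on all subsets of the group.\<close>

definition amenable :: "('a, 'm) monoid_scheme \<Rightarrow> bool" where
  "amenable G \<longleftrightarrow>
    (\<exists>\<mu> :: 'a set \<Rightarrow> real.
       (\<forall>A \<subseteq> carrier G. 0 \<le> \<mu> A) \<and>
       \<mu> (carrier G) = 1 \<and>
       (\<forall>A B. A \<subseteq> carrier G \<longrightarrow> B \<subseteq> carrier G \<longrightarrow> A \<inter> B = {} \<longrightarrow> \<mu> (A \<union> B) = \<mu> A + \<mu> B) \<and>
       (\<forall>g \<in> carrier G. \<forall>A \<subseteq> carrier G. \<mu> ((\<lambda>x. g \<otimes>\<^bsub>G\<^esub> x) ` A) = \<mu> A))"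


section \<open>LEF approximations and diagonal products\<close>

definition LEF_approximation ::
    "('a, 'm) monoid_scheme \<Rightarrow> (nat \<Rightarrow> ('b, 'k) monoid_scheme) \<Rightarrow> (nat \<Rightarrow> 'a \<Rightarrow> 'b) \<Rightarrow> bool" where
  "LEF_approximation G H \<theta> \<longleftrightarrow>
    (\<forall>n. group (H n) \<and> finite (carrier (H n)) \<and> \<theta> n \<in> carrier G \<rightarrow> carrier (H n)) \<and>
    (\<forall>g \<in> carrier G. \<forall>h \<in> carrier G.
       \<forall>\<^sub>F n in sequentially. \<theta> n (g \<otimes>\<^bsub>G\<^esub> h) = \<theta> n g \<otimes>\<^bsub>H n\<^esub> \<theta> n h) \<and>
    (\<forall>g \<in> carrier G. g \<noteq> \<one>\<^bsub>G\<^esub> \<longrightarrow> (\<forall>\<^sub>F n in sequentially. \<theta> n g \<noteq> \<one>\<^bsub>H n\<^esub>))"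

definition essential_by_simple_groups ::
    "('a, 'm) monoid_scheme \<Rightarrow> 'a set \<Rightarrow> (nat \<Rightarrow> ('b, 'k) monoid_scheme) \<Rightarrow> (nat \<Rightarrow> 'a \<Rightarrow> 'b) \<Rightarrow> bool"
  where
  "essential_by_simple_groups G S H \<theta> \<longleftrightarrow>
    (\<forall>n. simple_group (H n)) \<and>
    (\<forall>m n. m \<noteq> n \<longrightarrow> \<not> H m \<cong> H n) \<and>
    (\<forall>n. \<not> (\<exists>f \<in> hom G (H n). \<forall>s\<in>S. f s = \<theta> n s)) \<and>
    (\<forall>n. generate (H n) (\<theta> n ` S) = carrier (H n))"

definition diagonal_product ::
    "'a set \<Rightarrow> (nat \<Rightarrow> ('b, 'k) monoid_scheme) \<Rightarrow> (nat \<Rightarrow> 'a \<Rightarrow> 'b) \<Rightarrow> (nat \<Rightarrow> 'b) monoid" where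
  "diagonal_product S H \<theta> =
    subgroup_generated (product_group UNIV H) ((\<lambda>s n. \<theta> n s) ` S)"

end

theory Submission
  imports Defs "HOL-Analysis.Inner_Product" "Jordan_Normal_Form.Spectral_Radius"
begin

text \<open>Sending an element \<open>x\<close> of the diagonal product \<open>D\<close> to the unique \<open>g\<close> with \<open>x\<^sub>n = \<theta>\<^sub>n(g)\<close> for
  large \<open>n\<close> makes \<open>D\<close> an extension of \<open>G\<close> whose kernel consists of finitely supported elements.
  Essentiality, simplicity and Goursat's lemma show that \<open>D\<close> contains every single factor \<open>G\<^sub>n\<close>.
  Hence \<open>D = P \<times> D'\<close> with \<open>P = G\<^sub>0 \<times> \<dots> \<times> G\<^sub>m\<^sub>-\<^sub>1\<close> finite, and \<open>D'\<close> agrees with \<open>G\<close> on any given finite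
  set once \<open>m\<close> is large.

  Amenability passes to extensions by a locally finite kernel: average over the finite
  subgroups of the kernel, take a generalized limit and integrate over \<open>G\<close>.

  Stability does not need amenability. Finite groups are stable: dilate an almost representation
  to the regular representation, round the averaged range projection to a spectral projection,
  correct its trace by minimal projections of the commutant, and polarize. Given an almost
  representation of \<open>D\<close>, its restriction to \<open>P\<close> is thus close to a representation \<open>\<pi>\<close>. The part on
  \<open>D'\<close> almost commutes with \<open>\<pi>\<close>, so it may be moved into the commutant of \<open>\<pi>\<close>, a direct sum of
  matrix algebras; on all but a small part of them it is an almost representation of \<open>G\<close>, to which
  the stability of \<open>G\<close> applies.\<close>

section \<open>Finitary complex matrices\<close>

text \<open>All constants must be uniform in the dimension \<open>d\<close>, and the representation
  produced must have dimension exactly \<open>d\<close>. The second demand is the obstacle for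
  finite groups: the spectral projection near the range of the dilation may have rank above
  \<open>d\<close>. Its excess is at most the squared distance of the two projections, and ranks are
  integers, so an excess forces that distance to be at least 1. This pays for cutting off minimal
  projections, whose rank is at most the order of the group; missing dimensions are filled by the
  trivial representation. For the extension the obstacle is that a small Hilbert--Schmidt error says
  nothing about a single small block of the commutant, so stability of \<open>G\<close> applies only
  to blocks whose own normalized defect is small. The choices depend on each other in this order: a
  ball and a tolerance from the stability of \<open>G\<close>, the cut \<open>m\<close> and with it
  the finite group, the tolerance for that group, and the radius in the diagonal product. Stability
  of \<open>G\<close> comes with a generating set unrelated to \<open>S\<close>, so generators of
  the diagonal product are built to map into it.\<close>

text \<open>All matrix algebras, of every size and including rectangular blocks, are corners of the
  (nonunital) ring of finitely supported \<open>\<nat> \<times> \<nat>\<close> matrices, so that no dimension side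
  conditions arise. The norm is the unnormalized Hilbert--Schmidt norm.\<close>

typedef fmat = "{f :: nat \<Rightarrow> nat \<Rightarrow> complex. \<exists>N. \<forall>i j. f i j \<noteq> 0 \<longrightarrow> i < N \<and> j < N}"
  morphisms ent Abs_fmat
  by (rule exI[of _ "\<lambda>i j. 0"]) auto

setup_lifting type_definition_fmat

lemma ent_bound: "\<exists>N. \<forall>i j. ent a i j \<noteq> 0 \<longrightarrow> i < N \<and> j < N"
  using ent[of a] by simp

lemma fmat_eqI: "(\<And>i j. ent a i j = ent b i j) \<Longrightarrow> a = b"
  by (metis ent_inject ext)

text \<open>Summing over the support of a row of \<open>f\<close> requires no size bound as an
  argument; \<open>conv_eq\<close> trades the support for any bound.\<close>

definition conv :: "(nat \<Rightarrow> nat \<Rightarrow> complex) \<Rightarrow> (nat \<Rightarrow> nat \<Rightarrow> complex) \<Rightarrow> nat \<Rightarrow> nat \<Rightarrow> complex"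
  where "conv f g i j = (\<Sum>k | f i k \<noteq> 0. f i k * g k j)"

lemma conv_eq:
  assumes "\<And>k. f i k \<noteq> 0 \<Longrightarrow> k < N"
  shows "conv f g i j = (\<Sum>k<N. f i k * g k j)"
  unfolding conv_def by (rule sum.mono_neutral_left) (use assms in auto)

instantiation fmat :: ring
begin

lift_definition zero_fmat :: fmat is "\<lambda>i j. 0" by auto

lift_definition plus_fmat :: "fmat \<Rightarrow> fmat \<Rightarrow> fmat" is "\<lambda>f g i j. f i j + g i j"
proof -
  fix f g :: "nat \<Rightarrow> nat \<Rightarrow> complex"
  assume "\<exists>N. \<forall>i j. f i j \<noteq> 0 \<longrightarrow> i < N \<and> j < N" "\<exists>N. \<forall>i j. g i j \<noteq> 0 \<longrightarrow> i < N \<and> j < N"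
  then obtain M N where *: "\<And>i j. f i j \<noteq> 0 \<Longrightarrow> i < M \<and> j < M" "\<And>i j. g i j \<noteq> 0 \<Longrightarrow> i < N \<and> j < N"
    by blast
  have "f i j + g i j \<noteq> 0 \<Longrightarrow> i < max M N \<and> j < max M N" for i j
    using *[of i j] by (cases "f i j = 0") auto
  then show "\<exists>N. \<forall>i j. f i j + g i j \<noteq> 0 \<longrightarrow> i < N \<and> j < N" by blast
qed

lift_definition uminus_fmat :: "fmat \<Rightarrow> fmat" is "\<lambda>f i j. - f i j" by auto

definition minus_fmat :: "fmat \<Rightarrow> fmat \<Rightarrow> fmat" where "minus_fmat a b = a + - b"

lift_definition times_fmat :: "fmat \<Rightarrow> fmat \<Rightarrow> fmat" is conv
proof -
  fix f g :: "nat \<Rightarrow> nat \<Rightarrow> complex"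
  assume "\<exists>N. \<forall>i j. f i j \<noteq> 0 \<longrightarrow> i < N \<and> j < N" "\<exists>N. \<forall>i j. g i j \<noteq> 0 \<longrightarrow> i < N \<and> j < N"
  then obtain M N where *: "\<And>i j. f i j \<noteq> 0 \<Longrightarrow> i < M \<and> j < M" "\<And>i j. g i j \<noteq> 0 \<Longrightarrow> i < N \<and> j < N"
    by blast
  have "conv f g i j \<noteq> 0 \<Longrightarrow> i < max M N \<and> j < max M N" for i j
    unfolding conv_def using sum.not_neutral_contains_not_neutral * by (smt (verit) max.strict_coboundedI1 max.strict_coboundedI2 mult_eq_0_iff)
  then show "\<exists>N. \<forall>i j. conv f g i j \<noteq> 0 \<longrightarrow> i < N \<and> j < N" by blast
qed

lemma ent_times:
  assumes "\<And>i j. ent a i j \<noteq> 0 \<Longrightarrow> j < N"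
  shows "ent (a * b) i j = (\<Sum>k<N. ent a i k * ent b k j)"
  using assms by (simp add: times_fmat.rep_eq conv_eq)

instance
proof
  fix a b c :: fmat
  obtain N1 where N1: "\<And>i j. ent a i j \<noteq> 0 \<Longrightarrow> j < N1" using ent_bound[of a] by blast
  obtain N2 where N2: "\<And>i j. ent b i j \<noteq> 0 \<Longrightarrow> j < N2" using ent_bound[of b] by blast
  obtain N3 where N3: "\<And>i j. ent (a * b) i j \<noteq> 0 \<Longrightarrow> j < N3" using ent_bound[of "a * b"] by blast
  define N where "N = max (max N1 N2) N3"
  have N: "\<And>i j. ent a i j \<noteq> 0 \<Longrightarrow> j < N" "\<And>i j. ent b i j \<noteq> 0 \<Longrightarrow> j < N"
    "\<And>i j. ent (a * b) i j \<noteq> 0 \<Longrightarrow> j < N"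
    using N1 N2 N3 unfolding N_def by (meson max.strict_coboundedI1 max.strict_coboundedI2)+
  have t: "ent (a * y) i j = (\<Sum>k<N. ent a i k * ent y k j)"
    "ent (b * y) i j = (\<Sum>k<N. ent b i k * ent y k j)"
    "ent (a * b * y) i j = (\<Sum>k<N. ent (a * b) i k * ent y k j)" for y i j
    by (rule ent_times; erule N)+
  have "ent (a + b) i j \<noteq> 0 \<Longrightarrow> j < N" for i j
    using N by (metis add_cancel_right_left plus_fmat.rep_eq)
  then have t': "ent ((a + b) * y) i j = (\<Sum>k<N. ent (a + b) i k * ent y k j)" for y i j
    by (rule ent_times)
  show "a * b * c = a * (b * c)"
  proof (rule fmat_eqI)
    fix i j
    have "ent (a * b * c) i j = (\<Sum>k<N. \<Sum>l<N. ent a i l * ent b l k * ent c k j)"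
      by (subst t(3), subst t(1)) (simp only: sum_distrib_right)
    also have "\<dots> = (\<Sum>l<N. \<Sum>k<N. ent a i l * ent b l k * ent c k j)"
      by (rule sum.swap)
    also have "\<dots> = ent (a * (b * c)) i j"
      by (subst t(1), subst t(2)) (simp only: sum_distrib_left mult.assoc)
    finally show "ent (a * b * c) i j = ent (a * (b * c)) i j" .
  qed
  show "(a + b) * c = a * c + b * c"
    by (rule fmat_eqI)
      (simp add: t t' plus_fmat.rep_eq sum.distrib distrib_right)
  show "a * (b + c) = a * b + a * c"
    by (rule fmat_eqI) (simp add: t plus_fmat.rep_eq sum.distrib distrib_left)
qed (auto intro!: fmat_eqI simp: plus_fmat.rep_eq uminus_fmat.rep_eq zero_fmat.rep_eq minus_fmat_def)

end

lemma ent_minus: "ent (a - b) i j = ent a i j - ent b i j"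
  by (simp only: minus_fmat_def plus_fmat.rep_eq uminus_fmat.rep_eq) simp

section \<open>Adjoint, trace, identities and matrix units\<close>

lift_definition adj :: "fmat \<Rightarrow> fmat" is "\<lambda>f i j. cnj (f j i)" by auto

lift_definition sc :: "complex \<Rightarrow> fmat \<Rightarrow> fmat" is "\<lambda>c f i j. c * f i j" by auto

definition tr :: "fmat \<Rightarrow> complex" where "tr a = (\<Sum>i | ent a i i \<noteq> 0. ent a i i)"

text \<open>The ring has no unit; \<open>idm n\<close> is the unit of the corner of
  \<open>n \<times> n\<close> matrices.\<close>

lift_definition idm :: "nat \<Rightarrow> fmat" is "\<lambda>n i j. if i = j \<and> i < n then 1 else 0"
  by (metis (full_types))

lift_definition eunit :: "nat \<Rightarrow> nat \<Rightarrow> fmat" is "\<lambda>k l i j. if i = k \<and> j = l then 1 else 0"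
proof -
  fix k l :: nat
  show "\<exists>N. \<forall>i j. (if i = k \<and> j = l then 1 else (0 :: complex)) \<noteq> 0 \<longrightarrow> i < N \<and> j < N"
    by (rule exI[of _ "Suc (max k l)"]) auto
qed

lemma ent_sum: "ent (sum f A) i j = (\<Sum>x\<in>A. ent (f x) i j)"
  by (induction A rule: infinite_finite_induct) (simp_all add: plus_fmat.rep_eq zero_fmat.rep_eq)

lemma tr_eq:
  assumes "\<And>i. ent a i i \<noteq> 0 \<Longrightarrow> i < N"
  shows "tr a = (\<Sum>i<N. ent a i i)"
  unfolding tr_def by (rule sum.mono_neutral_left) (use assms in auto)

definition bnd :: "nat \<Rightarrow> fmat \<Rightarrow> bool"
  where "bnd N a \<longleftrightarrow> (\<forall>i j. ent a i j \<noteq> 0 \<longrightarrow> i < N \<and> j < N)"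

lemma tr_bnd: "bnd N a \<Longrightarrow> tr a = (\<Sum>i<N. ent a i i)"
  by (rule tr_eq) (auto simp: bnd_def)

lemma times_bnd: "bnd N a \<Longrightarrow> ent (a * b) i j = (\<Sum>k<N. ent a i k * ent b k j)"
  by (rule ent_times) (auto simp: bnd_def)

text \<open>Finitely many matrices fit into one size, so that traces and products become sums over a
  common range.\<close>

lemma common_bound:
  assumes "finite A"
  obtains N where "\<And>a. a \<in> A \<Longrightarrow> bnd N a"
proof -
  obtain B where B: "\<And>a i j. ent a i j \<noteq> 0 \<Longrightarrow> i < B a \<and> j < B a"
    using ent_bound by metis
  have "bnd (Max (B ` A)) a" if "a \<in> A" for a
    unfolding bnd_def
  proof (intro allI impI)
    fix i j
    assume "ent a i j \<noteq> 0"
    moreover have "B a \<le> Max (B ` A)" using assms that by simp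
    ultimately show "i < Max (B ` A) \<and> j < Max (B ` A)" using B[of a i j] by simp
  qed
  then show thesis by (rule that)
qed

lemma tr_add: "tr (a + b) = tr a + tr b"
proof -
  obtain N where "\<And>x. x \<in> {a, b, a + b} \<Longrightarrow> bnd N x"
    using common_bound[of "{a, b, a + b}"] by blast
  then have "bnd N a" "bnd N b" "bnd N (a + b)" by blast+
  then show ?thesis by (simp add: tr_bnd[of N] plus_fmat.rep_eq sum.distrib)
qed

lemma tr_sc: "tr (sc c a) = c * tr a"
proof -
  obtain N where "\<And>x. x \<in> {a, sc c a} \<Longrightarrow> bnd N x"
    using common_bound[of "{a, sc c a}"] by blast
  then have "bnd N a" "bnd N (sc c a)" by blast+
  then show ?thesis by (simp add: tr_bnd[of N] sc.rep_eq sum_distrib_left)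
qed

lemma tr_uminus: "tr (- a) = - tr a"
  unfolding tr_def by (simp add: uminus_fmat.rep_eq sum_negf)

lemma tr_diff: "tr (a - b) = tr a - tr b"
  using tr_add[of a "- b"] by (simp add: tr_uminus)

lemma tr_0 [simp]: "tr 0 = 0"
  by (simp add: tr_def zero_fmat.rep_eq)

lemma tr_sum: "tr (sum f A) = (\<Sum>x\<in>A. tr (f x))"
  by (induction A rule: infinite_finite_induct) (simp_all add: tr_add)

lemma tr_mult_comm: "tr (a * b) = tr (b * a)"
proof -
  obtain N where "\<And>x. x \<in> {a, b, a * b, b * a} \<Longrightarrow> bnd N x"
    using common_bound[of "{a, b, a * b, b * a}"] by blast
  then have N: "bnd N a" "bnd N b" "bnd N (a * b)" "bnd N (b * a)" by blast+
  have "tr (a * b) = (\<Sum>i<N. \<Sum>k<N. ent a i k * ent b k i)"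
    using N by (simp add: tr_bnd[of N] times_bnd[of N])
  also have "\<dots> = (\<Sum>k<N. \<Sum>i<N. ent b k i * ent a i k)"
    by (subst sum.swap) (simp add: mult.commute)
  also have "\<dots> = tr (b * a)"
    using N by (simp add: tr_bnd[of N] times_bnd[of N])
  finally show ?thesis .
qed

lemma tr_idm [simp]: "tr (idm n) = of_nat n"
  by (subst tr_eq[of _ n]) (auto simp: idm.rep_eq split: if_splits)

lemma tr_adj: "tr (adj a) = cnj (tr a)"
  by (simp add: tr_def adj.rep_eq cnj_sum)

lemma adj_adj [simp]: "adj (adj a) = a"
  by (rule fmat_eqI) (simp add: adj.rep_eq)

lemma adj_add: "adj (a + b) = adj a + adj b"
  by (rule fmat_eqI) (simp add: adj.rep_eq plus_fmat.rep_eq)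

lemma adj_diff: "adj (a - b) = adj a - adj b"
  by (rule fmat_eqI) (simp add: adj.rep_eq ent_minus)

lemma adj_0 [simp]: "adj 0 = 0"
  by (rule fmat_eqI) (simp add: adj.rep_eq zero_fmat.rep_eq)

lemma adj_sum: "adj (sum f A) = (\<Sum>x\<in>A. adj (f x))"
  by (induction A rule: infinite_finite_induct) (simp_all add: adj_add)

lemma adj_sc: "adj (sc c a) = sc (cnj c) (adj a)"
  by (rule fmat_eqI) (simp add: adj.rep_eq sc.rep_eq)

lemma adj_idm [simp]: "adj (idm n) = idm n"
  by (rule fmat_eqI) (auto simp: adj.rep_eq idm.rep_eq)

lemma adj_eunit [simp]: "adj (eunit i j) = eunit j i"
  by (rule fmat_eqI) (auto simp: adj.rep_eq eunit.rep_eq)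

lemma adj_mult: "adj (a * b) = adj b * adj a"
proof -
  obtain N where "\<And>x. x \<in> {a, adj b} \<Longrightarrow> bnd N x"
    using common_bound[of "{a, adj b}"] by blast
  then have N: "bnd N a" "bnd N (adj b)" by blast+
  show ?thesis
    by (rule fmat_eqI)
      (simp add: times_bnd[OF N(2)], simp add: adj.rep_eq times_bnd[OF N(1)] cnj_sum mult.commute)
qed

lemma sc_mult_left [simp]: "sc c a * b = sc c (a * b)"
proof -
  obtain N where "\<And>x. x \<in> {a, sc c a} \<Longrightarrow> bnd N x"
    using common_bound[of "{a, sc c a}"] by blast
  then have N: "bnd N a" "bnd N (sc c a)" by blast+
  show ?thesis
    by (rule fmat_eqI)
      (simp add: times_bnd[OF N(2)], simp add: sc.rep_eq times_bnd[OF N(1)] sum_distrib_left mult.assoc)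
qed

lemma sc_mult_right [simp]: "a * sc c b = sc c (a * b)"
proof -
  obtain N where N: "bnd N a" using common_bound[of "{a}"] by blast
  show ?thesis
    by (rule fmat_eqI) (simp add: sc.rep_eq times_bnd[OF N] sum_distrib_left ac_simps)
qed

lemma sc_sc [simp]: "sc c (sc d a) = sc (c * d) a"
  by (rule fmat_eqI) (simp add: sc.rep_eq)

lemma sc_1 [simp]: "sc 1 a = a"
  by (rule fmat_eqI) (simp add: sc.rep_eq)

lemma sc_0 [simp]: "sc 0 a = 0"
  by (rule fmat_eqI) (simp add: sc.rep_eq zero_fmat.rep_eq)

lemma sc_zero [simp]: "sc c 0 = 0"
  by (rule fmat_eqI) (simp add: sc.rep_eq zero_fmat.rep_eq)

lemma sc_add_right: "sc c (a + b) = sc c a + sc c b"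
  by (rule fmat_eqI) (simp add: sc.rep_eq plus_fmat.rep_eq distrib_left)

lemma sc_add_left: "sc (c + d) a = sc c a + sc d a"
  by (rule fmat_eqI) (simp add: sc.rep_eq plus_fmat.rep_eq distrib_right)

lemma sc_diff_right: "sc c (a - b) = sc c a - sc c b"
  by (rule fmat_eqI) (simp add: sc.rep_eq ent_minus right_diff_distrib)

lemma sc_diff_left: "sc (c - d) a = sc c a - sc d a"
  by (rule fmat_eqI) (simp add: sc.rep_eq ent_minus left_diff_distrib)

lemma sc_sum: "sc c (sum f A) = (\<Sum>x\<in>A. sc c (f x))"
  by (induction A rule: infinite_finite_induct) (simp_all add: sc_add_right)

lemma sum_sc: "(\<Sum>x\<in>A. sc (f x) a) = sc (sum f A) a"
  by (induction A rule: infinite_finite_induct) (simp_all add: sc_add_left)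

lemma idm_mult_ent: "ent (idm n * a) i j = (if i < n then ent a i j else 0)"
proof -
  have "ent (idm n * a) i j = (\<Sum>k<n. ent (idm n) i k * ent a k j)"
    by (rule ent_times) (simp add: idm.rep_eq split: if_splits)
  also have "\<dots> = (\<Sum>k<n. if k = i then ent a k j else 0)"
    by (rule sum.cong) (auto simp: idm.rep_eq)
  also have "\<dots> = (if i < n then ent a i j else 0)"
    by (subst sum.delta) auto
  finally show ?thesis .
qed

lemma mult_idm_ent: "ent (a * idm n) i j = (if j < n then ent a i j else 0)"
proof -
  have "ent (a * idm n) i j = ent (adj (idm n * adj a)) i j"
    by (simp add: adj_mult)
  then show ?thesis by (simp add: adj.rep_eq idm_mult_ent)
qed

lemma idm_idm [simp]: "idm m * idm n = idm (min m n)"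
  by (rule fmat_eqI) (simp add: idm_mult_ent, auto simp: idm.rep_eq)

lemma eunit_mult: "eunit i j * eunit k l = (if j = k then eunit i l else 0)"
proof (rule fmat_eqI)
  fix a b
  have "ent (eunit i j * eunit k l) a b = (\<Sum>n<Suc j. ent (eunit i j) a n * ent (eunit k l) n b)"
    by (rule ent_times) (auto simp: eunit.rep_eq split: if_splits)
  also have "\<dots> = (\<Sum>n<Suc j. if n = j then ent (eunit i j) a n * ent (eunit k l) n b else 0)"
    by (rule sum.cong) (auto simp: eunit.rep_eq)
  also have "\<dots> = ent (eunit i j) a j * ent (eunit k l) j b"
    by (subst sum.delta) auto
  finally show "ent (eunit i j * eunit k l) a b = ent (if j = k then eunit i l else 0) a b"
    by (auto simp: eunit.rep_eq zero_fmat.rep_eq)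
qed

lemma idm_Suc: "idm (Suc n) = idm n + eunit n n"
  by (rule fmat_eqI) (auto simp: idm.rep_eq eunit.rep_eq plus_fmat.rep_eq)

lemma idm_sum: "idm n = (\<Sum>i<n. eunit i i)"
  by (induction n) (auto simp: idm_Suc intro!: fmat_eqI simp: idm.rep_eq zero_fmat.rep_eq)

lemma tr_eunit [simp]: "tr (eunit i i) = 1"
  by (subst tr_eq[of _ "Suc i"]) (auto simp: eunit.rep_eq split: if_splits)

text \<open>Compression between matrix units leaves a scalar; the Gram numbers of columns are read
  off in this way.\<close>

lemma eunit_sandwich: "eunit i k * a * eunit l j = sc (ent a k l) (eunit i j)"
proof -
  obtain N where N: "\<And>i j. ent a i j \<noteq> 0 \<Longrightarrow> j < N" using ent_bound[of a] by blast
  have 1: "ent (eunit i k * a) x y = (if x = i then ent a k y else 0)" for x y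
  proof -
    have "ent (eunit i k * a) x y = (\<Sum>n<Suc k. ent (eunit i k) x n * ent a n y)"
      by (rule ent_times) (auto simp: eunit.rep_eq split: if_splits)
    also have "\<dots> = (\<Sum>n<Suc k. if n = k then (if x = i then ent a n y else 0) else 0)"
      by (rule sum.cong) (auto simp: eunit.rep_eq)
    also have "\<dots> = (if x = i then ent a k y else 0)"
      by (subst sum.delta) auto
    finally show ?thesis .
  qed
  show ?thesis
  proof (rule fmat_eqI)
    fix x y
    have N': "\<And>x y. ent (eunit i k * a) x y \<noteq> 0 \<Longrightarrow> y < max N (Suc l)" using N 1
      by (metis less_max_iff_disj)
    have "ent (eunit i k * a * eunit l j) x y
        = (\<Sum>n<max N (Suc l). ent (eunit i k * a) x n * ent (eunit l j) n y)"
      by (rule ent_times) (use N' in auto)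
    also have "\<dots> = (\<Sum>n<max N (Suc l). if n = l then ent (eunit i k * a) x n * ent (eunit l j) n y else 0)"
      by (rule sum.cong) (auto simp: eunit.rep_eq)
    also have "\<dots> = ent (eunit i k * a) x l * ent (eunit l j) l y"
      by (subst sum.delta) auto
    finally show "ent (eunit i k * a * eunit l j) x y = ent (sc (ent a k l) (eunit i j)) x y"
      by (auto simp: 1 sc.rep_eq eunit.rep_eq)
  qed
qed

lemma tr_adj_mult:
  assumes "\<And>i j. ent a i j \<noteq> 0 \<Longrightarrow> i < N" "\<And>i j. ent a i j \<noteq> 0 \<Longrightarrow> j < N"
  shows "tr (adj a * b) = (\<Sum>i<N. \<Sum>k<N. cnj (ent a k i) * ent b k i)"
proof -
  have 1: "ent (adj a * b) i j = (\<Sum>k<N. cnj (ent a k i) * ent b k j)" for i j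
    by (subst ent_times[of _ N]) (use assms in \<open>auto simp: adj.rep_eq\<close>)
  have "i < N" if "ent (adj a * b) i i \<noteq> 0" for i
    using that assms(2) unfolding 1 by (metis (no_types, lifting) complex_cnj_zero mult_zero_left sum.neutral)
  then have "tr (adj a * b) = (\<Sum>i<N. ent (adj a * b) i i)" by (rule tr_eq)
  then show ?thesis by (simp add: 1)
qed

section \<open>The Hilbert--Schmidt norm\<close>

instantiation fmat :: real_vector
begin

definition scaleR_fmat :: "real \<Rightarrow> fmat \<Rightarrow> fmat" where "scaleR_fmat r a = sc (of_real r) a"

instance
  by standard (simp_all add: scaleR_fmat_def sc_add_right sc_add_left)

end

text \<open>The real part of the trace form is a real inner product, which supplies the norm and its
  triangle inequality; complex scalars re-enter through \<open>norm_sc\<close>.\<close>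

instantiation fmat :: real_inner
begin

definition inner_fmat :: "fmat \<Rightarrow> fmat \<Rightarrow> real" where "inner_fmat a b = Re (tr (adj a * b))"
definition norm_fmat :: "fmat \<Rightarrow> real" where "norm_fmat a = sqrt (inner a a)"
definition sgn_fmat :: "fmat \<Rightarrow> fmat" where "sgn_fmat a = a /\<^sub>R norm a"
definition dist_fmat :: "fmat \<Rightarrow> fmat \<Rightarrow> real" where "dist_fmat a b = norm (a - b)"
definition uniformity_fmat :: "(fmat \<times> fmat) filter"
  where "uniformity_fmat = (INF e\<in>{0<..}. principal {(x, y). dist x y < e})"
definition open_fmat :: "fmat set \<Rightarrow> bool"
  where "open_fmat U = (\<forall>x\<in>U. eventually (\<lambda>(x', y). x' = x \<longrightarrow> y \<in> U) uniformity)"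

instance
proof
  fix a b c :: fmat and r s :: real
  show "dist a b = norm (a - b)" by (rule dist_fmat_def)
  show "sgn a = a /\<^sub>R norm a" by (rule sgn_fmat_def)
  show "(uniformity :: (fmat \<times> fmat) filter) = (INF e\<in>{0<..}. principal {(x, y). dist x y < e})"
    by (rule uniformity_fmat_def)
  show "open U \<longleftrightarrow> (\<forall>x\<in>U. \<forall>\<^sub>F (x', y) in uniformity. x' = x \<longrightarrow> y \<in> U)" for U :: "fmat set"
    by (rule open_fmat_def)
  have "tr (adj b * a) = cnj (tr (adj a * b))"
    by (metis adj_adj adj_mult tr_adj)
  then show "inner a b = inner b a" by (simp add: inner_fmat_def)
  show "inner (a + b) c = inner a c + inner b c"
    by (simp add: inner_fmat_def adj_add distrib_right tr_add)
  show "inner (r *\<^sub>R a) b = r * inner a b"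
    by (simp add: inner_fmat_def scaleR_fmat_def adj_sc tr_sc)
  obtain N where N: "\<And>i j. ent a i j \<noteq> 0 \<Longrightarrow> i < N" "\<And>i j. ent a i j \<noteq> 0 \<Longrightarrow> j < N"
    using ent_bound[of a] by blast
  have *: "inner a a = (\<Sum>i<N. \<Sum>k<N. (cmod (ent a k i))\<^sup>2)"
  proof -
    have "cnj z * z = of_real ((cmod z)\<^sup>2)" for z :: complex
      by (metis complex_norm_square mult.commute)
    then have "tr (adj a * a) = of_real (\<Sum>i<N. \<Sum>k<N. (cmod (ent a k i))\<^sup>2)"
      using tr_adj_mult[OF N, of a] by simp
    then show ?thesis by (simp add: inner_fmat_def)
  qed
  then show "0 \<le> inner a a" by (simp add: sum_nonneg)
  show "inner a a = 0 \<longleftrightarrow> a = 0"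
  proof
    assume "inner a a = 0"
    then have "\<forall>i<N. \<forall>k<N. ent a k i = 0"
      unfolding * by (subst (asm) sum_nonneg_eq_0_iff) (auto simp: sum_nonneg sum_nonneg_eq_0_iff)
    then show "a = 0" using N by (intro fmat_eqI) (metis zero_fmat.rep_eq)
  qed (simp add: inner_fmat_def)
  show "norm a = sqrt (inner a a)" by (rule norm_fmat_def)
qed

end

lemma norm_sq_tr: "(norm (a :: fmat))\<^sup>2 = Re (tr (adj a * a))"
  by (simp add: power2_norm_eq_inner inner_fmat_def)

lemma tr_adj_mult_real: "tr (adj a * a) = of_real ((norm a)\<^sup>2)"
proof -
  have "cnj (tr (adj a * a)) = tr (adj a * a)"
    by (metis adj_adj adj_mult tr_adj)
  then have "Im (tr (adj a * a)) = 0" by (metis Reals_cnj_iff complex_is_Real_iff)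
  then show ?thesis by (simp add: complex_eq_iff norm_sq_tr)
qed

text \<open>The standard device below: a matrix vanishes once its Gram matrix does, so equations
  between partial isometries become pure algebra, without vectors.\<close>

lemma adj_mult_eq_0 [simp]: "adj a * a = 0 \<longleftrightarrow> a = 0"
  using norm_sq_tr[of a] by auto

lemma norm_adj [simp]: "norm (adj a) = norm a"
  using norm_sq_tr[of a] norm_sq_tr[of "adj a"] tr_mult_comm[of a "adj a"]
  by (metis adj_adj norm_ge_zero power2_eq_iff_nonneg)

lemma norm_sc: "norm (sc c a) = cmod c * norm a"
proof -
  have "(norm (sc c a))\<^sup>2 = (cmod c * norm a)\<^sup>2"
  proof -
    have "tr (adj (sc c a) * sc c a) = of_real ((cmod c)\<^sup>2) * tr (adj a * a)"
      by (simp add: adj_sc tr_sc complex_norm_square[symmetric] flip: of_real_power)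
    then show ?thesis by (simp add: norm_sq_tr power_mult_distrib)
  qed
  then show ?thesis by (simp add: power2_eq_iff_nonneg)
qed

section \<open>Projections, partial isometries and the spectral theorem\<close>

text \<open>Lets the simplifier use \<open>a * b = c\<close> inside a product associated to the
  right.\<close>

lemma mult_extend: "a * b = c \<Longrightarrow> a * (b * x) = c * (x :: fmat)"
  by (simp add: mult.assoc[symmetric])

definition proj :: "fmat \<Rightarrow> bool" where "proj p \<longleftrightarrow> adj p = p \<and> p * p = p"

lemma proj_adj: "proj p \<Longrightarrow> adj p = p" and proj_idem: "proj p \<Longrightarrow> p * p = p"
  by (simp_all add: proj_def)

lemma proj_idm [simp]: "proj (idm n)"
  by (simp add: proj_def)

lemma proj_0 [simp]: "proj 0"
  by (simp add: proj_def)

lemma tr_proj: "proj p \<Longrightarrow> tr p = of_real ((norm p)\<^sup>2)"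
  using tr_adj_mult_real[of p] by (simp add: proj_def)

text \<open>The Gram matrix of \<open>v - v * p\<close> expands to
  \<open>p - p - p + p\<close>.\<close>

lemma partial_isometry_initial:
  assumes "adj v * v = p" "proj p"
  shows "v * p = v"
proof -
  have "adj (v - v * p) * (v - v * p) = 0"
    using assms by (simp add: adj_diff adj_mult algebra_simps proj_def mult_extend[OF assms(1)])
  then show ?thesis by simp
qed

lemma partial_isometry_final:
  assumes "adj v * v = p" "proj p"
  shows "proj (v * adj v)" "v * adj v * v = v" "adj v * (v * adj v) = adj v"
proof -
  have v: "v * p = v" by (rule partial_isometry_initial) fact+
  show *: "v * adj v * v = v" by (simp add: mult.assoc assms v)
  then show "proj (v * adj v)" by (simp add: proj_def adj_mult mult.assoc[symmetric])
  have "adj (v * adj v * v) = adj v" by (simp only: *)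
  then show "adj v * (v * adj v) = adj v" by (simp add: adj_mult mult.assoc)
qed

lemma proj_diff:
  assumes "proj p" "proj q" "p * q = q"
  shows "proj (p - q)" "q * p = q"
proof -
  have "adj q * adj p = adj q" by (metis adj_mult assms(3))
  then show "q * p = q" using assms(1,2) by (simp add: proj_def)
  then show "proj (p - q)" using assms by (simp add: proj_def adj_diff algebra_simps)
qed

lemma proj_pythagoras:
  assumes "proj p"
  shows "(norm (p * x))\<^sup>2 + (norm (x - p * x))\<^sup>2 = (norm x)\<^sup>2"
proof -
  have "adj (p * x) * (p * x) + adj (x - p * x) * (x - p * x) = adj x * x"
    using assms by (simp add: adj_mult adj_diff proj_def algebra_simps mult_extend[of p p p])
  then show ?thesis unfolding norm_sq_tr by (metis tr_add plus_complex.sel(1))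
qed

lemma partial_isometry_norm_eq:
  assumes "adj v * v = p" "proj p" "p * x = x"
  shows "norm (v * x) = norm x"
proof -
  have "adj (v * x) * (v * x) = adj x * x"
    using assms by (simp add: adj_mult mult.assoc mult_extend[OF assms(1)])
  then have "(norm (v * x))\<^sup>2 = (norm x)\<^sup>2" by (simp only: norm_sq_tr)
  then show ?thesis by simp
qed

text \<open>Since \<open>v = v * p\<close>, only \<open>p * x\<close> matters, and on it
  \<open>v\<close> is isometric.\<close>

lemma partial_isometry_norm_le:
  assumes "adj v * v = p" "proj p"
  shows "norm (v * x) \<le> norm x"
proof -
  have "v * x = v * (p * x)"
    using partial_isometry_initial[OF assms] by (simp add: mult.assoc[symmetric])
  also have "norm \<dots> = norm (p * x)"
    using assms by (intro partial_isometry_norm_eq[OF assms]) (simp add: proj_def mult.assoc[symmetric])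
  also have "\<dots> \<le> norm x"
    using proj_pythagoras[OF assms(2), of x] by (intro power2_le_imp_le[OF _ norm_ge_zero]) (smt (verit) zero_le_power2)
  finally show ?thesis .
qed

lemma partial_isometry_norm_right:
  assumes "v * adj v = p" "proj p"
  shows "norm (x * v) \<le> norm x"
proof -
  have "norm (x * v) = norm (adj v * adj x)" by (metis adj_mult norm_adj)
  also have "\<dots> \<le> norm (adj x)" by (rule partial_isometry_norm_le[of _ p]) (use assms in auto)
  finally show ?thesis by simp
qed

lemma proj_norm_le: "proj p \<Longrightarrow> norm (p * x) \<le> norm x" "proj p \<Longrightarrow> norm (x * p) \<le> norm x"
  using partial_isometry_norm_le[of p p x] partial_isometry_norm_right[of p p x]
  by (simp_all add: proj_def)

section \<open>Matrix algebras as corners, and their unitaries\<close>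

definition corner :: "nat \<Rightarrow> fmat \<Rightarrow> bool"
  where "corner n a \<longleftrightarrow> idm n * a = a \<and> a * idm n = a"

text \<open>Membership in the corner is not asked for: the two equations together force it, see
  \<open>unitary_corner\<close>.\<close>

definition unitary :: "nat \<Rightarrow> fmat \<Rightarrow> bool"
  where "unitary n u \<longleftrightarrow> adj u * u = idm n \<and> u * adj u = idm n"

lemma unitaryD:
  assumes "unitary n u"
  shows "adj u * u = idm n" "u * adj u = idm n" "u * idm n = u" "idm n * u = u"
    "adj u * idm n = adj u" "idm n * adj u = adj u"
proof -
  show 1: "adj u * u = idm n" "u * adj u = idm n" using assms by (auto simp: unitary_def)
  show 2: "u * idm n = u" using partial_isometry_initial[OF 1(1)] by simp
  show 3: "idm n * u = u" using 1 2 by (metis mult.assoc)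
  show "adj u * idm n = adj u" "idm n * adj u = adj u"
    using 2 3 by (metis adj_idm adj_mult)+
qed

lemma unitary_corner: "unitary n u \<Longrightarrow> corner n u"
  by (simp add: corner_def unitaryD)

lemma unitary_idm [simp]: "unitary n (idm n)"
  by (simp add: unitary_def)

lemma unitary_adj: "unitary n u \<Longrightarrow> unitary n (adj u)"
  by (simp add: unitary_def)

lemma unitary_mult:
  assumes "unitary n u" "unitary n v"
  shows "unitary n (u * v)"
  using unitaryD[OF assms(1)] unitaryD[OF assms(2)]
  by (simp add: unitary_def adj_mult mult.assoc mult_extend[of "adj u" u] mult_extend[of v "adj v"])

lemma unitary_norm_le:
  assumes "unitary n u"
  shows "norm (u * x) \<le> norm x" "norm (x * u) \<le> norm x"
  using partial_isometry_norm_le[of u "idm n" x] partial_isometry_norm_right[of u "idm n" x]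
    unitaryD[OF assms] by simp_all

lemma norm_idm: "norm (idm n) = sqrt n"
proof -
  have "(norm (idm n))\<^sup>2 = n" by (simp add: norm_sq_tr)
  then show ?thesis by (metis norm_ge_zero real_sqrt_unique)
qed

lemma unitary_norm: "unitary n u \<Longrightarrow> norm u = sqrt n"
  using norm_sq_tr[of u] by (simp add: unitaryD) (metis norm_ge_zero real_sqrt_unique)

lemma idm_eunit: "idm n * eunit i j = (if i < n then eunit i j else 0)"
  by (rule fmat_eqI) (auto simp: idm_mult_ent eunit.rep_eq zero_fmat.rep_eq)

lemma idm_0 [simp]: "idm 0 = 0"
  by (rule fmat_eqI) (simp add: idm.rep_eq zero_fmat.rep_eq)

section \<open>Rank and coordinates of projections\<close>

text \<open>A column vector is encoded as a matrix supported in column 0, that is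
  \<open>x * eunit 0 0 = x\<close>; its Gram matrix is its squared length times
  \<open>eunit 0 0\<close>.\<close>

lemma column_adj_mult:
  assumes "x * eunit 0 0 = x" "x \<noteq> 0"
  obtains r :: real where "r > 0" "adj x * x = sc (of_real r) (eunit 0 0)"
proof -
  have "adj x * x = adj (x * eunit 0 0) * (x * eunit 0 0)" by (simp only: assms)
  also have "\<dots> = eunit 0 0 * (adj x * x) * eunit 0 0" by (simp add: adj_mult mult.assoc)
  also have "\<dots> = sc (ent (adj x * x) 0 0) (eunit 0 0)" by (rule eunit_sandwich)
  finally have eq: "adj x * x = sc (ent (adj x * x) 0 0) (eunit 0 0)" .
  then have "tr (adj x * x) = ent (adj x * x) 0 0" by (metis mult.right_neutral tr_eunit tr_sc)
  then have "ent (adj x * x) 0 0 = of_real ((norm x)\<^sup>2)" by (simp add: tr_adj_mult_real)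
  then show thesis using that[of "(norm x)\<^sup>2"] eq assms(2) by simp
qed

text \<open>Induction on an integer above the squared norm: a nonzero column of \<open>p\<close>,
  normalized, splits off a rank one projection and lowers the squared norm by exactly 1.\<close>

lemma proj_coordinates:
  assumes "proj p"
  shows "\<exists>m w. adj w * w = idm m \<and> w * adj w = p"
proof -
  have "\<forall>p. proj p \<longrightarrow> (norm p)\<^sup>2 < real k \<longrightarrow> (\<exists>m w. adj w * w = idm m \<and> w * adj w = p)" for k
  proof (induction k)
    case 0
    then show ?case by (simp add: not_less)
  next
    case (Suc k)
    show ?case
    proof (intro allI impI)
      fix p assume p: "proj p" "(norm p)\<^sup>2 < real (Suc k)"
      show "\<exists>m w. adj w * w = idm m \<and> w * adj w = p"
      proof (cases "p = 0")
        case True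
        then show ?thesis by (intro exI[of _ 0]) simp
      next
        case False
        then obtain i j where ij: "ent p i j \<noteq> 0"
          by (metis fmat_eqI zero_fmat.rep_eq)
        \<comment> \<open>Column \<open>j\<close> of \<open>p\<close>, moved to column 0; it lies in
          the range of \<open>p\<close> and is nonzero because of the entry at \<open>i\<close>,
          \<open>j\<close>.\<close>
        define x where "x = p * eunit j 0"
        have x0: "x * eunit 0 0 = x" by (simp add: x_def mult.assoc eunit_mult)
        have "ent (eunit 0 i * x * eunit 0 0) 0 0 = ent p i j"
          using eunit_sandwich[of 0 i p j 0] by (simp add: x_def mult.assoc eunit_mult sc.rep_eq eunit.rep_eq)
        then have "x \<noteq> 0" using ij by (auto simp: zero_fmat.rep_eq)
        with x0 obtain r where r: "r > 0" "adj x * x = sc (of_real r) (eunit 0 0)"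
          by (rule column_adj_mult)
        define v where "v = sc (of_real (1 / sqrt r)) x"
        have vv: "adj v * v = eunit 0 0"
          using r by (simp add: v_def adj_sc flip: of_real_mult)
        have v0: "v * eunit 0 0 = v" by (simp add: v_def x0)
        have pv: "p * v = v" using p by (simp add: v_def x_def proj_def mult_extend[of p p p])
        have pp: "proj (eunit 0 0)" by (simp add: proj_def eunit_mult)
        define p' where "p' = p - v * adj v"
        have q: "proj (v * adj v)" using partial_isometry_final[OF vv pp] by simp
        have "p * (v * adj v) = v * adj v" by (simp add: mult.assoc[symmetric] pv)
        then have p': "proj p'" unfolding p'_def by (rule proj_diff[OF p(1) q])
        have p'v: "p' * v = 0" using partial_isometry_final[OF vv pp] by (simp add: p'_def left_diff_distrib pv)
        have "tr p' = tr p - 1"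
          by (simp add: p'_def tr_diff tr_mult_comm[of v] vv)
        then have "of_real ((norm p')\<^sup>2) = (of_real ((norm p)\<^sup>2 - 1) :: complex)"
          using tr_proj[OF p'] tr_proj[OF p(1)] by simp
        then have "(norm p')\<^sup>2 = (norm p)\<^sup>2 - 1" by (simp only: of_real_eq_iff)
        then have "(norm p')\<^sup>2 < real k" using p(2) by simp
        then obtain m w where w: "adj w * w = idm m" "w * adj w = p'" using Suc p' by blast
        have wm: "w * idm m = w" by (rule partial_isometry_initial[OF w(1)]) simp
        have "adj w = adj w * p'" using partial_isometry_final(3)[OF w(1)] w(2) by simp
        then have wv: "adj w * v = 0" by (metis mult.assoc mult_zero_right p'v)
        then have vw: "adj v * w = 0" by (metis adj_0 adj_adj adj_mult)
        have we: "w * eunit m 0 = 0"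
          by (metis idm_eunit less_irrefl mult.assoc mult_zero_right wm)
        have ew: "eunit 0 m * adj w = 0"
          using we by (metis adj_0 adj_eunit adj_mult)
        have e00: "eunit 0 0 * adj v = adj v" using v0 by (metis adj_eunit adj_mult)
        \<comment> \<open>The new vector receives the index \<open>m\<close>. The cross terms vanish
          because the ranges of \<open>w\<close> and \<open>v\<close> are orthogonal and
          \<open>w\<close> kills \<open>eunit m 0\<close>.\<close>
        let ?W = "w + v * eunit 0 m"
        have "adj ?W * ?W = idm (Suc m)"
          by (simp add: adj_add adj_mult distrib_left distrib_right mult.assoc w(1)
              mult_extend[OF wv] vw mult_extend[OF vv] eunit_mult idm_Suc)
        moreover have "?W * adj ?W = p"
          by (simp add: adj_add adj_mult distrib_left distrib_right mult.assoc w(2)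
              mult_extend[OF we] ew mult_extend[OF eunit_mult] e00 p'_def)
        ultimately show ?thesis by blast
      qed
    qed
  qed
  from this[of "Suc (nat \<lceil>(norm p)\<^sup>2\<rceil>)"] show ?thesis
    using assms by (smt (verit) of_nat_Suc real_nat_ceiling_ge)
qed

text \<open>Identifies the squared norm with the rank; the resulting integrality drives the trace
  correction.\<close>

lemma coordinates_norm:
  assumes "adj w * w = idm m" "w * adj w = p"
  shows "(norm p)\<^sup>2 = real m"
proof -
  have "proj p" using partial_isometry_final(1)[OF assms(1)] assms(2) by simp
  then have "of_real ((norm p)\<^sup>2) = tr (w * adj w)" using tr_proj assms(2) by simp
  then have "complex_of_real ((norm p)\<^sup>2) = of_real (real m)" by (simp add: tr_mult_comm[of w] assms(1))
  then show ?thesis by (simp only: of_real_eq_iff)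
qed

text \<open>Equal traces mean equal ranks, so the coordinates of \<open>p\<close> and
  \<open>q\<close> can be composed.\<close>

lemma proj_equiv:
  assumes "proj p" "proj q" "tr p = tr q"
  shows "\<exists>w. adj w * w = p \<and> w * adj w = q"
proof -
  obtain m v where v: "adj v * v = idm m" "v * adj v = p" using proj_coordinates[OF assms(1)] by blast
  obtain n w where w: "adj w * w = idm n" "w * adj w = q" using proj_coordinates[OF assms(2)] by blast
  have "tr p = of_nat m" "tr q = of_nat n"
    using v w tr_mult_comm by (metis tr_idm)+
  then have mn: "m = n" using assms(3) by simp
  have "v * idm m = v" "w * idm n = w"
    using partial_isometry_initial[OF v(1)] partial_isometry_initial[OF w(1)] by auto
  then show ?thesis
    using v w mn by (intro exI[of _ "w * adj v"])
      (simp add: adj_mult mult.assoc mult_extend[of "adj w" w] mult_extend[of "adj v" v] mult_extend[of v "idm n"] mult_extend[of w "idm n"])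
qed

lemma proj_zero_trace: "proj p \<Longrightarrow> tr p = 0 \<Longrightarrow> p = 0"
  using tr_proj by simp

section \<open>The spectral theorem\<close>

text \<open>The eigenvalue comes from the nonempty spectrum of a complex square matrix; the
  eigenvector is returned as a column so that it stays in the ring.\<close>

lemma eigenvector_exists:
  assumes "corner n T" "n > 0"
  obtains c x where "x \<noteq> 0" "x * eunit 0 0 = x" "idm n * x = x" "T * x = sc c x"
proof -
  define A where "A = mat n n (\<lambda>(i, j). ent T i j)"
  have A: "A \<in> carrier_mat n n" by (simp add: A_def)
  from spectrum_non_empty[OF A assms(2)] obtain c where "eigenvalue A c"
    by (auto simp: spectrum_def)
  then obtain v where v: "eigenvector A v c" by (auto simp: eigenvalue_def)
  then have dv: "dim_vec v = n" "v \<noteq> 0\<^sub>v n" "A *\<^sub>v v = c \<cdot>\<^sub>v v"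
    using A by (auto simp: eigenvector_def)
  define x where "x = (\<Sum>i<n. sc (v $ i) (eunit i 0))"
  have ex: "ent x i j = (if i < n \<and> j = 0 then v $ i else 0)" for i j
  proof -
    have "ent x i j = (\<Sum>k<n. if k = i then (if j = 0 then v $ k else 0) else 0)"
      unfolding x_def ent_sum by (rule sum.cong) (auto simp: sc.rep_eq eunit.rep_eq)
    also have "\<dots> = (if i < n \<and> j = 0 then v $ i else 0)" by (subst sum.delta) auto
    finally show ?thesis .
  qed
  show thesis
  proof (rule that)
    obtain i where "i < n" "v $ i \<noteq> 0"
      using dv(1,2) by (metis eq_vecI index_zero_vec(1) index_zero_vec(2))
    then show "x \<noteq> 0" using ex[of i 0] by (auto simp: zero_fmat.rep_eq)
    show "x * eunit 0 0 = x" by (simp add: x_def sum_distrib_right eunit_mult)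
    show "idm n * x = x" by (rule fmat_eqI) (simp add: idm_mult_ent ex)
    have b: "ent T i j \<noteq> 0 \<Longrightarrow> j < n" for i j
      using assms(1) mult_idm_ent[of T n i j] by (auto simp: corner_def split: if_splits)
    have b': "\<not> i < n \<Longrightarrow> ent T i j = 0" for i j
      using assms(1) idm_mult_ent[of n T i j] by (auto simp: corner_def split: if_splits)
    show "T * x = sc c x"
    proof (rule fmat_eqI)
      fix i j
      have e: "ent (T * x) i j = (\<Sum>k<n. ent T i k * ent x k j)" by (rule ent_times) (rule b)
      show "ent (T * x) i j = ent (sc c x) i j"
      proof (cases "i < n \<and> j = 0")
        case True
        have "(A *\<^sub>v v) $ i = (\<Sum>k<n. ent T i k * v $ k)"
          using True dv(1) by (simp add: A_def scalar_prod_def atLeast0LessThan)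
        then show ?thesis using True dv e by (simp add: ex sc.rep_eq)
      next
        case False
        then show ?thesis using b' by (auto simp: e ex sc.rep_eq)
      qed
    qed
  qed
qed

text \<open>Induction on the rank of \<open>e\<close>: an eigenvector in its range gives a rank one
  projection, and the rest of \<open>T\<close> lives on the complement. An eigenvalue may occur
  several times here; \<open>spectral\<close> groups equal ones.\<close>

lemma spectral_rank_one:
  assumes "proj e" "tr e = of_nat k" "adj T = T" "e * T = T" "T * e = T"
  shows "\<exists>f (l :: nat \<Rightarrow> real). (\<forall>i<k. proj (f i) \<and> f i \<noteq> 0) \<and>
    (\<forall>i<k. \<forall>j<k. i \<noteq> j \<longrightarrow> f i * f j = 0) \<and> (\<Sum>i<k. f i) = e \<and>
    T = (\<Sum>i<k. sc (of_real (l i)) (f i))"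
  using assms
proof (induction k arbitrary: e T)
  case 0
  then have "e = 0" using proj_zero_trace by simp
  then show ?case using 0 by simp
next
  case (Suc k)
  obtain m w where w: "adj w * w = idm m" "w * adj w = e"
    using proj_coordinates[OF \<open>proj e\<close>] by blast
  have "(of_nat m :: complex) = of_nat (Suc k)"
    using Suc.prems(2) w tr_mult_comm by (metis tr_idm)
  then have m: "m > 0" by (simp only: of_nat_eq_iff)
  have wm: "w * idm m = w" by (rule partial_isometry_initial[OF w(1)]) simp
  have mw: "idm m * adj w = adj w" using wm by (metis adj_idm adj_mult)
  \<comment> \<open>Coordinates of \<open>e\<close> turn \<open>T\<close> into a genuine
    \<open>m \<times> m\<close> matrix, and \<open>w\<close> carries its eigenvector back.\<close>
  have "corner m (adj w * T * w)"
    by (simp add: corner_def mult.assoc wm mult_extend[OF mw])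
  then obtain c x where x: "x \<noteq> 0" "x * eunit 0 0 = x" "idm m * x = x" "adj w * T * w * x = sc c x"
    using m by (rule eigenvector_exists)
  define y where "y = w * x"
  have wy: "adj w * y = x" by (simp add: y_def mult_extend[OF w(1)] x)
  have "y \<noteq> 0" using wy x(1) by auto
  have y0: "y * eunit 0 0 = y" by (simp add: y_def mult.assoc x)
  have ey: "e * y = y" by (simp add: w(2)[symmetric] mult.assoc wy) (simp add: y_def)
  have "T * y = e * (T * y)" by (simp add: mult.assoc[symmetric] Suc.prems)
  also have "\<dots> = w * (adj w * T * w * x)" by (simp add: w(2)[symmetric] mult.assoc y_def)
  also have "\<dots> = sc c y" by (simp add: x y_def)
  finally have Ty: "T * y = sc c y" .
  obtain r where r: "r > 0" "adj y * y = sc (of_real r) (eunit 0 0)"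
    using column_adj_mult[OF y0 \<open>y \<noteq> 0\<close>] by blast
  \<comment> \<open>The quadratic form of \<open>T\<close> at \<open>y\<close> is self-conjugate, so
    the eigenvalue is real.\<close>
  have "adj (adj y * (T * y)) = adj y * (T * y)"
    by (simp add: adj_mult Suc.prems mult.assoc)
  then have "tr (sc (cnj c * of_real r) (eunit 0 0)) = tr (sc (c * of_real r) (eunit 0 0))"
    by (simp add: Ty r adj_sc)
  then have "cnj c = c" using r(1) by (simp add: tr_sc)
  then obtain l0 where l0: "c = of_real l0" by (metis Reals_cases Reals_cnj_iff)
  define f0 where "f0 = sc (of_real (1 / r)) (y * adj y)"
  have "y * (adj y * (y * adj y)) = sc (of_real r) (y * adj y)"
    by (simp add: mult_extend[OF r(2)]) (simp add: mult.assoc[symmetric] y0)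
  then have f0: "proj f0"
    using r(1) by (simp add: proj_def f0_def adj_sc adj_mult mult.assoc)
  have trf: "tr f0 = 1"
    using r by (simp add: f0_def tr_sc tr_mult_comm[of y])
  have ef: "e * f0 = f0" by (simp add: f0_def mult.assoc[symmetric] ey)
  have Tf: "T * f0 = sc (of_real l0) f0"
    by (simp add: f0_def mult.assoc[symmetric] Ty l0 mult.commute)
  have "adj (T * f0) = adj (sc (of_real l0) f0)" by (simp only: Tf)
  then have fT: "f0 * T = sc (of_real l0) f0"
    using f0 Suc.prems(3) by (simp add: adj_mult adj_sc proj_def)
  define e' T' where "e' = e - f0" and "T' = T - sc (of_real l0) f0"
  have fe: "f0 * e = f0" and pe': "proj e'"
    using proj_diff[OF \<open>proj e\<close> f0 ef] by (simp_all add: e'_def)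
  have "tr e' = of_nat k" using Suc.prems(2) trf by (simp add: e'_def tr_diff)
  moreover have "adj T' = T'" using f0 Suc.prems by (simp add: T'_def adj_diff adj_sc proj_def)
  moreover have "e' * T' = T'" "T' * e' = T'"
    using f0 Suc.prems by (simp_all add: T'_def e'_def algebra_simps ef fe Tf fT proj_def)
  ultimately obtain f l where fl: "\<forall>i<k. proj (f i) \<and> f i \<noteq> 0"
      "\<forall>i<k. \<forall>j<k. i \<noteq> j \<longrightarrow> f i * f j = 0" "(\<Sum>i<k. f i) = e'"
      "T' = (\<Sum>i<k. sc (of_real (l i :: real)) (f i))"
    using Suc.IH[OF pe', of T'] by blast
  have orth: "f i * f0 = 0 \<and> f0 * f i = 0" if i: "i < k" for i
  proof -
    have "f i * e' = (\<Sum>j<k. f i * f j)" by (simp add: fl(3)[symmetric] sum_distrib_left)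
    also have "\<dots> = (\<Sum>j<k. if j = i then f i else 0)"
      using fl(1,2) i by (intro sum.cong) (auto simp: proj_def)
    also have "\<dots> = f i" using i by simp
    finally have "f i * e' = f i" .
    then have "f i * f0 = f i * (e' * f0)" by (simp add: mult.assoc[symmetric])
    also have "e' * f0 = 0" using f0 by (simp add: e'_def algebra_simps ef proj_def)
    finally have 1: "f i * f0 = 0" by simp
    then have "adj f0 * adj (f i) = 0" by (metis adj_0 adj_mult)
    then show ?thesis using 1 fl(1) i f0 by (simp add: proj_def)
  qed
  have "f0 \<noteq> 0" using trf by auto
  show ?case
    by (rule exI[of _ "\<lambda>i. if i < k then f i else f0"], rule exI[of _ "\<lambda>i. if i < k then l i else l0"])
      (use fl orth f0 \<open>f0 \<noteq> 0\<close> in \<open>auto simp: less_Suc_eq e'_def T'_def algebra_simps\<close>)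
qed

lemma corner_bound: "\<exists>n. corner n a"
proof -
  obtain N where "bnd N a" using common_bound[of "{a}"] by blast
  then have "corner N a"
    by (auto simp: corner_def bnd_def idm_mult_ent mult_idm_ent intro!: fmat_eqI) blast+
  then show ?thesis ..
qed

text \<open>The eigenvalue 0 is left out: its eigenspace is infinite dimensional in the ambient
  space, whereas the other eigenprojections are finitary and independent of the chosen corner. They
  therefore commute with everything that commutes with \<open>T\<close>, also outside that
  corner.\<close>

theorem spectral:
  assumes "adj T = T"
  obtains \<Lambda> :: "real set" and p where "finite \<Lambda>" "0 \<notin> \<Lambda>" "\<And>l. l \<in> \<Lambda> \<Longrightarrow> proj (p l)"
    "\<And>l. l \<in> \<Lambda> \<Longrightarrow> p l \<noteq> 0" "\<And>l m. l \<in> \<Lambda> \<Longrightarrow> m \<in> \<Lambda> \<Longrightarrow> l \<noteq> m \<Longrightarrow> p l * p m = 0"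
    "T = (\<Sum>l\<in>\<Lambda>. sc (of_real l) (p l))"
    "\<And>x l. l \<in> \<Lambda> \<Longrightarrow> x * T = T * x \<Longrightarrow> x * p l = p l * x"
    "\<And>l. l \<in> \<Lambda> \<Longrightarrow> T * p l = sc (of_real l) (p l)"
proof -
  obtain k where "corner k T" using corner_bound by blast
  then obtain f l where f: "\<forall>i<k. proj (f i) \<and> f i \<noteq> 0"
      "\<forall>i<k. \<forall>j<k. i \<noteq> j \<longrightarrow> f i * f j = 0" "(\<Sum>i<k. f i) = idm k"
      "T = (\<Sum>i<k. sc (of_real (l i :: real)) (f i))"
    using spectral_rank_one[of "idm k" k T] assms by (auto simp: corner_def)
  define p where "p m = (\<Sum>i\<in>{i. i < k \<and> l i = m}. f i)" for m
  have ff: "f i * f j = (if j = i then f i else 0)" if "i < k" "j < k" for i j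
    using f(1,2) that by (auto simp: proj_def)
  have pf: "p m * f j = (if l j = m then f j else 0)" if "j < k" for m j
  proof -
    have "p m * f j = (\<Sum>i\<in>{i. i < k \<and> l i = m}. if i = j then f j else 0)"
      unfolding p_def sum_distrib_right by (rule sum.cong) (use ff that in auto)
    then show ?thesis using that by simp
  qed
  have pp: "p m * p n = (if m = n then p m else 0)" for m n
  proof -
    have "p m * p n = (\<Sum>j\<in>{i. i < k \<and> l i = n}. p m * f j)" by (simp add: p_def[of n] sum_distrib_left)
    also have "\<dots> = (\<Sum>j\<in>{i. i < k \<and> l i = n}. if m = n then f j else 0)"
      by (rule sum.cong) (auto simp: pf)
    finally show ?thesis by (simp add: p_def)
  qed
  have pa: "adj (p m) = p m" for m
    using f(1) unfolding p_def adj_sum by (intro sum.cong) (auto simp: proj_def)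
  have grp: "(\<Sum>m\<in>l ` {..<k}. \<Sum>i\<in>{i. i < k \<and> l i = m}. h i) = (\<Sum>i<k. h i)" for h :: "nat \<Rightarrow> fmat"
    using sum.image_gen[of "{..<k}" h l] by simp
  have sum_p: "(\<Sum>m\<in>l ` {..<k}. p m) = idm k" by (simp add: p_def grp f(3))
  have "(\<Sum>m\<in>l ` {..<k}. sc (of_real m) (p m)) = (\<Sum>m\<in>l ` {..<k}. \<Sum>i\<in>{i. i < k \<and> l i = m}. sc (of_real (l i)) (f i))"
    unfolding p_def sc_sum by (intro sum.cong) auto
  then have sT: "(\<Sum>m\<in>l ` {..<k}. sc (of_real m) (p m)) = T" by (simp only: grp f(4))
  have Tp: "T * p n = sc (of_real n) (p n)" "p n * T = sc (of_real n) (p n)" if "n \<in> l ` {..<k}" for n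
  proof -
    have "T * p n = (\<Sum>m\<in>l ` {..<k}. if m = n then sc (of_real m) (p m) else 0)"
      unfolding sT[symmetric] sum_distrib_right by (rule sum.cong) (auto simp: pp)
    then show "T * p n = sc (of_real n) (p n)" using that by simp
    have "p n * T = (\<Sum>m\<in>l ` {..<k}. if m = n then sc (of_real m) (p m) else 0)"
      unfolding sT[symmetric] sum_distrib_left by (rule sum.cong) (auto simp: pp)
    then show "p n * T = sc (of_real n) (p n)" using that by simp
  qed
  show thesis
  proof (rule that[of "l ` {..<k} - {0}" p])
    show "p n \<noteq> 0" if "n \<in> l ` {..<k} - {0}" for n
    proof -
      from that obtain i where "i < k" "l i = n" by auto
      then have "p n * f i = f i" "f i \<noteq> 0" using pf f(1) by auto
      then show ?thesis by auto
    qed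
    show "T = (\<Sum>m\<in>l ` {..<k} - {0}. sc (of_real m) (p m))"
      unfolding sT[symmetric] by (rule sum.mono_neutral_right) auto
    show "x * p n = p n * x" if n: "n \<in> l ` {..<k} - {0}" and x: "x * T = T * x" for x n
    proof -
      \<comment> \<open>\<open>T\<close> acts by \<open>m\<close> on the left and by
        \<open>n'\<close> on the right, so distinct eigenvalues force the compression to
        vanish.\<close>
      have z: "p m * x * p n' = 0" if "m \<in> l ` {..<k}" "n' \<in> l ` {..<k}" "m \<noteq> n'" for m n'
      proof -
        have "p m * (x * T) * p n' = p m * (T * x) * p n'" by (simp only: x)
        then have "sc (of_real n') (p m * x * p n') = sc (of_real m) (p m * x * p n')"
          using Tp(2)[OF that(1)] Tp(1)[OF that(2)]
          by (simp add: mult.assoc mult_extend[of "p m" T])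
        then have "sc (of_real (n' - m)) (p m * x * p n') = 0" by (simp add: sc_diff_left)
        then have "sc (of_real (1 / (n' - m))) (sc (of_real (n' - m)) (p m * x * p n')) = 0" by simp
        then show ?thesis using that(3) by simp
      qed
      have kT: "idm k * T = T" "T * idm k = T"
        using Tp unfolding sT[symmetric] sum_p[symmetric] sum_distrib_left sum_distrib_right
        by (simp_all add: pp sum.delta sum.delta' cong: if_cong) (simp_all add: if_distrib[of "sc _"] sum.delta sum.delta' cong: if_cong)
      \<comment> \<open>Here \<open>x\<close> may reach outside the corner; dividing by the nonzero
        eigenvalue shows that \<open>x * p n\<close> and \<open>p n * x\<close> are nevertheless
        absorbed by \<open>idm k\<close> on the outer side.\<close>
      have "of_real n \<noteq> (0 :: complex)" using n by simp
      have "sc (of_real n) (idm k * (x * p n)) = idm k * (x * (T * p n))" using Tp n by simp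
      also have "\<dots> = idm k * (T * (x * p n))" by (metis mult.assoc x)
      also have "\<dots> = x * (T * p n)" by (metis kT(1) mult.assoc x)
      also have "\<dots> = sc (of_real n) (x * p n)" using Tp n by simp
      finally have "sc (1 / of_real n) (sc (of_real n) (idm k * (x * p n))) = sc (1 / of_real n) (sc (of_real n) (x * p n))"
        by simp
      then have 1: "idm k * (x * p n) = x * p n" using n by simp
      have "sc (of_real n) (p n * x * idm k) = p n * T * x * idm k" using Tp n by simp
      also have "\<dots> = p n * x * (T * idm k)" by (metis mult.assoc x)
      also have "\<dots> = p n * T * x" by (metis kT(2) mult.assoc x)
      also have "\<dots> = sc (of_real n) (p n * x)" using Tp n by simp
      finally have "sc (1 / of_real n) (sc (of_real n) (p n * x * idm k)) = sc (1 / of_real n) (sc (of_real n) (p n * x))"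
        by simp
      then have 2: "p n * x * idm k = p n * x" using n by simp
      have "x * p n = (\<Sum>m\<in>l ` {..<k}. p m * x * p n)"
        using 1 by (simp add: sum_p[symmetric] sum_distrib_right mult.assoc)
      also have "\<dots> = (\<Sum>m\<in>l ` {..<k}. if m = n then p n * x * p n else 0)"
        by (rule sum.cong) (use z n in auto)
      also have "\<dots> = p n * x * p n" using n by simp
      also have "\<dots> = (\<Sum>m\<in>l ` {..<k}. if m = n then p n * x * p m else 0)"
        using n by simp
      also have "\<dots> = (\<Sum>m\<in>l ` {..<k}. p n * x * p m)"
        by (rule sum.cong) (use z n in auto)
      also have "\<dots> = p n * x * idm k" by (simp add: sum_p[symmetric] sum_distrib_left)
      finally show ?thesis using 2 by simp
    qed
  qed (use pp pa Tp in \<open>auto simp: proj_def\<close>)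
qed

section \<open>Orthogonal sums and the polar decomposition\<close>

lemma norm_orthogonal_sum:
  assumes "finite A" "\<And>i j. i \<in> A \<Longrightarrow> j \<in> A \<Longrightarrow> i \<noteq> j \<Longrightarrow> adj (f i) * f j = 0"
  shows "(norm (\<Sum>i\<in>A. f i))\<^sup>2 = (\<Sum>i\<in>A. (norm (f i))\<^sup>2)"
proof -
  have "adj (\<Sum>i\<in>A. f i) * (\<Sum>i\<in>A. f i) = (\<Sum>i\<in>A. \<Sum>j\<in>A. adj (f i) * f j)"
    by (simp add: adj_sum sum_distrib_left sum_distrib_right) (rule sum.swap)
  also have "\<dots> = (\<Sum>i\<in>A. \<Sum>j\<in>A. if j = i then adj (f i) * f i else 0)"
    using assms(2) by (intro sum.cong) auto
  also have "\<dots> = (\<Sum>i\<in>A. adj (f i) * f i)" using assms(1) by simp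
  finally show ?thesis by (simp add: norm_sq_tr tr_sum)
qed

lemma norm_spectral_sum:
  assumes "finite A" "\<And>l. l \<in> A \<Longrightarrow> proj (p l)" "\<And>l m. l \<in> A \<Longrightarrow> m \<in> A \<Longrightarrow> l \<noteq> m \<Longrightarrow> p l * p m = 0"
  shows "(norm (\<Sum>l\<in>A. sc (c l) (p l)))\<^sup>2 = (\<Sum>l\<in>A. (cmod (c l))\<^sup>2 * (norm (p l))\<^sup>2)"
  using assms
  by (subst norm_orthogonal_sum) (auto simp: adj_sc proj_def norm_sc power_mult_distrib intro!: sum.cong)

text \<open>The unitary of a polar decomposition, completed on the kernel.\<close>

theorem unitary_near:
  assumes "corner n a"
  obtains u where "unitary n u" "norm (a - u) \<le> norm (adj a * a - idm n)"
proof -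
  have an: "a * idm n = a" "idm n * a = a" using assms by (auto simp: corner_def)
  have an': "adj a * idm n = adj a" "idm n * adj a = adj a" using an by (metis adj_idm adj_mult)+
  have "adj (adj a * a) = adj a * a" by (simp add: adj_mult)
  then obtain \<Lambda> p where L: "finite \<Lambda>" "0 \<notin> \<Lambda>" "\<And>l. l \<in> \<Lambda> \<Longrightarrow> proj (p l)"
    "\<And>l. l \<in> \<Lambda> \<Longrightarrow> p l \<noteq> 0" "\<And>l m. l \<in> \<Lambda> \<Longrightarrow> m \<in> \<Lambda> \<Longrightarrow> l \<noteq> m \<Longrightarrow> p l * p m = 0"
    "adj a * a = (\<Sum>l\<in>\<Lambda>. sc (of_real l) (p l))"
    and hp: "\<And>l. l \<in> \<Lambda> \<Longrightarrow> adj a * a * p l = sc (of_real l) (p l)"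
    by (rule spectral) blast
  have pp: "p l * p m = (if m = l then p l else 0)" if "l \<in> \<Lambda>" "m \<in> \<Lambda>" for l m
    using L that by (auto simp: proj_def)
  have pos: "l > 0" if "l \<in> \<Lambda>" for l
  proof -
    have "adj (a * p l) * (a * p l) = p l * (adj a * a * p l)"
      using L(3)[OF that] by (simp add: adj_mult proj_def mult.assoc)
    also have "\<dots> = sc (of_real l) (p l)" using hp pp that by simp
    finally have "(norm (a * p l))\<^sup>2 = l * (norm (p l))\<^sup>2"
      using tr_proj[OF L(3)[OF that]] by (simp add: norm_sq_tr tr_sc)
    then have "0 \<le> l * (norm (p l))\<^sup>2" by (metis zero_le_power2)
    then show ?thesis using L(2,4) that by (metis less_eq_real_def mult_less_0_iff norm_eq_zero not_less zero_less_power2)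
  qed
  have np: "idm n * p l = p l" "p l * idm n = p l" if "l \<in> \<Lambda>" for l
  proof -
    have "sc (of_real (1 / l)) (idm n * (adj a * a * p l)) = sc (of_real (1 / l)) (adj a * a * p l)"
      by (simp add: mult.assoc mult_extend[OF an'(2)])
    then show 1: "idm n * p l = p l" using hp pos[OF that] that by simp
    then show "p l * idm n = p l" using L(3)[OF that] by (metis adj_idm adj_mult proj_adj)
  qed
  \<comment> \<open>The support projection of \<open>adj a * a\<close>; \<open>idm n - P\<close>
    projects onto the kernel of \<open>a\<close>.\<close>
  define P where "P = (\<Sum>l\<in>\<Lambda>. p l)"
  have Pp: "P * p l = p l" "p l * P = p l" if "l \<in> \<Lambda>" for l
    using that L(1) pp unfolding P_def sum_distrib_left sum_distrib_right by (simp_all add: eq_commute[of l] cong: sum.cong)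
  have P: "proj P"
    unfolding proj_def
  proof
    show "adj P = P" using L(3) by (simp add: P_def adj_sum proj_def)
    have "P * P = (\<Sum>l\<in>\<Lambda>. P * p l)" by (simp add: P_def[symmetric] flip: sum_distrib_left)
    then show "P * P = P" using Pp by (simp add: P_def)
  qed
  have nP: "idm n * P = P" "P * idm n = P"
    using np by (simp_all add: P_def sum_distrib_left sum_distrib_right)
  \<comment> \<open>\<open>a\<close> times the inverse square root of \<open>adj a * a\<close> on
    its support.\<close>
  define v where "v = (\<Sum>l\<in>\<Lambda>. sc (of_real (1 / sqrt l)) (a * p l))"
  have vv: "adj v * v = P"
  proof -
    have "adj v * v = (\<Sum>l\<in>\<Lambda>. \<Sum>m\<in>\<Lambda>. sc (of_real (1 / sqrt m)) (sc (of_real (1 / sqrt l)) (p l * (adj a * a * p m))))"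
      using L(3) by (simp add: v_def adj_sum adj_sc adj_mult proj_def sum_distrib_left sum_distrib_right sc_sum mult.assoc
          del: sc_sc of_real_divide) (rule sum.swap)
    also have "\<dots> = (\<Sum>l\<in>\<Lambda>. \<Sum>m\<in>\<Lambda>. if m = l then p l else 0)"
    proof (intro sum.cong refl)
      fix l m assume lm: "l \<in> \<Lambda>" "m \<in> \<Lambda>"
      show "sc (of_real (1 / sqrt m)) (sc (of_real (1 / sqrt l)) (p l * (adj a * a * p m))) = (if m = l then p l else 0)"
        using pos[OF lm(2)] by (simp add: hp lm pp flip: of_real_mult)
    qed
    also have "\<dots> = P" using L(1) by (simp add: P_def)
    finally show ?thesis .
  qed
  have vP: "v * P = v" by (rule partial_isometry_initial[OF vv P])
  have nv: "idm n * v = v" by (simp add: v_def sum_distrib_left mult.assoc[symmetric] an)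
  note vf = partial_isometry_final[OF vv P]
  have q1: "proj (idm n - P)" by (rule proj_diff) (use P nP in auto)
  have q2: "proj (idm n - v * adj v)"
    by (rule proj_diff) (use vf nv in \<open>auto simp: mult.assoc[symmetric]\<close>)
  \<comment> \<open>Initial and final projection of \<open>v\<close> have equal trace, hence so do
    their complements, and some \<open>w\<close> maps one complement onto the other.\<close>
  have "tr (idm n - P) = tr (idm n - v * adj v)"
    using vv by (simp add: tr_diff tr_mult_comm[of v])
  then obtain w where w: "adj w * w = idm n - P" "w * adj w = idm n - v * adj v"
    using proj_equiv[OF q1 q2] by blast
  have wi: "w * (idm n - P) = w" by (rule partial_isometry_initial[OF w(1) q1])
  have wf: "adj w * (idm n - v * adj v) = adj w" using partial_isometry_final(3)[OF w(1) q1] w(2) by simp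
  have "(idm n - v * adj v) * v = 0" by (simp add: algebra_simps nv) (metis mult.assoc vf(2))
  then have wv: "adj w * v = 0" by (metis mult.assoc mult_zero_right wf)
  then have vw: "adj v * w = 0" by (metis adj_0 adj_adj adj_mult)
  have wP: "w * P = 0"
    using wi P nP by (metis (no_types, lifting) mult.assoc mult_zero_right proj_idem diff_self left_diff_distrib)
  have vw': "v * adj w = 0"
  proof -
    have "P * adj w = 0" using wP P by (metis adj_0 adj_mult proj_adj)
    then show ?thesis by (metis mult.assoc mult_zero_right vP)
  qed
  then have wv': "w * adj v = 0" by (metis adj_0 adj_adj adj_mult)
  define u where "u = v + w"
  have u: "unitary n u"
    by (simp add: unitary_def u_def adj_add algebra_simps vv w wv vw wv' vw')
  \<comment> \<open>The modulus of \<open>a\<close>, so that \<open>a = v * S\<close> and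
    \<open>a - u = u * (S - idm n)\<close>.\<close>
  define S where "S = (\<Sum>l\<in>\<Lambda>. sc (of_real (sqrt l)) (p l))"
  have "a * (idm n - P) = 0"
  proof -
    have hP: "adj a * a * P = adj a * a"
      using hp by (simp add: P_def sum_distrib_left L(6)[symmetric])
    have "adj (a * (idm n - P)) * (a * (idm n - P)) = (idm n - P) * (adj a * a * (idm n - P))"
      using q1 by (simp add: adj_mult proj_def mult.assoc)
    also have "adj a * a * (idm n - P) = 0"
      using hP by (simp add: right_diff_distrib) (simp add: mult.assoc an)
    finally show ?thesis by simp
  qed
  then have aP: "a * P = a" by (simp add: right_diff_distrib an)
  have vS: "v * S = a"
  proof -
    have "v * S = (\<Sum>l\<in>\<Lambda>. \<Sum>m\<in>\<Lambda>. sc (of_real (sqrt m)) (sc (of_real (1 / sqrt l)) (a * (p l * p m))))"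
      by (simp add: v_def S_def sum_distrib_left sum_distrib_right sc_sum mult.assoc del: sc_sc of_real_divide) (rule sum.swap)
    also have "\<dots> = (\<Sum>l\<in>\<Lambda>. \<Sum>m\<in>\<Lambda>. if m = l then a * p l else 0)"
    proof (intro sum.cong refl)
      fix l m assume lm: "l \<in> \<Lambda>" "m \<in> \<Lambda>"
      show "sc (of_real (sqrt m)) (sc (of_real (1 / sqrt l)) (a * (p l * p m))) = (if m = l then a * p l else 0)"
        using pos[OF lm(2)] by (simp add: pp lm flip: of_real_mult)
    qed
    also have "\<dots> = a * P" using L(1) by (simp add: P_def sum_distrib_left)
    finally show ?thesis by (simp add: aP)
  qed
  have PS: "P * S = S" using Pp by (simp add: S_def sum_distrib_left)
  have wS: "w * S = 0" by (metis PS mult.assoc mult_zero_left wP)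
  have ua: "a - u = u * (S - idm n)"
    using unitaryD(3)[OF u] by (simp add: right_diff_distrib) (simp add: u_def distrib_right vS wS)
  \<comment> \<open>\<open>S\<close> and \<open>adj a * a\<close> are diagonal for the same
    projections. With the square root and the identity for \<open>c\<close> this computes both
    distances to \<open>idm n\<close>, with the same contribution of the kernel.\<close>
  have dist: "(norm ((\<Sum>l\<in>\<Lambda>. sc (of_real (c l)) (p l)) - idm n))\<^sup>2
      = (\<Sum>l\<in>\<Lambda>. (c l - 1)\<^sup>2 * (norm (p l))\<^sup>2) + (norm (idm n - P))\<^sup>2" for c :: "real \<Rightarrow> real"
  proof -
    let ?x = "\<Sum>l\<in>\<Lambda>. sc (of_real (c l - 1)) (p l)"
    have x: "(\<Sum>l\<in>\<Lambda>. sc (of_real (c l)) (p l)) - idm n = ?x - (idm n - P)"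
      by (simp add: P_def sc_diff_left sum_subtractf)
    have Px: "P * (?x - (idm n - P)) = ?x"
    proof -
      have "P * ?x = ?x" using Pp by (simp add: sum_distrib_left)
      moreover have "P * (idm n - P) = 0" using nP P by (simp add: right_diff_distrib proj_def)
      ultimately show ?thesis by (simp only: right_diff_distrib diff_zero)
    qed
    have "(norm (?x - (idm n - P)))\<^sup>2 = (norm ?x)\<^sup>2 + (norm (?x - (idm n - P) - ?x))\<^sup>2"
      using proj_pythagoras[OF P, of "?x - (idm n - P)"] Px by simp
    also have "norm (?x - (idm n - P) - ?x) = norm (idm n - P)"
    proof -
      have "norm (y - r - y) = norm r" for y r :: fmat by simp
      then show ?thesis .
    qed
    also have "(norm ?x)\<^sup>2 = (\<Sum>l\<in>\<Lambda>. (cmod (of_real (c l - 1)))\<^sup>2 * (norm (p l))\<^sup>2)"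
      by (rule norm_spectral_sum) (use L(1,3,5) in blast)+
    also have "\<dots> = (\<Sum>l\<in>\<Lambda>. (c l - 1)\<^sup>2 * (norm (p l))\<^sup>2)"
      by (simp only: norm_of_real power2_abs)
    finally show ?thesis by (simp only: x)
  qed
  have "(norm (S - idm n))\<^sup>2 \<le> (norm (adj a * a - idm n))\<^sup>2"
    unfolding S_def L(6) dist
  proof (intro add_right_mono sum_mono mult_right_mono)
    fix l assume "l \<in> \<Lambda>"
    then have "l > 0" by (rule pos)
    \<comment> \<open>From \<open>l - 1 = (sqrt l - 1) * (sqrt l + 1)\<close>: the square root is at
      least as close to 1 as \<open>l\<close>.\<close>
    then have "(l - 1)\<^sup>2 = (sqrt l - 1)\<^sup>2 * (sqrt l + 1)\<^sup>2"
      by (simp add: algebra_simps flip: power_mult_distrib)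
    moreover have "(sqrt l - 1)\<^sup>2 * 1 \<le> (sqrt l - 1)\<^sup>2 * (sqrt l + 1)\<^sup>2"
      using \<open>l > 0\<close> by (intro mult_left_mono one_le_power zero_le_power2) simp
    ultimately show "(sqrt l - 1)\<^sup>2 \<le> (l - 1)\<^sup>2" by simp
  qed auto
  then have "norm (S - idm n) \<le> norm (adj a * a - idm n)" by (rule power2_le_imp_le) simp
  then have "norm (a - u) \<le> norm (adj a * a - idm n)"
    using unitary_norm_le(1)[OF u, of "S - idm n"] ua by simp
  with u show thesis by (rule that)
qed

section \<open>Structure of commutants\<close>

text \<open>\<open>e\<close> plays the part of the unit: besides the full commutant, with
  \<open>e = idm d\<close>, its corners under projections are needed.\<close>

definition commutant :: "fmat set \<Rightarrow> fmat \<Rightarrow> fmat set"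
  where "commutant C e = {x. e * x = x \<and> x * e = x \<and> (\<forall>c\<in>C. x * c = c * x)}"

lemma proj_norm_ge_1:
  assumes "proj p" "p \<noteq> 0"
  shows "1 \<le> (norm p)\<^sup>2"
proof -
  obtain m w where w: "adj w * w = idm m" "w * adj w = p"
    using proj_coordinates[OF assms(1)] by blast
  have "(norm p)\<^sup>2 = real m" by (rule coordinates_norm[OF w])
  moreover have "m \<noteq> 0" using calculation assms(2) by (intro notI) simp
  ultimately show ?thesis by simp
qed

lemma orthogonal_family_norm:
  assumes "finite F" "\<forall>p\<in>F. proj p" "\<forall>p\<in>F. \<forall>q\<in>F. p \<noteq> q \<longrightarrow> p * q = 0"
  shows "(norm (\<Sum>F))\<^sup>2 = (\<Sum>p\<in>F. (norm p)\<^sup>2)"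
  using norm_orthogonal_sum[of F "\<lambda>p. p"] assms by (simp add: proj_def)

lemma orthogonal_family_mult:
  assumes "finite F" "\<forall>p\<in>F. proj p" "\<forall>p\<in>F. \<forall>q\<in>F. p \<noteq> q \<longrightarrow> p * q = 0" "q \<in> F"
  shows "\<Sum>F * q = q" "q * \<Sum>F = q"
proof -
  have "\<Sum>F * q = (\<Sum>p\<in>F. if p = q then q else 0)"
    unfolding sum_distrib_right using assms by (intro sum.cong) (auto simp: proj_def)
  then show "\<Sum>F * q = q" using assms by simp
  have "q * \<Sum>F = (\<Sum>p\<in>F. if p = q then q else 0)"
    unfolding sum_distrib_left using assms by (intro sum.cong) (auto simp: proj_def)
  then show "q * \<Sum>F = q" using assms by simp
qed

text \<open>A set with nonzero members rather than a family, so that its cardinality is bounded by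
  the rank of \<open>e\<close>.\<close>

definition orthogonal_partition :: "fmat set \<Rightarrow> fmat \<Rightarrow> fmat set \<Rightarrow> bool"
  where "orthogonal_partition M e F \<longleftrightarrow> finite F \<and> F \<subseteq> M \<and> (\<forall>p\<in>F. proj p \<and> p \<noteq> 0) \<and>
    (\<forall>p\<in>F. \<forall>q\<in>F. p \<noteq> q \<longrightarrow> p * q = 0) \<and> \<Sum>F = e"

text \<open>The formulas for \<open>h\<close> and \<open>k\<close> are returned because membership
  in an algebra is read off from them.\<close>

lemma fmat_cartesian:
  obtains h k where "x = h + sc \<i> k" "adj h = h" "adj k = k"
    "h = sc (1 / 2) (x + adj x)" "k = sc (- \<i> / 2) (x - adj x)"
proof
  show "x = sc (1 / 2) (x + adj x) + sc \<i> (sc (- \<i> / 2) (x - adj x))"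
    by (simp add: sc_add_right sc_diff_right algebra_simps flip: sc_add_left)
  show "adj (sc (1 / 2) (x + adj x)) = sc (1 / 2) (x + adj x)"
    by (simp add: adj_sc adj_add add.commute)
  show "adj (sc (- \<i> / 2) (x - adj x)) = sc (- \<i> / 2) (x - adj x)"
    by (rule fmat_eqI) (simp add: adj_sc adj_diff sc.rep_eq ent_minus algebra_simps)
qed simp_all

locale star_commutant =
  fixes C :: "fmat set" and e :: fmat
  assumes e: "proj e" and C_adj: "c \<in> C \<Longrightarrow> adj c \<in> C" and C_e: "c \<in> C \<Longrightarrow> e * c = c * e"
begin

abbreviation "M \<equiv> commutant C e"

lemma M_I: "e * x = x \<Longrightarrow> x * e = x \<Longrightarrow> (\<And>c. c \<in> C \<Longrightarrow> x * c = c * x) \<Longrightarrow> x \<in> M"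
  by (simp add: commutant_def)

lemma M_D: "x \<in> M \<Longrightarrow> e * x = x" "x \<in> M \<Longrightarrow> x * e = x" "x \<in> M \<Longrightarrow> c \<in> C \<Longrightarrow> x * c = c * x"
  by (simp_all add: commutant_def)

lemma e_M: "e \<in> M"
  using e C_e by (simp add: commutant_def proj_def)

lemma M_add: "x \<in> M \<Longrightarrow> y \<in> M \<Longrightarrow> x + y \<in> M"
  by (simp add: commutant_def distrib_left distrib_right)

lemma M_diff: "x \<in> M \<Longrightarrow> y \<in> M \<Longrightarrow> x - y \<in> M"
  by (simp add: commutant_def left_diff_distrib right_diff_distrib)

lemma M_sc: "x \<in> M \<Longrightarrow> sc c x \<in> M"
  by (simp add: commutant_def)

lemma M_mult:
  assumes "x \<in> M" "y \<in> M"
  shows "x * y \<in> M"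
proof (rule M_I)
  show "e * (x * y) = x * y" "x * y * e = x * y"
    using assms by (simp_all add: mult_extend[OF M_D(1)] mult.assoc M_D)
  show "x * y * c = c * (x * y)" if "c \<in> C" for c
    using M_D(3)[OF assms(1) that] M_D(3)[OF assms(2) that] by (metis mult.assoc)
qed

lemma M_adj:
  assumes "x \<in> M"
  shows "adj x \<in> M"
proof (rule M_I)
  show "e * adj x = adj x" "adj x * e = adj x"
    using M_D(1,2)[OF assms] e by (metis adj_mult proj_adj)+
  show "adj x * c = c * adj x" if "c \<in> C" for c
    using M_D(3)[OF assms C_adj[OF that]] by (metis adj_adj adj_mult)
qed

lemma M_sum: "(\<And>i. i \<in> A \<Longrightarrow> f i \<in> M) \<Longrightarrow> sum f A \<in> M"
proof (induction A rule: infinite_finite_induct)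
  case (insert x A)
  then show ?case by (simp add: M_add)
qed (use M_sc[OF e_M, of 0] in simp_all)

text \<open>Each member has rank at least 1; the bound allows a partition of maximal cardinality to
  be chosen.\<close>

lemma partition_card:
  assumes "orthogonal_partition M e F"
  shows "real (card F) \<le> (norm e)\<^sup>2"
proof -
  have "real (card F) = (\<Sum>p\<in>F. 1)" by simp
  also have "\<dots> \<le> (\<Sum>p\<in>F. (norm p)\<^sup>2)"
    using assms proj_norm_ge_1 by (intro sum_mono) (auto simp: orthogonal_partition_def)
  also have "\<dots> = (norm e)\<^sup>2"
    using assms orthogonal_family_norm[of F] by (auto simp: orthogonal_partition_def)
  finally show ?thesis .
qed

text \<open>An orthogonal partition of \<open>e\<close> of maximal cardinality consists of minimal projections:
  a spectral projection of a non-scalar corner element would split a member.\<close>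

theorem minimal_partition:
  obtains F where "orthogonal_partition M e F"
    "\<And>p x. p \<in> F \<Longrightarrow> x \<in> M \<Longrightarrow> \<exists>c. p * x * p = sc c p"
proof -
  have ex: "orthogonal_partition M e (if e = 0 then {} else {e})"
    using e e_M by (simp add: orthogonal_partition_def)
  have bd: "\<forall>F. orthogonal_partition M e F \<longrightarrow> card F < Suc (nat \<lceil>(norm e)\<^sup>2\<rceil>)"
    using partition_card by (meson less_Suc_eq_le of_nat_le_iff order_trans real_nat_ceiling_ge)
  obtain F where F: "orthogonal_partition M e F"
    and mx: "\<And>F'. orthogonal_partition M e F' \<Longrightarrow> card F' \<le> card F"
    using ex_has_greatest_nat[OF ex bd] by blast
  have F': "finite F" "F \<subseteq> M" "\<And>p. p \<in> F \<Longrightarrow> proj p" "\<And>p. p \<in> F \<Longrightarrow> p \<noteq> 0"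
    "\<And>p q. p \<in> F \<Longrightarrow> q \<in> F \<Longrightarrow> p \<noteq> q \<Longrightarrow> p * q = 0" "\<Sum>F = e"
    using F by (auto simp: orthogonal_partition_def)
  \<comment> \<open>Hermitian \<open>x\<close> first, since these have spectral projections; the end
    of the proof combines real and imaginary part.\<close>
  have herm: "\<exists>c. p * x * p = sc c p" if p: "p \<in> F" and x: "x \<in> M" "adj x = x" for p x
  proof -
    let ?T = "p * x * p"
    have pM: "p \<in> M" using p F' by auto
    have pp: "p * p = p" "adj p = p" using F'(3)[OF p] by (auto simp: proj_def)
    have TM: "?T \<in> M" using pM x by (intro M_mult)
    have Tp: "p * ?T = ?T" "?T * p = ?T" by (simp_all add: mult.assoc pp mult_extend[OF pp(1)])
    have "adj ?T = ?T" using pp x by (simp add: adj_mult mult.assoc)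
    then obtain L f where L: "finite L" "0 \<notin> L" "\<And>l. l \<in> L \<Longrightarrow> proj (f l)"
      "\<And>l. l \<in> L \<Longrightarrow> f l \<noteq> 0" "\<And>l m. l \<in> L \<Longrightarrow> m \<in> L \<Longrightarrow> l \<noteq> m \<Longrightarrow> f l * f m = 0"
      "?T = (\<Sum>l\<in>L. sc (of_real l) (f l))"
      "\<And>x l. l \<in> L \<Longrightarrow> x * ?T = ?T * x \<Longrightarrow> x * f l = f l * x"
      "\<And>l. l \<in> L \<Longrightarrow> ?T * f l = sc (of_real l) (f l)"
      by (rule spectral) blast
    show ?thesis
    proof (cases "L = {}")
      case True
      then show ?thesis using L(6) by (intro exI[of _ 0]) simp
    next
      case False
      then obtain l where l: "l \<in> L" by blast
      note Tf = L(8)[OF l]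
      have l0: "l \<noteq> 0" using l L(2) by blast
      have pf: "p * f l = f l"
      proof -
        have "p * sc (of_real l) (f l) = sc (of_real l) (f l)"
          by (simp only: Tf[symmetric] mult.assoc[symmetric]) (simp only: mult.assoc Tp mult_extend[OF pp(1)])
        then have "sc (of_real (1 / l)) (p * sc (of_real l) (f l)) = sc (of_real (1 / l)) (sc (of_real l) (f l))"
          by simp
        then show ?thesis using l0 by simp
      qed
      have fM: "f l \<in> M"
      proof (rule M_I)
        show "e * f l = f l" using M_D(1)[OF pM] pf by (metis mult.assoc)
        have "e * ?T = ?T * e" using M_D(1,2)[OF TM] by simp
        from L(7)[OF l this] show "f l * e = f l" using \<open>e * f l = f l\<close> by simp
        show "f l * c = c * f l" if "c \<in> C" for c
          using L(7)[OF l, of c] M_D(3)[OF TM that] by simp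
      qed
      show ?thesis
      proof (cases "f l = p")
        case True
        then show ?thesis using Tf Tp by (intro exI[of _ "of_real l"]) simp
      next
        case False
        note fl = L(3)[OF l] L(4)[OF l]
        have d: "proj (p - f l)" "f l * p = f l" using proj_diff[OF F'(3)[OF p] fl(1) pf] by auto
        have ff: "f l * f l = f l" using fl(1) by (simp add: proj_def)
        have pq: "f l * q = 0" "q * f l = 0" if "q \<in> F" "q \<noteq> p" for q
        proof -
          have "f l * q = f l * p * q" by (simp add: d)
          then show "f l * q = 0" using F'(5)[OF p that(1)] that(2) by (simp add: mult.assoc)
          have "q * f l = q * p * f l" by (simp add: pf mult.assoc)
          then show "q * f l = 0" using F'(5)[OF that(1) p that(2)] by simp
        qed
        have n1: "f l \<notin> F" using F'(5)[OF _ p, of "f l"] False d(2) fl(2) by auto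
        have n2: "p - f l \<notin> F - {p}"
        proof
          assume "p - f l \<in> F - {p}"
          then have "(p - f l) * p = 0" using F'(5)[OF _ p] by auto
          then show False using False by (simp add: left_diff_distrib pp d)
        qed
        have n3: "f l \<noteq> p - f l"
        proof
          assume "f l = p - f l"
          then have "f l * f l = f l * (p - f l)" by simp
          then show False using ff d fl(2) by (simp add: right_diff_distrib)
        qed
        \<comment> \<open>The refinement of \<open>F\<close> that splits \<open>p\<close>;
          \<open>n1\<close>, \<open>n2\<close> and \<open>n3\<close> ensure that it has one member
          more.\<close>
        let ?F = "insert (f l) (insert (p - f l) (F - {p}))"
        have "orthogonal_partition M e ?F"
          unfolding orthogonal_partition_def
        proof (intro conjI)
          show "finite ?F" using F' by simp
          show "?F \<subseteq> M" using F'(2) fM pM M_diff by auto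
          show "\<forall>q\<in>?F. proj q \<and> q \<noteq> 0" using F'(3,4) fl d False by auto
          show "\<forall>q\<in>?F. \<forall>r\<in>?F. q \<noteq> r \<longrightarrow> q * r = 0"
            using pq F'(5) p by (auto simp: left_diff_distrib right_diff_distrib pf d ff)
          have "\<Sum>?F = f l + (p - f l + \<Sum>(F - {p}))"
            using F'(1) n1 n2 n3 by simp
          then show "\<Sum>?F = e" using F'(1,6) p by (simp add: sum.remove)
        qed
        moreover have "card ?F = Suc (card F)"
        proof -
          have "card F > 0" using p F'(1) by (auto simp: card_gt_0_iff)
          then show ?thesis using F'(1) n1 n2 n3 p by simp
        qed
        ultimately show ?thesis using mx by fastforce
      qed
    qed
  qed
  show thesis
  proof (rule that[OF F])
    fix p x assume p: "p \<in> F" and x: "x \<in> M"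
    obtain h k where hk: "x = h + sc \<i> k" "adj h = h" "adj k = k"
      "h = sc (1 / 2) (x + adj x)" "k = sc (- \<i> / 2) (x - adj x)" by (rule fmat_cartesian)
    have "h \<in> M" "k \<in> M" using hk(4,5) x M_adj M_add M_diff M_sc by auto
    then obtain a b where "p * h * p = sc a p" "p * k * p = sc b p" using herm p hk(2,3) by blast
    then have "p * x * p = sc (a + \<i> * b) p"
      by (simp add: hk(1) distrib_left distrib_right sc_add_left)
    then show "\<exists>c. p * x * p = sc c p" ..
  qed
qed

end

section \<open>Direct sums of matrix algebras with multiplicities\<close>

text \<open>Coordinates adapted to a direct sum of matrix algebras: \<open>J p\<close> is the
  isometry onto copy \<open>p\<close>, and copies of the same class \<open>\<kappa> p\<close> have
  the same size and will carry the same matrix.\<close>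

locale frame =
  fixes F :: "'i set" and \<kappa> :: "'i \<Rightarrow> 'c" and m :: "'c \<Rightarrow> nat" and J :: "'i \<Rightarrow> fmat" and d :: nat
  assumes finite_F: "finite F"
    and J_orth: "p \<in> F \<Longrightarrow> q \<in> F \<Longrightarrow> adj (J p) * J q = (if p = q then idm (m (\<kappa> p)) else 0)"
    and J_sum: "(\<Sum>p\<in>F. J p * adj (J p)) = idm d"
begin

definition block :: "('c \<Rightarrow> fmat) \<Rightarrow> fmat"
  where "block t = (\<Sum>p\<in>F. J p * t (\<kappa> p) * adj (J p))"

text \<open>Values of \<open>t\<close> at classes that do not occur are left free.\<close>

definition blocks :: "('c \<Rightarrow> fmat) set"
  where "blocks = {t. \<forall>p\<in>F. corner (m (\<kappa> p)) (t (\<kappa> p))}"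

lemma J_idm: "p \<in> F \<Longrightarrow> J p * idm (m (\<kappa> p)) = J p" "p \<in> F \<Longrightarrow> idm (m (\<kappa> p)) * adj (J p) = adj (J p)"
proof -
  assume "p \<in> F"
  then show *: "J p * idm (m (\<kappa> p)) = J p" by (intro partial_isometry_initial) (simp_all add: J_orth)
  then show "idm (m (\<kappa> p)) * adj (J p) = adj (J p)" by (metis adj_idm adj_mult)
qed

lemma J_d: "p \<in> F \<Longrightarrow> idm d * J p = J p" "p \<in> F \<Longrightarrow> adj (J p) * idm d = adj (J p)"
proof -
  assume p: "p \<in> F"
  have "idm d * J p = (\<Sum>q\<in>F. if q = p then J p else 0)"
    unfolding J_sum[symmetric] sum_distrib_right
    by (rule sum.cong) (use p J_idm in \<open>auto simp: mult.assoc J_orth\<close>)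
  then show *: "idm d * J p = J p" using p finite_F by simp
  then show "adj (J p) * idm d = adj (J p)" by (metis adj_idm adj_mult)
qed

lemma block_mult:
  assumes "s \<in> blocks"
  shows "block s * block t = block (\<lambda>r. s r * t r)"
proof -
  have "block s * block t = (\<Sum>p\<in>F. \<Sum>q\<in>F. J p * s (\<kappa> p) * (adj (J p) * J q) * t (\<kappa> q) * adj (J q))"
    by (simp add: block_def sum_distrib_left sum_distrib_right mult.assoc) (rule sum.swap)
  also have "\<dots> = (\<Sum>p\<in>F. \<Sum>q\<in>F. if q = p then J p * (s (\<kappa> p) * t (\<kappa> p)) * adj (J p) else 0)"
  proof (intro sum.cong refl)
    fix p q assume pq: "p \<in> F" "q \<in> F"
    have "s (\<kappa> p) * idm (m (\<kappa> p)) = s (\<kappa> p)"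
      using assms pq by (simp add: blocks_def corner_def)
    then show "J p * s (\<kappa> p) * (adj (J p) * J q) * t (\<kappa> q) * adj (J q) =
        (if q = p then J p * (s (\<kappa> p) * t (\<kappa> p)) * adj (J p) else 0)"
      using pq by (simp add: J_orth mult.assoc mult_extend[of "s (\<kappa> p)" "idm (m (\<kappa> p))"])
  qed
  finally show ?thesis using finite_F by (simp add: block_def)
qed

lemma block_adj: "adj (block t) = block (\<lambda>r. adj (t r))"
  by (simp add: block_def adj_sum adj_mult mult.assoc)

lemma block_diff: "block s - block t = block (\<lambda>r. s r - t r)"
  by (simp add: block_def left_diff_distrib right_diff_distrib sum_subtractf)

lemma block_idm: "block (\<lambda>r. idm (m r)) = idm d"
  by (simp add: block_def J_idm J_sum cong: sum.cong)

lemma block_cong: "(\<And>p. p \<in> F \<Longrightarrow> s (\<kappa> p) = t (\<kappa> p)) \<Longrightarrow> block s = block t"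
  by (simp add: block_def)

text \<open>Cross terms vanish by orthogonality. Each class counts once per copy, which is the
  weight in the later averaging argument.\<close>

lemma norm_block:
  assumes "t \<in> blocks"
  shows "(norm (block t))\<^sup>2 = (\<Sum>p\<in>F. (norm (t (\<kappa> p)))\<^sup>2)"
proof -
  have "tr (adj (block t) * block t) = (\<Sum>p\<in>F. tr (adj (t (\<kappa> p)) * t (\<kappa> p)))"
  proof -
    have "(\<lambda>r. adj (t r)) \<in> blocks"
      using assms by (auto simp: blocks_def corner_def) (metis adj_idm adj_mult)+
    then have "adj (block t) * block t = block (\<lambda>r. adj (t r) * t r)"
      by (simp add: block_adj block_mult)
    moreover have "tr (J p * (adj (t (\<kappa> p)) * t (\<kappa> p)) * adj (J p)) = tr (adj (t (\<kappa> p)) * t (\<kappa> p))" if "p \<in> F" for p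
    proof -
      have "tr (J p * (adj (t (\<kappa> p)) * t (\<kappa> p)) * adj (J p)) = tr (adj (J p) * J p * (adj (t (\<kappa> p)) * t (\<kappa> p)))"
        by (metis mult.assoc tr_mult_comm)
      also have "\<dots> = tr (adj (t (\<kappa> p)) * (t (\<kappa> p) * idm (m (\<kappa> p))))"
        using that by (simp add: J_orth) (metis mult.assoc tr_mult_comm)
      finally show ?thesis using assms that by (simp add: blocks_def corner_def)
    qed
    ultimately show ?thesis by (simp add: block_def tr_sum)
  qed
  then show ?thesis by (simp add: norm_sq_tr)
qed

lemma unitary_block:
  assumes "\<And>p. p \<in> F \<Longrightarrow> unitary (m (\<kappa> p)) (t (\<kappa> p))"
  shows "unitary d (block t)"
proof -
  have "t \<in> blocks" "(\<lambda>r. adj (t r)) \<in> blocks"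
    using assms unitary_corner unitary_adj by (auto simp: blocks_def)
  then have "adj (block t) * block t = block (\<lambda>r. idm (m r))" "block t * adj (block t) = block (\<lambda>r. idm (m r))"
    using assms by (auto simp: block_adj block_mult unitary_def intro!: block_cong)
  then show ?thesis by (simp add: unitary_def block_idm)
qed

text \<open>The trace of \<open>J_sum\<close>. For positive \<open>d\<close> it makes
  \<open>m (\<kappa> p) / d\<close> a probability weight on the copies.\<close>

lemma dimension: "(\<Sum>p\<in>F. real (m (\<kappa> p))) = real d"
proof -
  have "tr (idm d) = (\<Sum>p\<in>F. tr (idm (m (\<kappa> p))))"
    unfolding J_sum[symmetric] tr_sum by (rule sum.cong) (simp_all add: tr_mult_comm[of "J _"] J_orth)
  then have "of_nat d = (of_nat (\<Sum>p\<in>F. m (\<kappa> p)) :: complex)" by simp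
  then have "d = (\<Sum>p\<in>F. m (\<kappa> p))" by (simp only: of_nat_eq_iff)
  then show ?thesis by simp
qed

lemma compress_eqI:
  assumes "idm d * x = x" "x * idm d = x" "idm d * y = y" "y * idm d = y"
    and "\<And>p q. p \<in> F \<Longrightarrow> q \<in> F \<Longrightarrow> adj (J p) * x * J q = adj (J p) * y * J q"
  shows "x = y"
proof -
  have *: "z = (\<Sum>p\<in>F. \<Sum>q\<in>F. J p * (adj (J p) * z * J q) * adj (J q))" if "idm d * z = z" "z * idm d = z" for z
  proof -
    have "z = idm d * z * idm d" using that by simp
    also have "\<dots> = (\<Sum>p\<in>F. \<Sum>q\<in>F. J p * (adj (J p) * z * J q) * adj (J q))"
      unfolding J_sum[symmetric] by (simp add: sum_distrib_left sum_distrib_right mult.assoc) (rule sum.swap)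
    finally show ?thesis .
  qed
  show ?thesis
    by (subst *[OF assms(1,2)], subst *[OF assms(3,4)]) (intro sum.cong refl, simp add: assms(5))
qed

end

section \<open>The commutant as a direct sum of matrix algebras\<close>

context star_commutant
begin

text \<open>Applied to its own commutant, the locale yields the bicommutant, called
  \<open>N.M\<close> below.\<close>

lemma N_star_commutant: "star_commutant M e"
  by unfold_locales (use e M_adj M_D(1,2) in auto)

text \<open>The commutant \<open>M\<close> is a direct sum of full matrix algebras, each repeated with some
  multiplicity. The copies are indexed by a maximal orthogonal family \<open>F\<close> of minimal projections
  of the bicommutant, and \<open>\<kappa>\<close> picks a representative in each equivalence class.\<close>

theorem commutant_frame:
  assumes ed: "e = idm d"
  obtains F \<kappa> m J where "frame (F :: fmat set) (\<kappa> :: fmat \<Rightarrow> fmat) m J d"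
    "\<And>p. p \<in> F \<Longrightarrow> m (\<kappa> p) \<ge> 1"
    "\<And>t. t \<in> frame.blocks F \<kappa> m \<Longrightarrow> frame.block F \<kappa> J t \<in> M"
    "\<And>x. x \<in> M \<Longrightarrow> \<exists>t\<in>frame.blocks F \<kappa> m. x = frame.block F \<kappa> J t"
proof -
  interpret N: star_commutant M e by (rule N_star_commutant)
  obtain F where F: "orthogonal_partition N.M e F"
    and mini: "\<And>p x. p \<in> F \<Longrightarrow> x \<in> N.M \<Longrightarrow> \<exists>c. p * x * p = sc c p"
    by (rule N.minimal_partition) blast
  have F': "finite F" "\<And>p. p \<in> F \<Longrightarrow> p \<in> N.M" "\<And>p. p \<in> F \<Longrightarrow> proj p" "\<And>p. p \<in> F \<Longrightarrow> p \<noteq> 0"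
    "\<And>p q. p \<in> F \<Longrightarrow> q \<in> F \<Longrightarrow> p \<noteq> q \<Longrightarrow> p * q = 0" "\<Sum>F = e"
    using F by (auto simp: orthogonal_partition_def)
  \<comment> \<open>Murray--von Neumann equivalence inside the bicommutant.\<close>
  define eqv where "eqv r p \<longleftrightarrow> (\<exists>v\<in>N.M. adj v * v = r \<and> v * adj v = p)" for r p
  have eqv_refl: "eqv p p" if "p \<in> F" for p
    using F'(2,3)[OF that] by (auto simp: eqv_def proj_def intro!: bexI[of _ p])
  have eqv_sym: "eqv p r" if "eqv r p" for p r
    using that N.M_adj unfolding eqv_def by (metis adj_adj)
  have eqv_trans: "eqv p s" if h: "eqv p r" "eqv r s" "proj p" "proj r" for p r s
  proof -
    obtain v w where v: "v \<in> N.M" "adj v * v = p" "v * adj v = r"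
      and w: "w \<in> N.M" "adj w * w = r" "w * adj w = s"
      using h(1,2) by (auto simp: eqv_def)
    have rv: "r * v = v" using partial_isometry_final(2)[OF v(2) that(3)] v(3) by simp
    have wr: "w * r = w" by (rule partial_isometry_initial[OF w(2) that(4)])
    have "adj (w * v) * (w * v) = p"
      by (simp add: adj_mult mult.assoc mult_extend[OF w(2)] rv v)
    moreover have "w * v * adj (w * v) = s"
      by (simp add: adj_mult mult.assoc mult_extend[OF v(3)] mult_extend[OF wr] w)
    ultimately show ?thesis using N.M_mult[OF w(1) v(1)] by (auto simp: eqv_def)
  qed
  \<comment> \<open>By minimality the Gram matrix of a nonzero \<open>q * x * p\<close> is a
    positive multiple of \<open>p\<close>. Rescaled, it is a partial isometry from \<open>p\<close>
    onto a projection below \<open>q\<close>, which is \<open>q\<close> by minimality again.\<close>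
  have not_eqv: "q * x * p = 0" if h: "p \<in> F" "q \<in> F" "x \<in> N.M" "\<not> eqv p q" for p q x
  proof (rule ccontr)
    let ?y = "q * x * p"
    assume y: "?y \<noteq> 0"
    have pp: "p * p = p" "adj p = p" "q * q = q" "adj q = q"
      using F'(3) that by (auto simp: proj_def)
    have yM: "?y \<in> N.M" using that F'(2) by (intro N.M_mult) auto
    have "adj ?y * ?y = p * (adj x * q * x) * p"
      by (simp add: adj_mult mult.assoc pp mult_extend[OF pp(3)])
    moreover have "adj x * q * x \<in> N.M" using that F'(2) N.M_adj by (intro N.M_mult) auto
    ultimately obtain c where c: "adj ?y * ?y = sc c p" using mini h(1) by metis
    then have "of_real ((norm ?y)\<^sup>2) = c * of_real ((norm p)\<^sup>2)"
      using tr_adj_mult_real[of ?y] tr_proj[OF F'(3)[OF that(1)]] by (simp add: tr_sc)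
    then have "c = of_real ((norm ?y)\<^sup>2 / (norm p)\<^sup>2)" using F'(4)[OF that(1)] by (simp add: field_simps)
    moreover define r where "r = (norm ?y)\<^sup>2 / (norm p)\<^sup>2"
    ultimately have cr: "c = of_real r" "r > 0" using y F'(4)[OF that(1)] by simp_all
    define v where "v = sc (of_real (1 / sqrt r)) ?y"
    have vM: "v \<in> N.M" unfolding v_def by (rule N.M_sc[OF yM])
    have vv: "adj v * v = p"
      unfolding v_def adj_sc sc_mult_left sc_mult_right c using cr by (simp flip: of_real_mult)
    note vf = partial_isometry_final[OF vv F'(3)[OF that(1)]]
    have "q * v = v" by (simp add: v_def mult.assoc mult_extend[OF pp(3)])
    moreover have "adj v * q = adj v" using calculation pp(4) by (metis adj_mult)
    ultimately have "v * adj v = q * (v * adj v) * q" by (simp add: mult.assoc mult_extend)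
    moreover have "v * adj v \<in> N.M" using vM N.M_adj N.M_mult by blast
    ultimately obtain c' where c': "v * adj v = sc c' q" using mini h(2) by metis
    have "v \<noteq> 0" using vv F'(4)[OF that(1)] by auto
    then have "c' \<noteq> 0" using c' vf(2) by auto
    \<comment> \<open>A projection that is a nonzero multiple of \<open>q\<close> is
      \<open>q\<close> itself, since the factor is idempotent.\<close>
    moreover have "sc (c' * c') q = sc c' q"
      using vf(1) unfolding c' by (simp add: proj_def pp)
    then have "sc (c' * c' - c') q = 0" by (simp add: sc_diff_left)
    then have "c' * c' - c' = 0"
      using F'(4)[OF that(2)] norm_sc[of "c' * c' - c'" q] by simp
    ultimately have "c' = 1" by simp
    then have "eqv p q" using vM vv c' by (auto simp: eqv_def)
    then show False using that(4) by simp
  qed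
  \<comment> \<open>Equivalent members satisfy the same predicate under \<open>SOME\<close> and so
    get the very same representative.\<close>
  define \<kappa> where "\<kappa> p = (SOME r. r \<in> F \<and> eqv r p)" for p
  have \<kappa>: "\<kappa> p \<in> F" "eqv (\<kappa> p) p" if "p \<in> F" for p
    using someI[of "\<lambda>r. r \<in> F \<and> eqv r p" p] eqv_refl[OF that] that by (auto simp: \<kappa>_def)
  have \<kappa>_eq: "\<kappa> p = \<kappa> q" if "p \<in> F" "q \<in> F" "eqv p q" for p q
  proof -
    have "r \<in> F \<and> eqv r p \<longleftrightarrow> r \<in> F \<and> eqv r q" for r
      using that eqv_sym eqv_trans F'(3) by blast
    then show ?thesis by (simp add: \<kappa>_def)
  qed
  have "\<forall>p\<in>F. \<exists>v\<in>N.M. adj v * v = \<kappa> p \<and> v * adj v = p" using \<kappa>(2) by (simp add: eqv_def)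
  then obtain v where v: "\<And>p. p \<in> F \<Longrightarrow> v p \<in> N.M" "\<And>p. p \<in> F \<Longrightarrow> adj (v p) * v p = \<kappa> p"
    "\<And>p. p \<in> F \<Longrightarrow> v p * adj (v p) = p" by metis
  have "\<forall>r\<in>F. \<exists>m w. adj w * w = idm m \<and> w * adj w = r" using proj_coordinates F'(3) by blast
  then obtain m w where w: "\<And>r. r \<in> F \<Longrightarrow> adj (w r) * w r = idm (m r)" "\<And>r. r \<in> F \<Longrightarrow> w r * adj (w r) = r"
    by metis
  \<comment> \<open>Coordinates are chosen once, on the representative, and transported by
    \<open>v p\<close>; this makes elements of the commutant look alike in all copies of a
    class.\<close>
  define J where "J p = v p * w (\<kappa> p)" for p
  have m1: "m r \<ge> 1" if "r \<in> F" for r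
  proof (rule ccontr)
    assume "\<not> m r \<ge> 1"
    then have "m r = 0" by simp
    then have "adj (w r) * w r = 0" using w(1)[OF that] by simp
    then show False using w(2)[OF that] F'(4)[OF that] by auto
  qed
  have wr: "r * w r = w r" if "r \<in> F" for r
    using partial_isometry_final(2)[OF w(1)[OF that]] w(2)[OF that] by simp
  have wr': "adj (w r) * r = adj (w r)" if "r \<in> F" for r
    using wr[OF that] F'(3)[OF that] by (metis adj_mult proj_adj)
  have pv: "p * v p = v p" if "p \<in> F" for p
    using partial_isometry_final(2)[OF v(2)[OF that]] v(3)[OF that] F'(3)[OF \<kappa>(1)[OF that]] by simp
  have vp: "adj (v p) * p = adj (v p)" if "p \<in> F" for p
    using pv[OF that] F'(3)[OF that] by (metis adj_mult proj_adj)
  have vk: "v p * \<kappa> p = v p" if "p \<in> F" for p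
    by (rule partial_isometry_initial) (use that v F'(3) \<kappa>(1) in auto)
  have vv0: "adj (v p) * v q = 0" if "p \<in> F" "q \<in> F" "p \<noteq> q" for p q
  proof -
    have "adj (v p) * v q = adj (v p) * (p * q) * v q"
      by (simp add: mult.assoc pv that) (simp add: mult.assoc[symmetric] vp that)
    then show ?thesis using F'(5) that by simp
  qed
  interpret fr: frame F \<kappa> m J d
  proof
    show "finite F" by (rule F')
    show "adj (J p) * J q = (if p = q then idm (m (\<kappa> p)) else 0)" if "p \<in> F" "q \<in> F" for p q
    proof (cases "p = q")
      case True
      have "adj (J p) * J p = adj (w (\<kappa> p)) * (adj (v p) * v p) * w (\<kappa> p)"
        by (simp add: J_def adj_mult mult.assoc)
      then show ?thesis using True that v(2) \<kappa>(1) wr w(1) by (simp add: mult.assoc)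
    next
      case False
      have "adj (J p) * J q = adj (w (\<kappa> p)) * (adj (v p) * v q) * w (\<kappa> q)"
        by (simp add: J_def adj_mult mult.assoc)
      then show ?thesis using False vv0[OF that False] by simp
    qed
    have "J p * adj (J p) = p" if "p \<in> F" for p
    proof -
      have "J p * adj (J p) = v p * (w (\<kappa> p) * adj (w (\<kappa> p))) * adj (v p)"
        by (simp add: J_def adj_mult mult.assoc)
      then show ?thesis using that w(2) \<kappa>(1) vk v(3) by simp
    qed
    then show "(\<Sum>p\<in>F. J p * adj (J p)) = idm d" using F'(6) ed by simp
  qed
  \<comment> \<open>The bicommutant acts between copies by scalars, by minimality within a class and
    by \<open>not_eqv\<close> across classes. Blocks, which repeat one matrix in all copies of a
    class, commute with such an action.\<close>
  have JN: "\<exists>c. adj (J p) * y * J q = sc c (idm (m (\<kappa> p))) \<and> (\<kappa> p \<noteq> \<kappa> q \<longrightarrow> c = 0)"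
    if h: "p \<in> F" "q \<in> F" "y \<in> N.M" for p q y
  proof -
    define z where "z = adj (v p) * y * v q"
    have zM: "z \<in> N.M" unfolding z_def using v(1) that N.M_adj by (intro N.M_mult) auto
    have J: "adj (J p) * y * J q = adj (w (\<kappa> p)) * (\<kappa> p * z * \<kappa> q) * w (\<kappa> q)"
      using that \<kappa>(1) by (simp add: J_def z_def adj_mult mult.assoc wr) (simp add: mult.assoc[symmetric] wr')
    show ?thesis
    proof (cases "\<kappa> p = \<kappa> q")
      case True
      obtain c where "\<kappa> p * z * \<kappa> p = sc c (\<kappa> p)" using mini[OF \<kappa>(1)[OF h(1)] zM] by blast
      then show ?thesis using True \<kappa>(1) that J by (simp add: wr w(1) mult.assoc wr') blast
    next
      case False
      have "\<not> eqv (\<kappa> q) (\<kappa> p)"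
      proof
        assume *: "eqv (\<kappa> q) (\<kappa> p)"
        have "\<kappa> (\<kappa> r) = \<kappa> r" if "r \<in> F" for r using \<kappa>_eq[OF \<kappa>(1)[OF that] that \<kappa>(2)[OF that]] .
        then show False using \<kappa>_eq[OF _ _ *] \<kappa>(1) that False by metis
      qed
      then have "\<kappa> p * z * \<kappa> q = 0" by (intro not_eqv) (use \<kappa>(1) that zM in auto)
      then show ?thesis using J by (intro exI[of _ 0]) simp
    qed
  qed
  show thesis
  proof (rule that[of F \<kappa> m J])
    show "frame F \<kappa> m J d" by (rule fr.frame_axioms)
    show "m (\<kappa> p) \<ge> 1" if "p \<in> F" for p using m1 \<kappa>(1) that by blast
    show "fr.block t \<in> M" if t: "t \<in> fr.blocks" for t
    proof -
      have tc: "idm (m (\<kappa> p)) * t (\<kappa> p) = t (\<kappa> p)" "t (\<kappa> p) * idm (m (\<kappa> p)) = t (\<kappa> p)" if "p \<in> F" for p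
        using t that by (auto simp: fr.blocks_def corner_def)
      have d1: "idm d * fr.block t = fr.block t" "fr.block t * idm d = fr.block t"
        by (simp_all add: fr.block_def sum_distrib_left sum_distrib_right mult.assoc fr.J_d
            mult_extend[OF fr.J_d(1)] cong: sum.cong)
      have J1: "adj (J p) * fr.block t = t (\<kappa> p) * adj (J p)" if "p \<in> F" for p
      proof -
        have "adj (J p) * fr.block t = (\<Sum>q\<in>F. if q = p then t (\<kappa> p) * adj (J p) else 0)"
          unfolding fr.block_def sum_distrib_left
          by (rule sum.cong) (use that in \<open>auto simp: mult.assoc mult_extend[OF fr.J_orth] mult_extend[OF tc(1)]\<close>)
        then show ?thesis using that F'(1) by simp
      qed
      have J2: "fr.block t * J p = J p * t (\<kappa> p)" if "p \<in> F" for p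
      proof -
        have "fr.block t * J p = (\<Sum>q\<in>F. if q = p then J p * t (\<kappa> p) else 0)"
          unfolding fr.block_def sum_distrib_right
          by (rule sum.cong) (use that in \<open>auto simp: mult.assoc fr.J_orth tc(2)\<close>)
        then show ?thesis using that F'(1) by simp
      qed
      have comm: "fr.block t * y = y * fr.block t" if y: "y \<in> N.M" for y
      proof (rule fr.compress_eqI)
        have ey: "idm d * y = y" "y * idm d = y" using N.M_D(1,2)[OF y] ed by auto
        show "idm d * (fr.block t * y) = fr.block t * y" "fr.block t * y * idm d = fr.block t * y"
          "idm d * (y * fr.block t) = y * fr.block t" "y * fr.block t * idm d = y * fr.block t"
          by (simp_all add: mult.assoc ey d1 mult_extend[OF d1(1)] mult_extend[OF ey(1)])
        fix p q assume pq: "p \<in> F" "q \<in> F"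
        obtain c where c: "adj (J p) * y * J q = sc c (idm (m (\<kappa> p)))" "\<kappa> p \<noteq> \<kappa> q \<longrightarrow> c = 0"
          using JN[OF pq y] by blast
        have "adj (J p) * (fr.block t * y) * J q = t (\<kappa> p) * (adj (J p) * y * J q)"
          by (simp add: mult.assoc[symmetric] J1 pq)
        also have "\<dots> = (adj (J p) * y * J q) * t (\<kappa> q)"
          unfolding c(1) using c(2) tc pq by (cases "\<kappa> p = \<kappa> q") auto
        also have "\<dots> = adj (J p) * (y * fr.block t) * J q"
          by (simp add: mult.assoc J2 pq)
        finally show "adj (J p) * (fr.block t * y) * J q = adj (J p) * (y * fr.block t) * J q" .
      qed
      show ?thesis
      proof (rule M_I)
        show "e * fr.block t = fr.block t" "fr.block t * e = fr.block t" using d1 ed by auto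
        \<comment> \<open>\<open>c\<close> may reach outside the corner of \<open>e\<close>; its
          compression \<open>e * c\<close> lies in the bicommutant, and \<open>fr.block t\<close>
          sees nothing else of \<open>c\<close>.\<close>
        fix c assume c: "c \<in> C"
        have ee: "e * e = e" using e by (simp add: proj_def)
        have "e * c \<in> N.M"
        proof (rule N.M_I)
          show "e * (e * c) = e * c" by (simp add: mult.assoc[symmetric] ee)
          show "e * c * e = e * c" by (metis C_e[OF c] ee mult.assoc)
          show "e * c * x = x * (e * c)" if "x \<in> M" for x
            using M_D[OF that] c C_e[OF c] by (metis mult.assoc)
        qed
        from comm[OF this] show "fr.block t * c = c * fr.block t"
          using d1 ed C_e[OF c] by (metis mult.assoc)
      qed
    qed
    show "\<exists>t\<in>fr.blocks. x = fr.block t" if x: "x \<in> M" for x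
    proof
      define t where "t r = adj (w r) * x * w r" for r
      show tb: "t \<in> fr.blocks"
      proof -
        have "corner (m r) (t r)" if "r \<in> F" for r
        proof -
          have 1: "w r * idm (m r) = w r" by (rule partial_isometry_initial) (use w that in auto)
          then have 2: "idm (m r) * adj (w r) = adj (w r)" by (metis adj_idm adj_mult)
          have "t r * idm (m r) = t r" by (simp add: t_def mult.assoc 1)
          moreover have "idm (m r) * t r = t r" by (simp add: t_def mult.assoc[symmetric] 2)
          ultimately show ?thesis by (simp add: corner_def)
        qed
        then show ?thesis using \<kappa>(1) by (simp add: fr.blocks_def)
      qed
      have xN: "x * y = y * x" if "y \<in> N.M" for y using N.M_D(3)[OF that x] by simp
      \<comment> \<open>\<open>x\<close> commutes with \<open>v p\<close>, so its matrix in copy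
        \<open>p\<close> is the one on the representative.\<close>
      have Jx: "x * J p = J p * t (\<kappa> p)" if "p \<in> F" for p
      proof -
        have "J p * t (\<kappa> p) = v p * (w (\<kappa> p) * adj (w (\<kappa> p))) * x * w (\<kappa> p)"
          by (simp add: J_def t_def mult.assoc)
        also have "\<dots> = v p * x * w (\<kappa> p)" by (simp add: w(2) \<kappa>(1) that vk)
        also have "\<dots> = x * J p" using xN[OF v(1)[OF that]] by (simp add: J_def mult.assoc[symmetric])
        finally show ?thesis by simp
      qed
      have "x = x * (\<Sum>p\<in>F. J p * adj (J p))" using M_D(2)[OF x] fr.J_sum ed by simp
      also have "\<dots> = fr.block t"
        unfolding fr.block_def sum_distrib_left by (rule sum.cong) (simp_all add: mult.assoc[symmetric] Jx)
      finally show "x = fr.block t" .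
    qed
  qed
qed

end

section \<open>Stability of finite groups\<close>

definition urep :: "('a, 'm) monoid_scheme \<Rightarrow> nat \<Rightarrow> ('a \<Rightarrow> fmat) \<Rightarrow> bool"
  where "urep G d \<pi> \<longleftrightarrow> (\<forall>g\<in>carrier G. unitary d (\<pi> g)) \<and>
    (\<forall>g\<in>carrier G. \<forall>h\<in>carrier G. \<pi> (g \<otimes>\<^bsub>G\<^esub> h) = \<pi> g * \<pi> h)"

text \<open>Operator norm at most 1, expressed through the Hilbert--Schmidt norm on both sides so
  that no second norm is introduced.\<close>

definition contraction :: "fmat \<Rightarrow> bool"
  where "contraction x \<longleftrightarrow> (\<forall>z. norm (z * x) \<le> norm z \<and> norm (x * z) \<le> norm z)"

lemma contractionD: "contraction x \<Longrightarrow> norm (z * x) \<le> norm z" "contraction x \<Longrightarrow> norm (x * z) \<le> norm z"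
  by (simp_all add: contraction_def)

lemma unitary_contraction: "unitary n u \<Longrightarrow> contraction u"
  by (simp add: contraction_def unitary_norm_le)

lemma proj_contraction: "proj p \<Longrightarrow> contraction p"
  by (simp add: contraction_def proj_norm_le)

lemma contraction_mult: "contraction x \<Longrightarrow> contraction y \<Longrightarrow> contraction (x * y)"
  unfolding contraction_def by (metis mult.assoc order_trans)

lemma contraction_adj: "contraction x \<Longrightarrow> contraction (adj x)"
  unfolding contraction_def by (metis adj_adj adj_mult norm_adj)

lemma isometry_contraction:
  assumes "adj v * v = idm n"
  shows "contraction v"
  using partial_isometry_norm_le[OF assms] partial_isometry_norm_right[of v, OF refl]
    partial_isometry_final(1)[OF assms] by (simp add: contraction_def)

text \<open>The squared distance is the sum of the ranks minus twice the squared norm of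
  \<open>p * q\<close>, which is at most the rank of \<open>q\<close>. The rank excess is thus
  bounded quadratically in the distance.\<close>

lemma norm_diff_projs:
  assumes "proj p" "proj q"
  shows "(norm p)\<^sup>2 - (norm q)\<^sup>2 \<le> (norm (p - q))\<^sup>2"
proof -
  have a: "adj p = p" "p * p = p" "adj q = q" "q * q = q" using assms by (auto simp: proj_def)
  have "tr (adj (p * q) * (p * q)) = tr (q * (p * q))"
    by (simp add: adj_mult a mult.assoc mult_extend[OF a(2)])
  also have "\<dots> = tr (p * q)" by (simp add: tr_mult_comm[of q] mult.assoc a)
  finally have 1: "(norm (p * q))\<^sup>2 = Re (tr (p * q))" by (simp add: norm_sq_tr)
  have "norm (p * q) \<le> norm q" by (rule proj_norm_le(1)[OF assms(1)])
  then have 2: "(norm (p * q))\<^sup>2 \<le> (norm q)\<^sup>2" by (simp add: power_mono)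
  have "(norm (p - q))\<^sup>2 = (norm p)\<^sup>2 + (norm q)\<^sup>2 - 2 * Re (tr (p * q))"
    by (simp add: norm_sq_tr adj_diff a algebra_simps tr_diff tr_add tr_mult_comm[of q p])
  then show ?thesis using 1 2 by linarith
qed

context group
begin

lemma urep_one:
  assumes "urep G d \<pi>"
  shows "\<pi> \<one> = idm d"
proof -
  have u: "unitary d (\<pi> \<one>)" and "\<pi> (\<one> \<otimes> \<one>) = \<pi> \<one> * \<pi> \<one>"
    using assms unfolding urep_def by blast+
  then have "adj (\<pi> \<one>) * (\<pi> \<one> * \<pi> \<one>) = adj (\<pi> \<one>) * \<pi> \<one>" by simp
  then show ?thesis using unitaryD[OF u] by (simp add: mult_extend)
qed

lemma urep_inv:
  assumes "urep G d \<pi>" "g \<in> carrier G"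
  shows "\<pi> (inv g) = adj (\<pi> g)"
proof -
  have u: "unitary d (\<pi> g)" "unitary d (\<pi> (inv g))" using assms by (auto simp: urep_def)
  have "\<pi> (inv g) * \<pi> g = \<pi> (inv g \<otimes> g)" using assms inv_closed unfolding urep_def by metis
  then have "\<pi> (inv g) * \<pi> g = idm d" using urep_one assms by simp
  then have "\<pi> (inv g) * \<pi> g * adj (\<pi> g) = adj (\<pi> g)"
    using unitaryD[OF u(1)] by simp
  then show ?thesis using unitaryD[OF u(1)] unitaryD[OF u(2)] by (simp add: mult.assoc)
qed

end

section \<open>Averaging over a finite group\<close>

locale finite_urep = group P for P :: "('a, 'm) monoid_scheme" (structure) +
  fixes d :: nat and \<rho> :: "'a \<Rightarrow> fmat"
  assumes fin: "finite (carrier P)" and rep: "urep P d \<rho>"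
begin

text \<open>The conditional expectation onto the commutant.\<close>

definition avg :: "fmat \<Rightarrow> fmat"
  where "avg x = sc (1 / of_nat (card (carrier P))) (\<Sum>g\<in>carrier P. \<rho> g * x * adj (\<rho> g))"

lemma card_pos: "card (carrier P) > 0"
  using fin by (auto simp: card_gt_0_iff)

lemma uni: "g \<in> carrier P \<Longrightarrow> unitary d (\<rho> g)"
  using rep by (simp add: urep_def)

lemma rep_mult: "g \<in> carrier P \<Longrightarrow> h \<in> carrier P \<Longrightarrow> \<rho> (g \<otimes> h) = \<rho> g * \<rho> h"
  using rep by (simp add: urep_def)

lemma commutant_structure:
  assumes "proj e" "\<And>g. g \<in> carrier P \<Longrightarrow> e * \<rho> g = \<rho> g * e"
  shows "star_commutant (\<rho> ` carrier P) e"
proof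
  show "adj c \<in> \<rho> ` carrier P" if c: "c \<in> \<rho> ` carrier P" for c
  proof -
    from c obtain g where "g \<in> carrier P" "c = \<rho> g" by blast
    then show ?thesis using urep_inv[OF rep, of g] by (metis image_eqI inv_closed)
  qed
qed (use assms in auto)

lemma commutant_idm: "star_commutant (\<rho> ` carrier P) (idm d)"
  by (rule commutant_structure) (auto simp: unitaryD[OF uni])

lemma avg_translate:
  assumes "h \<in> carrier P"
  shows "(\<Sum>g\<in>carrier P. \<rho> h * (\<rho> g * x * adj (\<rho> g)) * adj (\<rho> h)) = (\<Sum>g\<in>carrier P. \<rho> g * x * adj (\<rho> g))"
proof -
  have "(\<Sum>g\<in>carrier P. \<rho> h * (\<rho> g * x * adj (\<rho> g)) * adj (\<rho> h))
      = (\<Sum>g\<in>carrier P. \<rho> (h \<otimes> g) * x * adj (\<rho> (h \<otimes> g)))"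
    by (rule sum.cong) (simp_all add: rep_mult assms adj_mult mult.assoc)
  also have "\<dots> = (\<Sum>g\<in>carrier P. \<rho> g * x * adj (\<rho> g))"
    using sum.reindex_bij_betw[of "\<lambda>g. h \<otimes> g" "carrier P" "carrier P" "\<lambda>g. \<rho> g * x * adj (\<rho> g)"]
      inj_on_cmult[OF assms] surj_const_mult[OF assms] by (simp add: bij_betw_def)
  finally show ?thesis .
qed

lemma sum_commutes:
  assumes "h \<in> carrier P"
  shows "(\<Sum>g\<in>carrier P. \<rho> g * x * adj (\<rho> g)) * \<rho> h = \<rho> h * (\<Sum>g\<in>carrier P. \<rho> g * x * adj (\<rho> g))"
proof -
  let ?S = "\<Sum>g\<in>carrier P. \<rho> g * x * adj (\<rho> g)"
  have "?S * \<rho> h = \<rho> h * ?S * adj (\<rho> h) * \<rho> h"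
    using avg_translate[OF assms, of x] by (simp add: sum_distrib_left sum_distrib_right)
  also have "\<dots> = \<rho> h * (?S * idm d)" using unitaryD[OF uni[OF assms]] by (simp add: mult.assoc)
  also have "?S * idm d = ?S"
    unfolding sum_distrib_right by (rule sum.cong) (simp_all add: mult.assoc unitaryD[OF uni])
  finally show ?thesis .
qed

lemma avg_commutant: "avg x \<in> commutant (\<rho> ` carrier P) (idm d)"
proof -
  let ?S = "\<Sum>g\<in>carrier P. \<rho> g * x * adj (\<rho> g)"
  have "idm d * ?S = ?S"
    unfolding sum_distrib_left by (rule sum.cong) (simp_all add: mult.assoc mult_extend[OF unitaryD(4)[OF uni]])
  moreover have "?S * idm d = ?S"
    unfolding sum_distrib_right by (rule sum.cong) (simp_all add: mult.assoc unitaryD[OF uni])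
  ultimately show ?thesis by (auto simp: commutant_def avg_def sum_commutes)
qed

lemma avg_adj: "adj (avg x) = avg (adj x)"
  by (simp add: avg_def adj_sc adj_sum adj_mult mult.assoc)

lemma norm_average_le:
  assumes "\<And>g. g \<in> carrier P \<Longrightarrow> norm (f g) \<le> c"
  shows "norm (sc (1 / of_nat (card (carrier P))) (\<Sum>g\<in>carrier P. f g)) \<le> c"
proof -
  have "norm (\<Sum>g\<in>carrier P. f g) \<le> (\<Sum>g\<in>carrier P. c)"
    using norm_sum sum_mono[OF assms] by (rule order_trans)
  also have "\<dots> = real (card (carrier P)) * c" by (simp)
  finally show ?thesis using card_pos by (simp add: norm_sc norm_divide field_simps)
qed

lemma avg_close:
  assumes "\<And>g. g \<in> carrier P \<Longrightarrow> norm (\<rho> g * x * adj (\<rho> g) - x) \<le> c"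
  shows "norm (avg x - x) \<le> c"
proof -
  have "x = sc (1 / of_nat (card (carrier P))) (\<Sum>g\<in>carrier P. x)"
    using card_pos
  proof -
    have "(\<Sum>g\<in>carrier P. x) = (\<Sum>g\<in>carrier P. sc 1 x)" by simp
    also have "\<dots> = sc (of_nat (card (carrier P))) x" unfolding sum_sc by (simp)
    finally show ?thesis using card_pos by simp
  qed
  then have "avg x - x = sc (1 / of_nat (card (carrier P))) (\<Sum>g\<in>carrier P. \<rho> g * x * adj (\<rho> g) - x)"
    unfolding avg_def sum_subtractf sc_diff_right by simp
  then show ?thesis using norm_average_le[OF assms] by simp
qed

lemma avg_contraction:
  assumes "contraction x"
  shows "contraction (avg x)"
proof -
  have c: "contraction (\<rho> g * x * adj (\<rho> g))" if "g \<in> carrier P" for g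
    by (intro contraction_mult contraction_adj assms unitary_contraction[OF uni[OF that]])
  have "norm (z * avg x) \<le> norm z" "norm (avg x * z) \<le> norm z" for z
    unfolding avg_def sc_mult_left sc_mult_right sum_distrib_left sum_distrib_right
    by (intro norm_average_le contractionD c; assumption)+
  then show ?thesis by (simp add: contraction_def)
qed

lemma proj_column:
  assumes "proj p" "p \<noteq> 0"
  obtains v where "adj v * v = eunit 0 0" "p * v = v"
proof -
  obtain m w where w: "adj w * w = idm m" "w * adj w = p" using proj_coordinates[OF assms(1)] by blast
  have "m \<noteq> 0"
  proof
    assume "m = 0"
    then have "w = 0" using w(1) by simp
    then show False using w(2) assms(2) by simp
  qed
  then have "adj (w * eunit 0 0) * (w * eunit 0 0) = eunit 0 0"
    by (simp add: adj_mult mult.assoc mult_extend[OF w(1)] idm_eunit eunit_mult)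
  moreover have "p * (w * eunit 0 0) = w * eunit 0 0"
    using partial_isometry_final(2)[OF w(1)] w(2) by (simp add: mult.assoc[symmetric])
  ultimately show thesis by (rule that)
qed

text \<open>The range of a minimal projection of the commutant is irreducible, so it is spanned by the
  orbit of any nonzero vector.\<close>

lemma minimal_proj_norm:
  assumes q: "proj q" "q \<in> commutant (\<rho> ` carrier P) (idm d)"
    and p: "proj p" "p \<noteq> 0" "p \<in> commutant (\<rho> ` carrier P) q"
    and mini: "\<And>x. x \<in> commutant (\<rho> ` carrier P) q \<Longrightarrow> \<exists>c. p * x * p = sc c p"
  shows "(norm p)\<^sup>2 \<le> real (card (carrier P))"
proof -
  interpret S: star_commutant "\<rho> ` carrier P" "idm d" by (rule commutant_idm)
  obtain v where v: "adj v * v = eunit 0 0" "p * v = v" using proj_column[OF p(1,2)] by blast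
  have pr: "p * \<rho> g = \<rho> g * p" if "g \<in> carrier P" for g
    using p(3) that by (simp add: commutant_def)
  have qp: "q * p = p" "p * q = p" using p(3) by (simp_all add: commutant_def)
  have dq: "idm d * q = q" using q(2) by (simp add: commutant_def)
  have dv: "idm d * v = v" using v(2) qp(1) dq by (metis mult.assoc)
  \<comment> \<open>The sum of the rank one projections onto the orbit of \<open>v\<close>. It
    commutes with \<open>\<rho>\<close>, hence equals \<open>c\<close> times \<open>p\<close>, and
    its trace says that \<open>c\<close> times the rank of \<open>p\<close> is the order of the
    group.\<close>
  let ?S = "\<Sum>g\<in>carrier P. \<rho> g * (v * adj v) * adj (\<rho> g)"
  have pS: "p * ?S = ?S"
    unfolding sum_distrib_left
  proof (rule sum.cong[OF refl])
    fix g assume g: "g \<in> carrier P"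
    have "p * (\<rho> g * (v * adj v) * adj (\<rho> g)) = p * \<rho> g * v * adj v * adj (\<rho> g)"
      by (simp add: mult.assoc)
    then show "p * (\<rho> g * (v * adj v) * adj (\<rho> g)) = \<rho> g * (v * adj v) * adj (\<rho> g)"
      by (simp add: pr[OF g]) (simp add: mult.assoc mult_extend[OF v(2)])
  qed
  have Sa: "adj ?S = ?S" by (simp add: adj_sum adj_mult mult.assoc)
  have pS': "?S * p = ?S"
    by (metis Sa pS adj_mult proj_adj[OF p(1)])
  have "q * (p * ?S) = p * ?S" "?S * p * q = ?S * p"
    by (rule mult_extend[OF qp(1)], simp only: mult.assoc qp(2))
  then have qS: "q * ?S = ?S" "?S * q = ?S" by (simp_all only: pS pS')
  have "?S \<in> commutant (\<rho> ` carrier P) q"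
    by (auto simp: commutant_def qS sum_commutes)
  then obtain c where "p * ?S * p = sc c p" using mini by blast
  then have c: "?S = sc c p" using pS pS' by simp
  have "tr ?S = (\<Sum>g\<in>carrier P. 1)"
    unfolding tr_sum
  proof (rule sum.cong)
    fix g assume g: "g \<in> carrier P"
    have "tr (\<rho> g * (v * adj v) * adj (\<rho> g)) = tr (adj (\<rho> g) * \<rho> g * (v * adj v))"
      by (metis mult.assoc tr_mult_comm)
    also have "\<dots> = tr (adj v * v)"
      using unitaryD[OF uni[OF g]] dv by (simp add: mult.assoc[symmetric]) (metis tr_mult_comm)
    finally show "tr (\<rho> g * (v * adj v) * adj (\<rho> g)) = 1" by (simp add: v)
  qed simp
  then have 1: "c * of_real ((norm p)\<^sup>2) = of_nat (card (carrier P))"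
    using c tr_proj[OF p(1)] by (simp add: tr_sc)
  \<comment> \<open>Evaluation at \<open>v\<close> shows that \<open>c\<close> is at least the term
    of the identity element, which is 1.\<close>
  have "tr (adj v * ?S * v) = c"
    unfolding c by (simp add: mult.assoc v tr_sc)
  moreover have "tr (adj v * ?S * v) = (\<Sum>g\<in>carrier P. of_real ((norm (adj v * adj (\<rho> g) * v))\<^sup>2))"
    unfolding sum_distrib_left sum_distrib_right tr_sum
  proof (rule sum.cong)
    fix g
    have "adj v * (\<rho> g * (v * adj v) * adj (\<rho> g)) * v = adj (adj v * adj (\<rho> g) * v) * (adj v * adj (\<rho> g) * v)"
      by (simp add: adj_mult mult.assoc)
    then show "tr (adj v * (\<rho> g * (v * adj v) * adj (\<rho> g)) * v) = of_real ((norm (adj v * adj (\<rho> g) * v))\<^sup>2)"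
      by (simp only: tr_adj_mult_real)
  qed simp
  ultimately have 2: "c = of_real (\<Sum>g\<in>carrier P. (norm (adj v * adj (\<rho> g) * v))\<^sup>2)" by simp
  have "(norm (adj v * adj (\<rho> \<one>) * v))\<^sup>2 = 1"
    using urep_one[OF rep] by (simp add: mult.assoc dv v norm_sq_tr eunit_mult)
  then have "1 \<le> (\<Sum>g\<in>carrier P. (norm (adj v * adj (\<rho> g) * v))\<^sup>2)"
    using member_le_sum[OF one_closed, of "\<lambda>g. (norm (adj v * adj (\<rho> g) * v))\<^sup>2"] fin by simp
  then obtain r where r: "c = of_real r" "r \<ge> 1" using 2 by blast
  then have "complex_of_real (r * (norm p)\<^sup>2) = of_real (real (card (carrier P)))" using 1 by simp
  then have "r * (norm p)\<^sup>2 = real (card (carrier P))" by (simp only: of_real_eq_iff)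
  moreover have "1 * (norm p)\<^sup>2 \<le> r * (norm p)\<^sup>2" using r by (intro mult_right_mono) auto
  ultimately show ?thesis by simp
qed

text \<open>Members are removed until the sum is at most \<open>b\<close>; the last one removed
  contributes at most \<open>c\<close>.\<close>

lemma subset_sum_approx:
  fixes f :: "'x \<Rightarrow> real"
  assumes "finite F" "\<And>x. x \<in> F \<Longrightarrow> f x \<le> c" "0 \<le> b" "b < sum f F"
  shows "\<exists>A\<subseteq>F. sum f A \<le> b \<and> b - c \<le> sum f A"
  using assms
proof (induction F rule: finite_induct)
  case (insert x F)
  show ?case
  proof (cases "b < sum f F")
    case True
    then show ?thesis using insert by (metis insertI2 subset_insertI2)
  next
    case False
    have "f x \<le> c" by (rule insert.prems(1)) simp
    then show ?thesis using False \<open>f x \<le> c\<close> insert.prems(2,3) insert.hyps by (intro exI[of _ F]) auto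
  qed
qed simp

text \<open>\<open>q\<close> is a sum of minimal projections of rank at most the order of the group,
  so a partial sum comes within that order below \<open>b\<close>.\<close>

lemma cut_projection:
  assumes q: "proj q" "q \<in> commutant (\<rho> ` carrier P) (idm d)" and b: "0 \<le> b" "b < (norm q)\<^sup>2"
  obtains q' where "proj q'" "q' \<in> commutant (\<rho> ` carrier P) (idm d)" "(norm q')\<^sup>2 \<le> b"
    "(norm (q - q'))\<^sup>2 \<le> (norm q)\<^sup>2 - b + real (card (carrier P))"
proof -
  have qc: "q * \<rho> g = \<rho> g * q" if "g \<in> carrier P" for g
    using q(2) that by (simp add: commutant_def)
  interpret S: star_commutant "\<rho> ` carrier P" q
    by (rule commutant_structure) (use q qc in auto)
  interpret I: star_commutant "\<rho> ` carrier P" "idm d" by (rule commutant_idm)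
  obtain F where F: "orthogonal_partition S.M q F"
    and mini: "\<And>p x. p \<in> F \<Longrightarrow> x \<in> S.M \<Longrightarrow> \<exists>c. p * x * p = sc c p"
    by (rule S.minimal_partition) blast
  have F': "finite F" "\<And>p. p \<in> F \<Longrightarrow> p \<in> S.M" "\<And>p. p \<in> F \<Longrightarrow> proj p" "\<And>p. p \<in> F \<Longrightarrow> p \<noteq> 0"
    "\<And>p q. p \<in> F \<Longrightarrow> q \<in> F \<Longrightarrow> p \<noteq> q \<Longrightarrow> p * q = 0" "\<Sum>F = q"
    using F by (auto simp: orthogonal_partition_def)
  have le: "(norm p)\<^sup>2 \<le> real (card (carrier P))" if "p \<in> F" for p
    using minimal_proj_norm[OF q F'(3)[OF that] F'(4)[OF that] F'(2)[OF that]] mini[OF that] by blast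
  have ns: "(norm (\<Sum>A))\<^sup>2 = (\<Sum>p\<in>A. (norm p)\<^sup>2)" if "A \<subseteq> F" for A
    by (rule orthogonal_family_norm) (use that F'(3,5) finite_subset[OF that F'(1)] in blast)+
  obtain A where A: "A \<subseteq> F" "(\<Sum>p\<in>A. (norm p)\<^sup>2) \<le> b" "b - real (card (carrier P)) \<le> (\<Sum>p\<in>A. (norm p)\<^sup>2)"
  proof -
    have "\<exists>A\<subseteq>F. (\<Sum>p\<in>A. (norm p)\<^sup>2) \<le> b \<and> b - real (card (carrier P)) \<le> (\<Sum>p\<in>A. (norm p)\<^sup>2)"
      by (rule subset_sum_approx) (use F'(1,6) le b ns[of F] in auto)
    then show thesis using that by blast
  qed
  have fA: "finite A" using A(1) F'(1) finite_subset by blast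
  have pM: "p \<in> I.M" if "p \<in> F" for p
    using F'(2)[OF that] q(2) unfolding commutant_def by (auto simp: mult.assoc[symmetric]) (metis mult.assoc)+
  show thesis
  proof (rule that[of "\<Sum>A"])
    have "\<Sum>A * \<Sum>A = \<Sum>A"
      unfolding sum_distrib_left by (rule sum.cong[OF refl], rule orthogonal_family_mult(1)) (use A(1) fA F'(3,5) in blast)+
    moreover have "adj (\<Sum>A) = \<Sum>A"
      unfolding adj_sum by (rule sum.cong) (use A F'(3) in \<open>auto simp: proj_def\<close>)
    ultimately show "proj (\<Sum>A)" by (simp add: proj_def)
    show "\<Sum>A \<in> commutant (\<rho> ` carrier P) (idm d)"
      by (rule I.M_sum) (use A(1) pM in auto)
    show "(norm (\<Sum>A))\<^sup>2 \<le> b" using ns A by simp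
    have "q - \<Sum>A = \<Sum>(F - A)" using sum_diff[OF F'(1) A(1), of "\<lambda>p. p"] F'(6) by simp
    then have "(norm (q - \<Sum>A))\<^sup>2 = (\<Sum>p\<in>F - A. (norm p)\<^sup>2)" using ns[of "F - A"] by simp
    also have "\<dots> = (norm q)\<^sup>2 - (\<Sum>p\<in>A. (norm p)\<^sup>2)"
      using ns[of F] F'(1,6) A(1) by (simp add: sum_diff)
    finally show "(norm (q - \<Sum>A))\<^sup>2 \<le> (norm q)\<^sup>2 - b + real (card (carrier P))" using A(3) by simp
  qed
qed

end

section \<open>Dilation to the regular representation\<close>

text \<open>The isometry of C^d onto summand \<open>k\<close> in a direct sum of copies of
  C^d.\<close>

definition slot :: "nat \<Rightarrow> nat \<Rightarrow> fmat"
  where "slot d k = (\<Sum>a<d. eunit (k * d + a) a)"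

lemma slot_orth: "adj (slot d k) * slot d l = (if k = l then idm d else 0)"
proof -
  have inj: "k * d + a = l * d + b \<longleftrightarrow> k = l \<and> a = b" if ab: "a < d" "b < d" for a b
  proof
    assume *: "k * d + a = l * d + b"
    have "(k * d + a) div d = k" "(k * d + a) mod d = a" "(l * d + b) div d = l" "(l * d + b) mod d = b"
      using ab by auto
    then show "k = l \<and> a = b" using * by metis
  qed simp
  have "adj (slot d k) * slot d l = (\<Sum>b<d. \<Sum>a<d. eunit a (k * d + a) * eunit (l * d + b) b)"
    by (simp add: slot_def adj_sum sum_distrib_left sum_distrib_right)
  also have "\<dots> = (\<Sum>b<d. \<Sum>a<d. if a = b then (if k = l then eunit b b else 0) else 0)"
    by (intro sum.cong) (auto simp: eunit_mult inj)
  also have "\<dots> = (if k = l then idm d else 0)" by (simp add: idm_sum)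
  finally show ?thesis .
qed

lemma slot_sum: "(\<Sum>k<n. slot d k * adj (slot d k)) = idm (n * d)"
proof -
  have "slot d k * adj (slot d k) = (\<Sum>i = k * d..<k * d + d. eunit i i)" for k
  proof -
    have "slot d k * adj (slot d k) = (\<Sum>b<d. \<Sum>a<d. eunit (k * d + a) a * eunit b (k * d + b))"
      by (simp add: slot_def adj_sum sum_distrib_left sum_distrib_right)
    also have "\<dots> = (\<Sum>b<d. \<Sum>a<d. if a = b then eunit (k * d + b) (k * d + b) else 0)"
      by (intro sum.cong) (auto simp: eunit_mult)
    also have "\<dots> = (\<Sum>b<d. eunit (k * d + b) (k * d + b))" by simp
    also have "\<dots> = (\<Sum>i = k * d..<k * d + d. eunit i i)"
      using sum.shift_bounds_nat_ivl[of "\<lambda>i. eunit i i" 0 "k * d" d]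
      by (simp add: atLeast0LessThan add.commute)
    finally show ?thesis .
  qed
  then show ?thesis
    using sum.nat_group[of "\<lambda>i. eunit i i" d n] by (simp add: idm_sum)
qed

text \<open>The map \<open>\<phi>\<close> is dilated to a multiple of the regular representation.\<close>

lemma (in group) dilation:
  assumes fin: "finite (carrier G)"
    and uni: "\<And>g. g \<in> carrier G \<Longrightarrow> unitary d (\<phi> g)"
    and alm: "\<And>g h. g \<in> carrier G \<Longrightarrow> h \<in> carrier G \<Longrightarrow> norm (\<phi> (g \<otimes> h) - \<phi> g * \<phi> h) \<le> c"
  obtains N \<rho> V where "urep G N \<rho>" "adj V * V = idm d" "idm N * V = V"
    "\<And>g. g \<in> carrier G \<Longrightarrow> norm (\<rho> g * V - V * \<phi> g) \<le> real (card (carrier G)) * c"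
proof -
  define n where "n = card (carrier G)"
  have n: "n > 0" using fin by (auto simp: n_def card_gt_0_iff)
  obtain idx where idx: "bij_betw idx (carrier G) {0..<n}"
    using ex_bij_betw_finite_nat[OF fin] by (auto simp: n_def)
  define S where "S h = slot d (idx h)" for h
  have inj: "idx h = idx k \<longleftrightarrow> h = k" if "h \<in> carrier G" "k \<in> carrier G" for h k
    using idx that by (auto simp: bij_betw_def inj_on_def)
  have SS: "adj (S h) * S k = (if h = k then idm d else 0)" if "h \<in> carrier G" "k \<in> carrier G" for h k
    using inj[OF that] by (simp add: S_def slot_orth)
  have Ssum: "(\<Sum>h\<in>carrier G. S h * adj (S h)) = idm (n * d)"
    using sum.reindex_bij_betw[OF idx, of "\<lambda>k. slot d k * adj (slot d k)"] slot_sum[of d n]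
    by (simp add: S_def atLeast0LessThan)
  have Si: "S h * idm d = S h" if "h \<in> carrier G" for h
    by (rule partial_isometry_initial) (use SS that in auto)
  have pick: "(\<Sum>h\<in>carrier G. f h * adj (S h)) * S k = f k * idm d" if k: "k \<in> carrier G" for f k
  proof -
    have "(\<Sum>h\<in>carrier G. f h * adj (S h)) * S k = (\<Sum>h\<in>carrier G. if h = k then f k * idm d else 0)"
      unfolding sum_distrib_right by (rule sum.cong) (use SS k in \<open>auto simp: mult.assoc\<close>)
    then show ?thesis using k fin by simp
  qed
  have reidx: "(\<Sum>h\<in>carrier G. f (g \<otimes> h)) = (\<Sum>h\<in>carrier G. f h)" if "g \<in> carrier G" for f :: "'a \<Rightarrow> fmat" and g
    using sum.reindex_bij_betw[of "\<lambda>h. g \<otimes> h" "carrier G" "carrier G" f]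
      inj_on_cmult[OF that] surj_const_mult[OF that] by (simp add: bij_betw_def)
  \<comment> \<open>Left translation of the summands: a multiple of the regular
    representation.\<close>
  define \<rho> where "\<rho> g = (\<Sum>h\<in>carrier G. S (g \<otimes> h) * adj (S h))" for g
  have \<rho>S: "\<rho> g * S k = S (g \<otimes> k)" if "g \<in> carrier G" "k \<in> carrier G" for g k
    using pick[OF that(2), of "\<lambda>h. S (g \<otimes> h)"] Si that by (simp add: \<rho>_def)
  have \<rho>a: "adj (\<rho> g) * S (g \<otimes> k) = S k" if "g \<in> carrier G" "k \<in> carrier G" for g k
  proof -
    have "adj (\<rho> g) * S (g \<otimes> k) = (\<Sum>h\<in>carrier G. if h = k then S k * idm d else 0)"
      unfolding \<rho>_def adj_sum sum_distrib_right
      by (rule sum.cong) (use SS that in \<open>auto simp: adj_mult mult.assoc\<close>)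
    then show ?thesis using that fin Si by simp
  qed
  have rep: "urep G (n * d) \<rho>"
    unfolding urep_def unitary_def
  proof (intro conjI ballI)
    fix g assume g: "g \<in> carrier G"
    have "adj (\<rho> g) * \<rho> g = (\<Sum>h\<in>carrier G. S h * adj (S h))"
      by (subst (2) \<rho>_def) (simp add: sum_distrib_left mult.assoc[symmetric] \<rho>a g)
    then show "adj (\<rho> g) * \<rho> g = idm (n * d)" by (simp add: Ssum)
    have "\<rho> g * adj (\<rho> g) = (\<Sum>h\<in>carrier G. S (g \<otimes> h) * adj (S (g \<otimes> h)))"
      by (subst (2) \<rho>_def) (simp add: adj_sum adj_mult sum_distrib_left mult.assoc[symmetric] \<rho>S g)
    also have "\<dots> = idm (n * d)" using reidx[OF g, of "\<lambda>h. S h * adj (S h)"] Ssum by simp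
    finally show "\<rho> g * adj (\<rho> g) = idm (n * d)" .
    fix h assume h: "h \<in> carrier G"
    have "\<rho> g * \<rho> h = (\<Sum>k\<in>carrier G. S (g \<otimes> (h \<otimes> k)) * adj (S k))"
      by (subst (2) \<rho>_def) (simp add: sum_distrib_left mult.assoc[symmetric] \<rho>S g h)
    also have "\<dots> = \<rho> (g \<otimes> h)" by (simp add: \<rho>_def m_assoc g h)
    finally show "\<rho> (g \<otimes> h) = \<rho> g * \<rho> h" by simp
  qed
  \<comment> \<open>The inverse makes this an intertwiner if \<open>\<phi>\<close> is
    multiplicative: after reindexing, \<open>\<rho> g * V0\<close> has the components
    \<open>\<phi> (inv k \<otimes> g)\<close>.\<close>
  define V0 where "V0 = (\<Sum>h\<in>carrier G. S h * \<phi> (inv h))"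
  define V where "V = sc (of_real (1 / sqrt n)) V0"
  have V0S: "adj (S k) * V0 = \<phi> (inv k)" if k: "k \<in> carrier G" for k
  proof -
    have "adj (S k) * V0 = (\<Sum>h\<in>carrier G. if h = k then idm d * \<phi> (inv k) else 0)"
      unfolding V0_def sum_distrib_left
      by (rule sum.cong) (use SS k in \<open>auto simp: mult.assoc[symmetric]\<close>)
    then show ?thesis using k fin unitaryD(4)[OF uni, of "inv k"] by simp
  qed
  have "adj V0 * V0 = (\<Sum>h\<in>carrier G. adj (\<phi> (inv h)) * (adj (S h) * V0))"
    by (subst V0_def) (simp add: adj_sum adj_mult sum_distrib_right mult.assoc)
  also have "\<dots> = (\<Sum>h\<in>carrier G. sc 1 (idm d))"
    by (rule sum.cong) (simp_all add: V0S unitaryD(1)[OF uni])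
  also have "\<dots> = sc (of_nat n) (idm d)" unfolding sum_sc by (simp add: n_def)
  finally have "adj V * V = idm d"
    using n by (simp add: V_def adj_sc flip: of_real_mult)
  moreover have "idm (n * d) * S h = S h" if "h \<in> carrier G" for h
    unfolding Ssum[symmetric] using pick[OF that, of S] Si that by simp
  then have "idm (n * d) * V = V"
    by (simp add: V_def V0_def sum_distrib_left mult.assoc[symmetric])
  moreover have "norm (\<rho> g * V - V * \<phi> g) \<le> real (card (carrier G)) * c" if g: "g \<in> carrier G" for g
  proof -
    have "\<rho> g * V0 = (\<Sum>h\<in>carrier G. S (g \<otimes> h) * \<phi> (inv h))"
      by (simp add: V0_def sum_distrib_left mult.assoc[symmetric] \<rho>S g)
    also have "\<dots> = (\<Sum>h\<in>carrier G. S (g \<otimes> h) * \<phi> (inv (g \<otimes> h) \<otimes> g))"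
      by (rule sum.cong) (simp_all add: g inv_mult_group m_assoc)
    also have "\<dots> = (\<Sum>k\<in>carrier G. S k * \<phi> (inv k \<otimes> g))"
      using reidx[OF g, of "\<lambda>k. S k * \<phi> (inv k \<otimes> g)"] by simp
    finally have 1: "\<rho> g * V0 - V0 * \<phi> g = (\<Sum>k\<in>carrier G. S k * (\<phi> (inv k \<otimes> g) - \<phi> (inv k) * \<phi> g))"
      by (simp add: V0_def sum_distrib_right right_diff_distrib sum_subtractf mult.assoc)
    have "norm (\<rho> g * V0 - V0 * \<phi> g) \<le> (\<Sum>k\<in>carrier G. norm (S k * (\<phi> (inv k \<otimes> g) - \<phi> (inv k) * \<phi> g)))"
      unfolding 1 by (rule norm_sum)
    also have "\<dots> \<le> (\<Sum>k\<in>carrier G. c)"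
    proof (rule sum_mono)
      fix k assume k: "k \<in> carrier G"
      have "norm (S k * (\<phi> (inv k \<otimes> g) - \<phi> (inv k) * \<phi> g)) \<le> norm (\<phi> (inv k \<otimes> g) - \<phi> (inv k) * \<phi> g)"
        by (rule partial_isometry_norm_le[of _ "idm d"]) (use SS k in auto)
      also have "\<dots> \<le> c" using alm k g by simp
      finally show "norm (S k * (\<phi> (inv k \<otimes> g) - \<phi> (inv k) * \<phi> g)) \<le> c" .
    qed
    finally have 2: "norm (\<rho> g * V0 - V0 * \<phi> g) \<le> n * c" by (simp add: n_def)
    have "\<rho> g * V - V * \<phi> g = sc (of_real (1 / sqrt n)) (\<rho> g * V0 - V0 * \<phi> g)"
      by (simp add: V_def sc_diff_right)
    then have "norm (\<rho> g * V - V * \<phi> g) = (1 / sqrt n) * norm (\<rho> g * V0 - V0 * \<phi> g)"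
      by (simp only: norm_sc norm_of_real) simp
    also have "\<dots> \<le> 1 * norm (\<rho> g * V0 - V0 * \<phi> g)"
      using n by (intro mult_right_mono) (auto simp: divide_le_eq)
    finally show ?thesis using 2 by (simp add: n_def)
  qed
  ultimately show thesis using that[OF rep] by blast
qed

section \<open>Rounding, trace correction and polarization\<close>

text \<open>An eigenvalue \<open>l\<close> goes to the nearer of 0 and 1. The other factor of
  \<open>l - l * l\<close> then has modulus at least 1/2, which is the origin of the constant
  2.\<close>

lemma spectral_rounding:
  assumes "adj T = T"
  obtains q where "proj q" "\<And>x. x * T = T * x \<Longrightarrow> x * q = q * x" "norm (T - q) \<le> 2 * norm (T - T * T)"
    "\<And>e. e * T = T \<Longrightarrow> e * q = q"
proof -
  obtain L p where L: "finite L" "0 \<notin> L" "\<And>l. l \<in> L \<Longrightarrow> proj (p l)"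
    "\<And>l. l \<in> L \<Longrightarrow> p l \<noteq> 0" "\<And>l m. l \<in> L \<Longrightarrow> m \<in> L \<Longrightarrow> l \<noteq> m \<Longrightarrow> p l * p m = 0"
    "T = (\<Sum>l\<in>L. sc (of_real l) (p l))"
    "\<And>x l. l \<in> L \<Longrightarrow> x * T = T * x \<Longrightarrow> x * p l = p l * x"
    and Tp: "\<And>l. l \<in> L \<Longrightarrow> T * p l = sc (of_real l) (p l)"
    using assms by (rule spectral) blast
  have pp: "p l * p m = (if m = l then p l else 0)" if "l \<in> L" "m \<in> L" for l m
    using L(3,5) that by (auto simp: proj_def)
  define q where "q = (\<Sum>l\<in>{l\<in>L. l \<ge> 1/2}. p l)"
  have q: "q = (\<Sum>l\<in>L. sc (of_real (if l \<ge> 1/2 then 1 else 0)) (p l))"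
  proof -
    have "q = (\<Sum>l\<in>L. if l \<ge> 1/2 then p l else 0)"
      unfolding q_def by (rule sum.inter_filter) (rule L(1))
    also have "\<dots> = (\<Sum>l\<in>L. sc (of_real (if l \<ge> 1/2 then 1 else 0)) (p l))"
      by (rule sum.cong) auto
    finally show ?thesis .
  qed
  have TT: "T * T = (\<Sum>l\<in>L. sc (of_real (l * l)) (p l))"
  proof -
    have "T * T = (\<Sum>l\<in>L. sc (of_real l) (T * p l))"
      by (subst (2) L(6)) (simp add: sum_distrib_left)
    then show ?thesis by (simp add: Tp)
  qed
  have nrm: "(norm (\<Sum>l\<in>L. sc (of_real (c l)) (p l)))\<^sup>2 = (\<Sum>l\<in>L. (c l)\<^sup>2 * (norm (p l))\<^sup>2)" for c :: "real \<Rightarrow> real"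
  proof -
    have "(norm (\<Sum>l\<in>L. sc (of_real (c l)) (p l)))\<^sup>2 = (\<Sum>l\<in>L. (cmod (of_real (c l)))\<^sup>2 * (norm (p l))\<^sup>2)"
      by (rule norm_spectral_sum) (use L(1,3,5) in blast)+
    then show ?thesis by (simp only: norm_of_real power2_abs)
  qed
  show thesis
  proof (rule that[of q])
    have "adj q = q" unfolding q_def adj_sum by (rule sum.cong) (use L(3) in \<open>auto simp: proj_def\<close>)
    moreover have "q * p l = p l" if "l \<in> L" "l \<ge> 1/2" for l
    proof -
      have "q * p l = (\<Sum>m\<in>{l\<in>L. l \<ge> 1/2}. if m = l then p l else 0)"
        unfolding q_def sum_distrib_right by (rule sum.cong) (use pp that in auto)
      then show ?thesis using that L(1) by simp
    qed
    then have "q * q = q"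
      by (subst (2) q_def) (simp add: sum_distrib_left q_def[symmetric] cong: sum.cong, simp add: q_def)
    ultimately show "proj q" by (simp add: proj_def)
    show "x * q = q * x" if "x * T = T * x" for x
      unfolding q_def sum_distrib_left sum_distrib_right by (rule sum.cong) (use L(7) that in auto)
    show "e * q = q" if e: "e * T = T" for e
    proof -
      have "e * p l = p l" if l: "l \<in> L" for l
      proof -
        have "e * (T * p l) = T * p l" by (simp add: mult.assoc[symmetric] e)
        then have "sc (of_real (1 / l)) (sc (of_real l) (e * p l)) = sc (of_real (1 / l)) (sc (of_real l) (p l))"
          by (simp add: Tp l)
        moreover have "l \<noteq> 0" using l L(2) by auto
        ultimately show ?thesis by simp
      qed
      then show ?thesis by (simp add: q_def sum_distrib_left)
    qed
    have "T - q = (\<Sum>l\<in>L. sc (of_real (l - (if l \<ge> 1/2 then 1 else 0))) (p l))"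
      unfolding q by (subst (1) L(6)) (simp add: sc_diff_left sum_subtractf)
    then have 1: "(norm (T - q))\<^sup>2 = (\<Sum>l\<in>L. (l - (if l \<ge> 1/2 then 1 else 0))\<^sup>2 * (norm (p l))\<^sup>2)"
      using nrm[of "\<lambda>l. l - (if l \<ge> 1/2 then 1 else 0)"] by simp
    have "T - T * T = (\<Sum>l\<in>L. sc (of_real (l - l * l)) (p l))"
      unfolding TT by (subst (1) L(6)) (simp add: sc_diff_left sum_subtractf)
    then have 2: "(norm (T - T * T))\<^sup>2 = (\<Sum>l\<in>L. (l - l * l)\<^sup>2 * (norm (p l))\<^sup>2)"
      using nrm[of "\<lambda>l. l - l * l"] by simp
    have "(norm (T - q))\<^sup>2 \<le> (2 * norm (T - T * T))\<^sup>2"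
      unfolding power_mult_distrib 1 2 sum_distrib_left
    proof (rule sum_mono)
      fix l :: real
      have "\<bar>l - (if l \<ge> 1/2 then 1 else 0)\<bar> \<le> \<bar>2 * (l - l * l)\<bar>"
      proof (cases "l \<ge> 1/2")
        case True
        have "1 * \<bar>l - 1\<bar> \<le> (2 * l) * \<bar>l - 1\<bar>" using True by (intro mult_right_mono) auto
        also have "\<dots> = \<bar>2 * l * (l - 1)\<bar>" using True by (simp add: abs_mult)
        also have "\<dots> = \<bar>2 * (l - l * l)\<bar>" by (simp add: algebra_simps)
        finally show ?thesis using True by simp
      next
        case False
        have "1 * \<bar>l\<bar> \<le> (2 * (1 - l)) * \<bar>l\<bar>" using False by (intro mult_right_mono) auto
        also have "\<dots> = \<bar>2 * (1 - l) * l\<bar>" using False by (simp add: abs_mult)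
        also have "\<dots> = \<bar>2 * (l - l * l)\<bar>" by (simp add: algebra_simps)
        finally show ?thesis using False by simp
      qed
      then have "(l - (if l \<ge> 1/2 then 1 else 0))\<^sup>2 \<le> (2 * (l - l * l))\<^sup>2"
        by (simp only: abs_le_square_iff)
      then show "(l - (if l \<ge> 1/2 then 1 else 0))\<^sup>2 * (norm (p l))\<^sup>2 \<le> 2\<^sup>2 * ((l - l * l)\<^sup>2 * (norm (p l))\<^sup>2)"
        using mult_right_mono[OF _ zero_le_power2[of "norm (p l)"]]
        by (simp only: power_mult_distrib mult.assoc[symmetric])
    qed
    then show "norm (T - q) \<le> 2 * norm (T - T * T)" by (rule power2_le_imp_le) simp
  qed
qed

text \<open>The range projection \<open>Q\<close> of the dilation almost commutes with the regular
  representation. A nearby projection that commutes exactly carries a subrepresentation;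
  \<open>A\<close> is the dilation compressed to it, and \<open>adj A * A\<close> differs from
  \<open>idm d\<close> by no more than the distance of the two projections.\<close>

lemma (in group) approximate_intertwiner:
  assumes fin: "finite (carrier G)"
    and uni: "\<And>g. g \<in> carrier G \<Longrightarrow> unitary d (\<phi> g)"
    and alm: "\<And>g h. g \<in> carrier G \<Longrightarrow> h \<in> carrier G \<Longrightarrow> norm (\<phi> (g \<otimes> h) - \<phi> g * \<phi> h) \<le> c"
    and n: "n = real (card (carrier G))" and c: "0 \<le> c"
  obtains m \<rho> A where "m \<le> d" "urep G m \<rho>" "corner d A" "idm m * A = A"
    "\<And>g. g \<in> carrier G \<Longrightarrow> norm (A * \<phi> g - \<rho> g * A) \<le> n * c"
    "norm (adj A * A - idm d) \<le> 14 * (n * c) * (2 + n)"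
proof -
  obtain N \<rho> V where rep: "urep G N \<rho>" and V: "adj V * V = idm d" "idm N * V = V"
    and near: "\<And>g. g \<in> carrier G \<Longrightarrow> norm (\<rho> g * V - V * \<phi> g) \<le> n * c"
    using dilation[OF fin uni alm] n by metis
  interpret R: finite_urep G N \<rho> by unfold_locales (fact fin, fact rep)
  interpret I: star_commutant "\<rho> ` carrier G" "idm N" by (rule R.commutant_idm)
  have n1: "n \<ge> 1" using R.card_pos n by linarith
  define Q where "Q = V * adj V"
  have Q: "proj Q" "V * adj V * V = V" "adj V * (V * adj V) = adj V"
    using partial_isometry_final[OF V(1)] by (simp_all add: Q_def)
  have cV: "contraction V" by (rule isometry_contraction[OF V(1)])
  have cQ: "contraction Q" by (rule proj_contraction[OF Q(1)])
  have Qn: "(norm Q)\<^sup>2 = real d"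
  proof -
    have "tr (adj Q * Q) = tr (adj V * V)"
      using Q(1) by (simp add: proj_def) (simp add: Q_def tr_mult_comm)
    then show ?thesis by (simp add: norm_sq_tr V)
  qed
  \<comment> \<open>Both terms have the form \<open>x * adj x\<close>, for \<open>x\<close> the two
    sides of the almost intertwining relation; telescoping costs its error twice.\<close>
  have QQ: "norm (\<rho> g * Q * adj (\<rho> g) - Q) \<le> 2 * (n * c)" if g: "g \<in> carrier G" for g
  proof -
    let ?A = "\<rho> g * V" and ?B = "V * \<phi> g"
    have BB: "?B * adj ?B = Q"
    proof -
      have "V * idm d = V" by (rule partial_isometry_initial[OF V(1)]) simp
      then show ?thesis
        by (simp add: adj_mult mult.assoc mult_extend[OF unitaryD(2)[OF uni[OF g]]])
          (simp add: Q_def mult.assoc[symmetric])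
    qed
    have cA: "contraction (adj ?A)" and cB: "contraction ?B"
      using cV unitary_contraction[OF uni[OF g]] unitary_contraction[OF R.uni[OF g]]
      by (auto intro!: contraction_mult contraction_adj)
    have "\<rho> g * Q * adj (\<rho> g) - Q = ?A * adj ?A - ?B * adj ?B"
      unfolding BB by (simp add: Q_def adj_mult mult.assoc)
    also have "\<dots> = (?A - ?B) * adj ?A + ?B * adj (?A - ?B)"
      by (simp add: adj_diff algebra_simps)
    also have "norm \<dots> \<le> norm (?A - ?B) + norm (adj (?A - ?B))"
      using contractionD(1)[OF cA] contractionD(2)[OF cB] by (meson add_mono norm_triangle_le)
    also have "\<dots> \<le> 2 * (n * c)" using near[OF g] by simp
    finally show ?thesis .
  qed
  define T where "T = R.avg Q"
  have TQ: "norm (T - Q) \<le> 2 * (n * c)" unfolding T_def by (rule R.avg_close[OF QQ])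
  have cT: "contraction T" unfolding T_def by (rule R.avg_contraction[OF cQ])
  have Ta: "adj T = T" using Q(1) by (simp add: T_def R.avg_adj proj_def)
  have TM: "T \<in> I.M" unfolding T_def by (rule R.avg_commutant)
  \<comment> \<open>\<open>Q\<close> is idempotent and \<open>Q\<close> and \<open>T\<close> are
    contractions, so the defect is at most three times \<open>norm (T - Q)\<close>.\<close>
  have "T - T * T = (T - Q) + (Q * (Q - T) + (Q - T) * T)"
    using Q(1) by (simp add: proj_def algebra_simps)
  also have "norm \<dots> \<le> norm (T - Q) + (norm (Q - T) + norm (Q - T))"
    using contractionD(2)[OF cQ, of "Q - T"] contractionD(1)[OF cT, of "Q - T"]
    by (meson add_left_mono add_mono norm_triangle_ineq order_trans)
  finally have TT: "norm (T - T * T) \<le> 6 * (n * c)" using TQ by (simp add: norm_minus_commute)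
  obtain q where q: "proj q" "\<And>x. x * T = T * x \<Longrightarrow> x * q = q * x" "norm (T - q) \<le> 2 * norm (T - T * T)"
    "\<And>e. e * T = T \<Longrightarrow> e * q = q"
    using Ta by (rule spectral_rounding) blast
  have qM: "q \<in> I.M"
  proof (rule I.M_I)
    show 1: "idm N * q = q" using q(4) I.M_D(1)[OF TM] by blast
    have "idm N * T = T * idm N" using I.M_D(1,2)[OF TM] by simp
    then show "q * idm N = q" using q(2) 1 by metis
    show "q * x = x * q" if "x \<in> \<rho> ` carrier G" for x
      using q(2)[of x] I.M_D(3)[OF TM that] by simp
  qed
  \<comment> \<open>14 = 2 + 2 * 6, from \<open>TQ\<close> and the rounding bound with
    \<open>TT\<close>.\<close>
  have qQ: "norm (q - Q) \<le> 14 * (n * c)"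
    using norm_triangle_ineq4[of "T - Q" "T - q"] q(3) TT TQ by simp
  have nc: "0 \<le> n * c" using n1 c by simp
  have qQ2: "(norm (q - Q))\<^sup>2 \<le> (14 * (n * c))\<^sup>2" by (rule power_mono[OF qQ norm_ge_zero])
  obtain q' where q': "proj q'" "q' \<in> I.M" "(norm q')\<^sup>2 \<le> real d" "norm (q' - Q) \<le> 14 * (n * c) * (2 + n)"
  proof (cases "(norm q)\<^sup>2 \<le> real d")
    case True
    have "14 * (n * c) * 1 \<le> 14 * (n * c) * (2 + n)" using nc n1 by (intro mult_left_mono) auto
    then show thesis using that[of q] q(1) qM True qQ by linarith
  next
    case False
    then obtain q' where q': "proj q'" "q' \<in> I.M" "(norm q')\<^sup>2 \<le> real d"
      "(norm (q - q'))\<^sup>2 \<le> (norm q)\<^sup>2 - real d + real (card (carrier G))"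
      using R.cut_projection[OF q(1) qM, of "real d"] by auto
    \<comment> \<open>Ranks are integers, so an excess is at least 1. With \<open>le\<close> this
      makes \<open>(14 * (n * c))\<^sup>2\<close> at least 1, which lets it absorb the loss
      \<open>n\<close> of the cut.\<close>
    have ge: "(norm q)\<^sup>2 \<ge> real d + 1"
    proof -
      obtain m w where w: "adj w * w = idm m" "w * adj w = q" using proj_coordinates[OF q(1)] by blast
      from coordinates_norm[OF this] have "(norm q)\<^sup>2 = real m" .
      then show ?thesis using False by simp
    qed
    have le: "(norm q)\<^sup>2 - real d \<le> (14 * (n * c))\<^sup>2"
      using norm_diff_projs[OF q(1) Q(1)] Qn qQ2 by simp
    have "(norm (q - q'))\<^sup>2 \<le> (14 * (n * c))\<^sup>2 + n" using q'(4) le n by simp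
    also have "\<dots> \<le> (14 * (n * c))\<^sup>2 + (14 * (n * c))\<^sup>2 * n"
      using ge le n1 by (intro add_left_mono) (simp add: mult_le_cancel_right1)
    also have "\<dots> \<le> (14 * (n * c))\<^sup>2 * (1 + n)\<^sup>2"
    proof -
      have "(1 + n) * 1 \<le> (1 + n) * (1 + n)" using n1 by (intro mult_left_mono) auto
      then have "(14 * (n * c))\<^sup>2 * (1 + n) \<le> (14 * (n * c))\<^sup>2 * (1 + n)\<^sup>2"
        unfolding power2_eq_square[of "1 + n"] by (intro mult_left_mono zero_le_power2) simp
      then show ?thesis by (simp only: distrib_left mult_1_right)
    qed
    also have "\<dots> = (14 * (n * c) * (1 + n))\<^sup>2" by (rule power_mult_distrib[symmetric])
    finally have "(norm (q - q'))\<^sup>2 \<le> (14 * (n * c) * (1 + n))\<^sup>2" .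
    then have "norm (q - q') \<le> 14 * (n * c) * (1 + n)"
      by (rule power2_le_imp_le) (intro mult_nonneg_nonneg, use n1 c in auto)
    then have "norm (q' - Q) \<le> 14 * (n * c) * (1 + n) + 14 * (n * c)"
      using norm_triangle_ineq4[of "q - Q" "q - q'"] qQ by simp
    then have "norm (q' - Q) \<le> 14 * (n * c) * (2 + n)" by (simp add: algebra_simps)
    then show thesis using that[OF q'(1,2,3)] by blast
  qed
  obtain m w where w: "adj w * w = idm m" "w * adj w = q'" using proj_coordinates[OF q'(1)] by blast
  have md: "m \<le> d" using coordinates_norm[OF w] q'(3) by simp
  have wm: "w * idm m = w" by (rule partial_isometry_initial[OF w(1)]) simp
  have mw: "idm m * adj w = adj w" using wm by (metis adj_idm adj_mult)
  have wq: "adj w * q' = adj w" and qw: "q' * w = w"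
    using partial_isometry_final[OF w(1)] w(2) by auto
  have q\<rho>: "q' * \<rho> g = \<rho> g * q'" if "g \<in> carrier G" for g
    using I.M_D(3)[OF q'(2)] that by simp
  have q\<rho>': "q' * adj (\<rho> g) = adj (\<rho> g) * q'" if "g \<in> carrier G" for g
    using q\<rho>[OF that] q'(1) by (metis adj_mult proj_adj)
  have Nq: "idm N * q' = q'" by (rule I.M_D(1)[OF q'(2)])
  have Nw: "idm N * w = w" using Nq qw by (metis mult.assoc)
  \<comment> \<open>The subrepresentation on the range of \<open>q'\<close>, written in
    coordinates.\<close>
  define \<sigma> where "\<sigma> g = adj w * \<rho> g * w" for g
  have \<sigma>: "urep G m \<sigma>"
    unfolding urep_def unitary_def
  proof (intro conjI ballI)
    fix g assume g: "g \<in> carrier G"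
    have "adj (\<sigma> g) * \<sigma> g = adj w * adj (\<rho> g) * (q' * \<rho> g) * w"
      by (simp add: \<sigma>_def adj_mult mult.assoc w(2)[symmetric])
    also have "\<dots> = adj w * (adj (\<rho> g) * \<rho> g) * (q' * w)" by (simp add: q\<rho>[OF g] mult.assoc)
    also have "\<dots> = idm m" by (simp add: unitaryD[OF R.uni[OF g]] qw mult.assoc Nw w)
    finally show "adj (\<sigma> g) * \<sigma> g = idm m" .
    have "\<sigma> g * adj (\<sigma> g) = adj w * \<rho> g * (q' * adj (\<rho> g)) * w"
      by (simp add: \<sigma>_def adj_mult mult.assoc w(2)[symmetric])
    also have "\<dots> = adj w * (\<rho> g * adj (\<rho> g)) * (q' * w)" by (simp add: q\<rho>'[OF g] mult.assoc)
    also have "\<dots> = idm m" by (simp add: unitaryD[OF R.uni[OF g]] qw mult.assoc Nw w)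
    finally show "\<sigma> g * adj (\<sigma> g) = idm m" .
    fix h assume h: "h \<in> carrier G"
    have "\<sigma> g * \<sigma> h = adj w * \<rho> g * (q' * \<rho> h) * w"
      by (simp add: \<sigma>_def mult.assoc w(2)[symmetric])
    also have "\<dots> = adj w * (\<rho> g * \<rho> h) * (q' * w)" by (simp add: q\<rho>[OF h] mult.assoc)
    finally show "\<sigma> (g \<otimes> h) = \<sigma> g * \<sigma> h" by (simp add: qw R.rep_mult g h \<sigma>_def mult.assoc)
  qed
  define A where "A = adj w * V"
  have Vd: "V * idm d = V" by (rule partial_isometry_initial[OF V(1)]) simp
  have mA: "idm m * A = A" by (simp add: A_def mult.assoc[symmetric] mw)
  have "idm d * A = idm d * idm m * A" by (simp only: mult.assoc mA)
  also have "\<dots> = A" using md mA by (simp add: min_absorb2)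
  finally have "corner d A" by (simp add: corner_def A_def mult.assoc Vd)
  moreover have "norm (A * \<phi> g - \<sigma> g * A) \<le> n * c" if g: "g \<in> carrier G" for g
  proof -
    have "\<sigma> g * A = adj w * \<rho> g * q' * V" by (simp add: \<sigma>_def A_def mult.assoc w(2)[symmetric])
    also have "\<dots> = adj w * q' * \<rho> g * V" using q\<rho>[OF g] by (metis mult.assoc)
    finally have "A * \<phi> g - \<sigma> g * A = adj w * (V * \<phi> g - \<rho> g * V)"
      by (simp add: wq A_def right_diff_distrib mult.assoc)
    also have "norm \<dots> \<le> norm (V * \<phi> g - \<rho> g * V)"
      by (rule contractionD(2)) (rule contraction_adj[OF isometry_contraction[OF w(1)]])
    finally show ?thesis using near[OF g] by (simp add: norm_minus_commute)
  qed
  moreover have "norm (adj A * A - idm d) \<le> 14 * (n * c) * (2 + n)"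
  proof -
    have "adj A * A - idm d = adj V * ((q' - Q) * V)"
      by (simp add: A_def adj_mult w(2)[symmetric] left_diff_distrib right_diff_distrib mult.assoc
          Q_def V(1) mult_extend[OF V(1)])
    also have "norm \<dots> \<le> norm ((q' - Q) * V)" by (rule contractionD(2)[OF contraction_adj[OF cV]])
    also have "\<dots> \<le> norm (q' - Q)" by (rule contractionD(1)[OF cV])
    finally show ?thesis using q'(4) by simp
  qed
  ultimately show thesis using that[OF md \<sigma> _ mA] by blast
qed

text \<open>Fills the missing \<open>d - m\<close> dimensions with the identity, to pass from rank
  at most \<open>d\<close> to dimension exactly \<open>d\<close>.\<close>

lemma pad_unitary:
  assumes "unitary m u" "m \<le> d"
  shows "unitary d (u + (idm d - idm m))"
proof -
  have e: "idm d * u = u" "u * idm d = u" "idm d * adj u = adj u" "adj u * idm d = adj u"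
  proof -
    have m: "idm d * idm m = idm m" "idm m * idm d = idm m" using assms(2) by (simp_all add: min_def)
    show "idm d * u = u" "u * idm d = u" "idm d * adj u = adj u" "adj u * idm d = adj u"
      using unitaryD[OF assms(1)] m by (metis mult.assoc)+
  qed
  show ?thesis
    using unitaryD[OF assms(1)] e assms(2)
    by (simp add: unitary_def adj_add adj_diff algebra_simps min_def)
qed

text \<open>Uniformity in \<open>d\<close> holds because every error is a multiple of
  \<open>\<delta> * sqrt d\<close> whose factor depends only on the order of the group.\<close>

theorem finite_group_stability:
  assumes G: "group G" and fin: "finite (carrier G)" and \<epsilon>: "0 < \<epsilon>"
  shows "\<exists>\<delta>>0. \<forall>d \<phi>. (\<forall>g\<in>carrier G. unitary d (\<phi> g)) \<longrightarrow>
    (\<forall>g\<in>carrier G. \<forall>h\<in>carrier G. norm (\<phi> (g \<otimes>\<^bsub>G\<^esub> h) - \<phi> g * \<phi> h) \<le> \<delta> * sqrt d) \<longrightarrow>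
    (\<exists>\<pi>. urep G d \<pi> \<and> (\<forall>g\<in>carrier G. norm (\<phi> g - \<pi> g) \<le> \<epsilon> * sqrt d))"
proof -
  interpret group G by fact
  define n where "n = real (card (carrier G))"
  have "card (carrier G) > 0" using fin by (auto simp: card_gt_0_iff)
  then have n1: "n \<ge> 1" by (simp add: n_def)
  \<comment> \<open>29 = 1 + 2 * 14: one intertwining error, and twice the distance from
    \<open>A\<close> to the unitary \<open>u\<close>.\<close>
  define \<delta> where "\<delta> = \<epsilon> / (29 * n * (2 + n))"
  have \<delta>: "\<delta> > 0" using \<epsilon> n1 by (simp add: \<delta>_def)
  show ?thesis
  proof (intro exI[of _ \<delta>] conjI allI impI \<delta>)
    fix d \<phi>
    assume uni0: "\<forall>g\<in>carrier G. unitary d (\<phi> g)"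
      and alm0: "\<forall>g\<in>carrier G. \<forall>h\<in>carrier G. norm (\<phi> (g \<otimes>\<^bsub>G\<^esub> h) - \<phi> g * \<phi> h) \<le> \<delta> * sqrt (real d)"
    have uni: "\<And>g. g \<in> carrier G \<Longrightarrow> unitary d (\<phi> g)" using uni0 by blast
    have alm: "\<And>g h. g \<in> carrier G \<Longrightarrow> h \<in> carrier G \<Longrightarrow> norm (\<phi> (g \<otimes>\<^bsub>G\<^esub> h) - \<phi> g * \<phi> h) \<le> \<delta> * sqrt (real d)"
      using alm0 by blast
    let ?c = "\<delta> * sqrt (real d)"
    have c0: "0 \<le> ?c" using \<delta> by simp
    obtain m \<rho> A where A: "m \<le> d" "urep G m \<rho>" "corner d A" "idm m * A = A"
      "\<And>g. g \<in> carrier G \<Longrightarrow> norm (A * \<phi> g - \<rho> g * A) \<le> n * ?c"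
      "norm (adj A * A - idm d) \<le> 14 * (n * ?c) * (2 + n)"
      using approximate_intertwiner[OF fin uni alm n_def c0] by blast
    obtain u where u: "unitary d u" "norm (A - u) \<le> norm (adj A * A - idm d)"
      using unitary_near[OF A(3)] by blast
    define \<sigma> where "\<sigma> g = \<rho> g + (idm d - idm m)" for g
    have \<rho>u: "unitary m (\<rho> g)" if "g \<in> carrier G" for g using A(2) that by (simp add: urep_def)
    have \<sigma>u: "unitary d (\<sigma> g)" if "g \<in> carrier G" for g
      unfolding \<sigma>_def by (rule pad_unitary[OF \<rho>u[OF that] A(1)])
    have mm: "idm d * idm m = idm m" "idm m * idm d = idm m" using A(1) by (simp_all add: min_def)
    have \<sigma>m: "\<sigma> (g \<otimes>\<^bsub>G\<^esub> h) = \<sigma> g * \<sigma> h" if "g \<in> carrier G" "h \<in> carrier G" for g h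
    proof -
      have 1: "\<rho> g * (idm d - idm m) = 0"
        using unitaryD(3)[OF \<rho>u[OF that(1)]] mm
        by (metis (no_types, lifting) idm_idm min.idem mult.assoc mult_zero_right right_diff_distrib right_minus_eq)
      have 2: "(idm d - idm m) * \<rho> h = 0"
        using unitaryD(4)[OF \<rho>u[OF that(2)]] mm
        by (metis (no_types, lifting) idm_idm min.idem mult.assoc mult_zero_left left_diff_distrib right_minus_eq)
      have 3: "(idm d - idm m) * (idm d - idm m) = idm d - idm m"
        using mm by (simp add: left_diff_distrib right_diff_distrib del: idm_idm) simp
      have "\<rho> (g \<otimes>\<^bsub>G\<^esub> h) = \<rho> g * \<rho> h" using A(2) that by (simp add: urep_def)
      then show ?thesis by (simp add: \<sigma>_def distrib_left distrib_right 1 2 3)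
    qed
    define \<pi> where "\<pi> g = adj u * \<sigma> g * u" for g
    have "urep G d \<pi>"
      unfolding urep_def
    proof (intro conjI ballI)
      fix g assume g: "g \<in> carrier G"
      show "unitary d (\<pi> g)"
        unfolding \<pi>_def by (intro unitary_mult unitary_adj u \<sigma>u g)
      fix h assume h: "h \<in> carrier G"
      have "\<pi> g * \<pi> h = adj u * \<sigma> g * (u * adj u) * \<sigma> h * u" by (simp add: \<pi>_def mult.assoc)
      also have "\<dots> = \<pi> (g \<otimes>\<^bsub>G\<^esub> h)"
        using unitaryD[OF u(1)] unitaryD[OF \<sigma>u[OF g]] by (simp add: \<pi>_def \<sigma>m g h mult.assoc mult_extend[OF unitaryD(4)[OF \<sigma>u[OF h]]])
      finally show "\<pi> (g \<otimes>\<^bsub>G\<^esub> h) = \<pi> g * \<pi> h" by simp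
    qed
    moreover have "norm (\<phi> g - \<pi> g) \<le> \<epsilon> * sqrt (real d)" if g: "g \<in> carrier G" for g
    proof -
      have \<sigma>A: "\<sigma> g * A = \<rho> g * A"
      proof -
        have "(idm d - idm m) * A = 0" using A(3,4) by (simp add: corner_def left_diff_distrib)
        then show ?thesis by (simp add: \<sigma>_def distrib_right)
      qed
      have "\<phi> g - \<pi> g = adj u * (u * \<phi> g - \<sigma> g * u)"
        using unitaryD[OF u(1)] unitaryD[OF uni[OF g]]
        by (simp add: \<pi>_def right_diff_distrib mult.assoc mult_extend[OF unitaryD(1)[OF u(1)]])
      also have "norm \<dots> \<le> norm (u * \<phi> g - \<sigma> g * u)"
        by (rule unitary_norm_le(1)[OF unitary_adj[OF u(1)]])
      \<comment> \<open>The padding is invisible to \<open>A\<close>, so its intertwining error is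
        that of \<open>\<rho>\<close>; exchanging \<open>u\<close> for \<open>A\<close> costs their
        distance twice.\<close>
      also have "u * \<phi> g - \<sigma> g * u = (A * \<phi> g - \<rho> g * A) + (\<sigma> g * (A - u) - (A - u) * \<phi> g)"
        by (simp add: algebra_simps \<sigma>A)
      also have "norm \<dots> \<le> norm (A * \<phi> g - \<rho> g * A) + (norm (\<sigma> g * (A - u)) + norm ((A - u) * \<phi> g))"
        by (meson add_left_mono norm_triangle_ineq norm_triangle_ineq4 order_trans)
      also have "\<dots> \<le> n * ?c + (norm (A - u) + norm (A - u))"
        using A(5)[OF g] unitary_norm_le(1)[OF \<sigma>u[OF g]] unitary_norm_le(2)[OF uni[OF g]]
        by (intro add_mono) auto
      also have "\<dots> \<le> n * ?c + 2 * (14 * (n * ?c) * (2 + n))" using order_trans[OF u(2) A(6)] by linarith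
      also have "\<dots> \<le> 29 * n * (2 + n) * ?c"
      proof -
        have "n * ?c * 1 \<le> n * ?c * (2 + n)" using n1 c0 by (intro mult_left_mono) auto
        then show ?thesis by (simp add: algebra_simps)
      qed
      also have "\<dots> = \<epsilon> * sqrt (real d)" using n1 by (simp add: \<delta>_def)
      finally show ?thesis .
    qed
    ultimately show "\<exists>\<pi>. urep G d \<pi> \<and> (\<forall>g\<in>carrier G. norm (\<phi> g - \<pi> g) \<le> \<epsilon> * sqrt (real d))" by blast
  qed
qed

section \<open>Finitary matrices and the matrices of the statement\<close>

lift_definition emb :: "complex mat \<Rightarrow> fmat"
  is "\<lambda>A i j. if i < dim_row A \<and> j < dim_col A then A $$ (i, j) else 0"
proof -
  fix A :: "complex mat"
  show "\<exists>N. \<forall>i j. (if i < dim_row A \<and> j < dim_col A then A $$ (i, j) else 0) \<noteq> 0 \<longrightarrow> i < N \<and> j < N"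
    by (rule exI[of _ "max (dim_row A) (dim_col A)"]) auto
qed

definition to_mat :: "nat \<Rightarrow> fmat \<Rightarrow> complex mat"
  where "to_mat d a = mat d d (\<lambda>(i, j). ent a i j)"

lemma to_mat_carrier [simp]: "to_mat d a \<in> carrier_mat d d"
  by (simp add: to_mat_def)

lemma emb_to_mat:
  assumes "corner d a"
  shows "emb (to_mat d a) = a"
proof (rule fmat_eqI)
  fix i j
  have "ent a i j = (if i < d \<and> j < d then ent a i j else 0)"
    using assms idm_mult_ent[of d a i j] mult_idm_ent[of a d i j] by (auto simp: corner_def split: if_splits)
  then show "ent (emb (to_mat d a)) i j = ent a i j" by (auto simp: emb.rep_eq to_mat_def)
qed

lemma emb_inj:
  assumes "A \<in> carrier_mat d d" "B \<in> carrier_mat d d" "emb A = emb B"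
  shows "A = B"
proof (rule eq_matI)
  fix i j assume "i < dim_row B" "j < dim_col B"
  then have "A $$ (i, j) = ent (emb A) i j" "B $$ (i, j) = ent (emb B) i j"
    using assms(1,2) by (simp_all add: emb.rep_eq)
  then show "A $$ (i, j) = B $$ (i, j)" by (simp only: assms(3))
qed (use assms in auto)

lemma emb_mult:
  assumes A: "A \<in> carrier_mat d d" and B: "B \<in> carrier_mat d d"
  shows "emb (A * B) = emb A * emb B"
proof (rule fmat_eqI)
  fix i j
  have e: "ent (emb A * emb B) i j = (\<Sum>k<d. ent (emb A) i k * ent (emb B) k j)"
    by (rule ent_times) (use A in \<open>auto simp: emb.rep_eq split: if_splits\<close>)
  show "ent (emb (A * B)) i j = ent (emb A * emb B) i j"
    unfolding e using A B by (auto simp: emb.rep_eq scalar_prod_def atLeast0LessThan intro!: sum.cong)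
qed

lemma emb_diff: "A \<in> carrier_mat d d \<Longrightarrow> B \<in> carrier_mat d d \<Longrightarrow> emb (A - B) = emb A - emb B"
  by (rule fmat_eqI) (auto simp: emb.rep_eq ent_minus)

lemma mat_adjoint_index:
  "i < dim_col A \<Longrightarrow> j < dim_row A \<Longrightarrow> mat_adjoint A $$ (i, j) = cnj (A $$ (j, i))"
  for A :: "complex mat"
  by (simp add: mat_adjoint_def mat_of_rows_def)

lemma dim_mat_adjoint [simp]:
  "dim_row (mat_adjoint A) = dim_col A" "dim_col (mat_adjoint A) = dim_row A"
  by (simp_all add: mat_adjoint_def)

lemma mat_adjoint_carrier [simp]: "A \<in> carrier_mat d d \<Longrightarrow> mat_adjoint A \<in> carrier_mat d d"
  by (intro carrier_matI) auto

lemma emb_adjoint: "A \<in> carrier_mat d d \<Longrightarrow> emb (mat_adjoint A) = adj (emb A)"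
  by (rule fmat_eqI) (simp add: emb.rep_eq adj.rep_eq mat_adjoint_index)

lemma emb_one: "emb (1\<^sub>m d) = idm d"
  by (rule fmat_eqI) (auto simp: emb.rep_eq idm.rep_eq)

lemma emb_trace: "A \<in> carrier_mat d d \<Longrightarrow> mat_trace A = tr (emb A)"
  by (subst tr_eq[of _ d]) (auto simp: mat_trace_def emb.rep_eq split: if_splits)

text \<open>Normalization by the dimension becomes the factor \<open>sqrt d\<close> carried by all
  bounds on the finitary side.\<close>

lemma hs_dist_emb:
  assumes A: "A \<in> carrier_mat d d" and B: "B \<in> carrier_mat d d"
  shows "hs_dist A B = norm (emb A - emb B) / sqrt d"
proof -
  have AB: "A - B \<in> carrier_mat d d" using B by (rule minus_carrier_mat)
  have "mat_trace (mat_adjoint (A - B) * (A - B)) = tr (adj (emb A - emb B) * (emb A - emb B))"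
    using AB by (simp add: emb_trace[of _ d] mult_carrier_mat[of _ d d] emb_mult[of _ d] emb_adjoint[of _ d] emb_diff[OF A B])
  then show ?thesis using A by (simp add: hs_dist_def norm_sq_tr[symmetric] real_sqrt_divide)
qed

lemma unitary_group_emb:
  "A \<in> carrier (unitary_group d) \<longleftrightarrow> A \<in> carrier_mat d d \<and> unitary d (emb A)"
proof -
  have "mat_adjoint A * A = 1\<^sub>m d \<longleftrightarrow> adj (emb A) * emb A = idm d"
    "A * mat_adjoint A = 1\<^sub>m d \<longleftrightarrow> emb A * adj (emb A) = idm d" if A: "A \<in> carrier_mat d d"
  proof -
    have c: "mat_adjoint A * A \<in> carrier_mat d d" "A * mat_adjoint A \<in> carrier_mat d d"
      using A by (auto intro!: mult_carrier_mat[of _ d d])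
    have e: "emb (mat_adjoint A * A) = adj (emb A) * emb A" "emb (A * mat_adjoint A) = emb A * adj (emb A)"
      using A by (simp_all add: emb_mult[of _ d] emb_adjoint[of _ d])
    show "mat_adjoint A * A = 1\<^sub>m d \<longleftrightarrow> adj (emb A) * emb A = idm d"
      "A * mat_adjoint A = 1\<^sub>m d \<longleftrightarrow> emb A * adj (emb A) = idm d"
      unfolding e[symmetric] emb_one[symmetric] using emb_inj[OF c(1)] emb_inj[OF c(2)] by auto
  qed
  then show ?thesis by (auto simp: unitary_group_def unitary_def)
qed

lemma unitary_to_mat: "unitary d u \<Longrightarrow> to_mat d u \<in> carrier (unitary_group d)"
  by (simp add: unitary_group_emb emb_to_mat unitary_corner)

section \<open>Stability for finitary matrices\<close>

definition fmat_almost_rep :: "('a, 'm) monoid_scheme \<Rightarrow> 'a set \<Rightarrow> real \<Rightarrow> nat \<Rightarrow> ('a \<Rightarrow> fmat) \<Rightarrow> bool"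
  where "fmat_almost_rep G B \<delta> d \<phi> \<longleftrightarrow> (\<forall>g\<in>B. unitary d (\<phi> g)) \<and>
    (\<forall>g\<in>B. \<forall>h\<in>B. g \<otimes>\<^bsub>G\<^esub> h \<in> B \<longrightarrow> norm (\<phi> (g \<otimes>\<^bsub>G\<^esub> h) - \<phi> g * \<phi> h) \<le> \<delta> * sqrt d)"

definition fmat_stable :: "('a, 'm) monoid_scheme \<Rightarrow> 'a set \<Rightarrow> bool"
  where "fmat_stable G S \<longleftrightarrow>
    (\<forall>\<epsilon>>0. \<exists>\<delta>>0. \<exists>n\<ge>1. \<forall>d\<ge>1. \<forall>\<phi>. fmat_almost_rep G (word_ball G S n) \<delta> d \<phi> \<longrightarrow>
       (\<exists>\<pi>. urep G d \<pi> \<and> (\<forall>s\<in>S. norm (\<phi> s - \<pi> s) < \<epsilon> * sqrt d)))"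

lemma word_ball_one: "\<one>\<^bsub>G\<^esub> \<in> word_ball G S n"
  unfolding word_ball_def by (intro CollectI exI[of _ "[]"]) simp

lemma (in monoid) word_ball_gen:
  assumes "s \<in> S" "S \<subseteq> carrier G" "n \<ge> 1"
  shows "s \<in> word_ball G S n"
  unfolding word_ball_def by (intro CollectI exI[of _ "[s]"]) (use assms in auto)

lemma urep_unitary: "urep G d \<pi> \<Longrightarrow> g \<in> carrier G \<Longrightarrow> unitary d (\<pi> g)"
  by (simp add: urep_def)

lemma hom_unitary_group:
  assumes "\<pi> \<in> hom G (unitary_group d)"
  shows "urep G d (\<lambda>g. emb (\<pi> g))"
proof -
  have "\<pi> g \<in> carrier (unitary_group d)" if "g \<in> carrier G" for g
    using assms that by (auto simp: hom_def)
  moreover have "\<pi> (g \<otimes>\<^bsub>G\<^esub> h) = \<pi> g * \<pi> h" if "g \<in> carrier G" "h \<in> carrier G" for g h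
    using assms that by (simp add: hom_def unitary_group_def)
  ultimately show ?thesis by (auto simp: urep_def unitary_group_emb emb_mult[of _ d])
qed

lemma urep_hom:
  assumes "urep G d \<pi>"
  shows "(\<lambda>g. to_mat d (\<pi> g)) \<in> hom G (unitary_group d)"
proof (rule homI)
  fix g assume g: "g \<in> carrier G"
  then show "to_mat d (\<pi> g) \<in> carrier (unitary_group d)"
    using assms by (auto simp: urep_def intro: unitary_to_mat)
  fix h assume h: "h \<in> carrier G"
  have c: "corner d (\<pi> g)" "corner d (\<pi> h)" "corner d (\<pi> g * \<pi> h)"
    using assms g h unitary_mult by (auto simp: urep_def intro!: unitary_corner)
  have "to_mat d (\<pi> g * \<pi> h) = to_mat d (\<pi> g) * to_mat d (\<pi> h)"
    by (rule emb_inj[of _ d]) (auto simp: emb_to_mat emb_mult[of _ d] c intro!: mult_carrier_mat[of _ d d])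
  then show "to_mat d (\<pi> (g \<otimes>\<^bsub>G\<^esub> h)) = to_mat d (\<pi> g) \<otimes>\<^bsub>unitary_group d\<^esub> to_mat d (\<pi> h)"
    using assms g h by (simp add: urep_def unitary_group_def)
qed

text \<open>In the ring of finitary matrices all sizes coexist, so representations found on the
  blocks of a commutant can be assembled directly.\<close>

lemma (in monoid) hs_stable_wrt_fmat:
  assumes S: "S \<subseteq> carrier G"
  shows "hs_stable_wrt G S \<longleftrightarrow> fmat_stable G S"
proof
  assume st: "hs_stable_wrt G S"
  show "fmat_stable G S"
    unfolding fmat_stable_def
  proof (intro allI impI)
    fix \<epsilon> :: real assume "\<epsilon> > 0"
    then obtain \<delta> n where \<delta>: "\<delta> > 0" "n \<ge> 1" and
      *: "\<And>d \<phi>. d \<ge> 1 \<Longrightarrow> almost_representation G S n \<delta> d \<phi> \<Longrightarrow>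
        \<exists>\<pi>\<in>hom G (unitary_group d). \<forall>s\<in>S. hs_dist (\<phi> s) (\<pi> s) < \<epsilon>"
      using st unfolding hs_stable_wrt_def by metis
    show "\<exists>\<delta>>0. \<exists>n\<ge>1. \<forall>d\<ge>1. \<forall>\<phi>. fmat_almost_rep G (word_ball G S n) \<delta> d \<phi> \<longrightarrow>
       (\<exists>\<pi>. urep G d \<pi> \<and> (\<forall>s\<in>S. norm (\<phi> s - \<pi> s) < \<epsilon> * sqrt d))"
    proof (intro exI[of _ \<delta>] exI[of _ n] conjI allI impI \<delta>)
      fix d :: nat and \<phi> assume d: "d \<ge> 1" and \<phi>: "fmat_almost_rep G (word_ball G S n) \<delta> d \<phi>"
      define \<psi> where "\<psi> g = to_mat d (\<phi> g)" for g
      have u: "unitary d (\<phi> g)" if "g \<in> word_ball G S n" for g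
        using \<phi> that by (simp add: fmat_almost_rep_def)
      have e: "emb (\<psi> g) = \<phi> g" if "g \<in> word_ball G S n" for g
        unfolding \<psi>_def by (rule emb_to_mat[OF unitary_corner[OF u[OF that]]])
      have "almost_representation G S n \<delta> d \<psi>"
        unfolding almost_representation_def
      proof (intro conjI ballI impI)
        show "\<psi> \<in> word_ball G S n \<rightarrow> carrier (unitary_group d)"
          using unitary_to_mat[OF u] by (auto simp: \<psi>_def)
        fix g h assume gh: "g \<in> word_ball G S n" "h \<in> word_ball G S n" "g \<otimes> h \<in> word_ball G S n"
        have c: "\<psi> x \<in> carrier_mat d d" for x by (simp add: \<psi>_def)
        have "hs_dist (\<psi> (g \<otimes> h)) (\<psi> g * \<psi> h) = norm (\<phi> (g \<otimes> h) - \<phi> g * \<phi> h) / sqrt d"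
          using gh e by (subst hs_dist_emb[of _ d]) (auto simp: c emb_mult[of _ d] intro!: mult_carrier_mat[of _ d d])
        also have "\<dots> \<le> \<delta>" using \<phi> gh d by (simp add: fmat_almost_rep_def divide_le_eq)
        finally show "hs_dist (\<psi> (g \<otimes> h)) (\<psi> g * \<psi> h) \<le> \<delta>" .
      qed
      from *[OF d this] obtain \<pi> where \<pi>: "\<pi> \<in> hom G (unitary_group d)" "\<And>s. s \<in> S \<Longrightarrow> hs_dist (\<psi> s) (\<pi> s) < \<epsilon>"
        by blast
      have "norm (\<phi> s - emb (\<pi> s)) < \<epsilon> * sqrt d" if s: "s \<in> S" for s
      proof -
        have "\<pi> s \<in> carrier_mat d d" using \<pi>(1) s S by (auto simp: hom_def unitary_group_emb)
        then have "hs_dist (\<psi> s) (\<pi> s) = norm (\<phi> s - emb (\<pi> s)) / sqrt d"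
          using e[OF word_ball_gen[OF s S \<delta>(2)]] by (subst hs_dist_emb[of _ d]) (auto simp: \<psi>_def)
        then show ?thesis using \<pi>(2)[OF s] d by (simp add: divide_less_eq)
      qed
      then show "\<exists>\<pi>. urep G d \<pi> \<and> (\<forall>s\<in>S. norm (\<phi> s - \<pi> s) < \<epsilon> * sqrt d)"
        using hom_unitary_group[OF \<pi>(1)] by blast
    qed
  qed
next
  assume st: "fmat_stable G S"
  show "hs_stable_wrt G S"
    unfolding hs_stable_wrt_def
  proof (intro allI impI)
    fix \<epsilon> :: real assume "\<epsilon> > 0"
    then obtain \<delta> n where \<delta>: "\<delta> > 0" "n \<ge> 1" and
      *: "\<And>d \<phi>. d \<ge> 1 \<Longrightarrow> fmat_almost_rep G (word_ball G S n) \<delta> d \<phi> \<Longrightarrow>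
        \<exists>\<pi>. urep G d \<pi> \<and> (\<forall>s\<in>S. norm (\<phi> s - \<pi> s) < \<epsilon> * sqrt d)"
      using st unfolding fmat_stable_def by metis
    show "\<exists>\<delta>>0. \<exists>n\<ge>1. \<forall>d\<ge>1. \<forall>\<phi>. almost_representation G S n \<delta> d \<phi> \<longrightarrow>
       (\<exists>\<pi>\<in>hom G (unitary_group d). \<forall>s\<in>S. hs_dist (\<phi> s) (\<pi> s) < \<epsilon>)"
    proof (intro exI[of _ \<delta>] exI[of _ n] conjI allI impI \<delta>)
      fix d :: nat and \<phi> assume d: "d \<ge> 1" and \<phi>: "almost_representation G S n \<delta> d \<phi>"
      have c: "\<phi> g \<in> carrier_mat d d" "unitary d (emb (\<phi> g))" if "g \<in> word_ball G S n" for g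
        using \<phi> that unitary_group_emb[of "\<phi> g" d] unfolding almost_representation_def by auto
      have "fmat_almost_rep G (word_ball G S n) \<delta> d (\<lambda>g. emb (\<phi> g))"
        unfolding fmat_almost_rep_def
      proof (intro conjI ballI impI c(2))
        fix g h assume gh: "g \<in> word_ball G S n" "h \<in> word_ball G S n" "g \<otimes> h \<in> word_ball G S n"
        have "hs_dist (\<phi> (g \<otimes> h)) (\<phi> g * \<phi> h) = norm (emb (\<phi> (g \<otimes> h)) - emb (\<phi> g) * emb (\<phi> h)) / sqrt d"
          using gh c by (subst hs_dist_emb[of _ d]) (auto simp: emb_mult[of _ d] intro!: mult_carrier_mat[of _ d d])
        moreover have "hs_dist (\<phi> (g \<otimes> h)) (\<phi> g * \<phi> h) \<le> \<delta>"
          using \<phi> gh by (simp add: almost_representation_def)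
        ultimately show "norm (emb (\<phi> (g \<otimes> h)) - emb (\<phi> g) * emb (\<phi> h)) \<le> \<delta> * sqrt d"
          using d by (simp add: divide_le_eq)
      qed
      from *[OF d this] obtain \<pi> where \<pi>: "urep G d \<pi>" "\<And>s. s \<in> S \<Longrightarrow> norm (emb (\<phi> s) - \<pi> s) < \<epsilon> * sqrt d"
        by blast
      have "hs_dist (\<phi> s) (to_mat d (\<pi> s)) < \<epsilon>" if s: "s \<in> S" for s
      proof -
        have "corner d (\<pi> s)" by (rule unitary_corner[OF urep_unitary[OF \<pi>(1)]]) (use s S in blast)
        then have "emb (to_mat d (\<pi> s)) = \<pi> s" by (rule emb_to_mat)
        then have "hs_dist (\<phi> s) (to_mat d (\<pi> s)) = norm (emb (\<phi> s) - \<pi> s) / sqrt d"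
          using hs_dist_emb[OF c(1)[OF word_ball_gen[OF s S \<delta>(2)]] to_mat_carrier] by simp
        then show ?thesis using \<pi>(2)[OF s] d by (simp add: divide_less_eq)
      qed
      then show "\<exists>\<pi>\<in>hom G (unitary_group d). \<forall>s\<in>S. hs_dist (\<phi> s) (\<pi> s) < \<epsilon>"
        by (intro bexI[of _ "\<lambda>g. to_mat d (\<pi> g)"] urep_hom[OF \<pi>(1)] ballI)
    qed
  qed
qed

section \<open>Stability of extensions by finite factors\<close>

text \<open>Telescoping, with one factor of each term estimated as a contraction.\<close>

lemma norm_adj_mult_diff:
  assumes "contraction x" "contraction y"
  shows "norm (adj y * y - adj x * x) \<le> 2 * norm (y - x)"
proof -
  have "adj y * y - adj x * x = adj (y - x) * y + adj x * (y - x)"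
    by (simp add: adj_diff algebra_simps)
  also have "norm \<dots> \<le> norm (adj (y - x) * y) + norm (adj x * (y - x))" by (rule norm_triangle_ineq)
  also have "\<dots> \<le> norm (adj (y - x)) + norm (y - x)"
    by (intro add_mono contractionD(1)[OF assms(2)] contractionD(2)[OF contraction_adj[OF assms(1)]])
  finally show ?thesis by simp
qed

text \<open>Telescoping, with one \<open>c\<close> for each of the three matrices replaced.\<close>

lemma norm_mult_defect:
  assumes "contraction a'" "contraction b" "norm (a - a') \<le> c" "norm (b - b') \<le> c" "norm (ab - ab') \<le> c"
  shows "norm (ab' - a' * b') \<le> norm (ab - a * b) + 3 * c"
proof -
  have "ab' - a' * b' = (ab - a * b) + ((a - a') * b + (a' * (b - b') - (ab - ab')))"
    by (simp add: algebra_simps)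
  also have "norm \<dots> \<le> norm (ab - a * b) + (norm ((a - a') * b) + (norm (a' * (b - b')) + norm (ab - ab')))"
    by (meson add_left_mono norm_triangle_ineq norm_triangle_ineq4 order_trans)
  also have "\<dots> \<le> norm (ab - a * b) + (c + (c + c))"
    by (intro add_mono order_refl assms(5) order_trans[OF contractionD(1)[OF assms(2)] assms(3)]
        order_trans[OF contractionD(2)[OF assms(1)] assms(4)])
  finally show ?thesis by simp
qed

text \<open>An approximate representation of \<open>G\<close> that almost commutes with a representation of the
  finite group \<open>P\<close> is moved into the commutant, block by block. Blocks on which the defect is not
  small have small total weight (Chebyshev's inequality) and may be replaced by the trivial
  representation.\<close>

theorem (in finite_urep) commutant_stability:
  fixes G :: "('g, 'k) monoid_scheme" and B S :: "'g set" and X :: "'g \<Rightarrow> fmat"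
  assumes stab: "\<And>k u. k \<ge> 1 \<Longrightarrow> fmat_almost_rep G B \<delta> k u \<Longrightarrow>
      \<exists>\<sigma>. urep G k \<sigma> \<and> (\<forall>s\<in>S. norm (u s - \<sigma> s) < \<epsilon> * sqrt k)"
    and B: "finite B" "S \<subseteq> B" "S \<subseteq> carrier G" and pos: "0 < \<delta>" "0 < \<epsilon>" "0 \<le> \<eta>"
    and small: "20 * real (card B) * \<eta> \<le> \<epsilon> * \<delta>"
    and X: "fmat_almost_rep G B \<eta> d X"
    and comm: "\<And>b p. b \<in> B \<Longrightarrow> p \<in> carrier P \<Longrightarrow> norm (\<rho> p * X b * adj (\<rho> p) - X b) \<le> \<eta> * sqrt d"
  shows "\<exists>\<sigma>. urep G d \<sigma> \<and> (\<forall>g\<in>carrier G. \<forall>p\<in>carrier P. \<sigma> g * \<rho> p = \<rho> p * \<sigma> g) \<and>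
    (\<forall>s\<in>S. norm (X s - \<sigma> s) \<le> (3 * \<eta> + 2 * \<epsilon>) * sqrt d)"
proof -
  interpret I: star_commutant "\<rho> ` carrier P" "idm d" by (rule commutant_idm)
  obtain F \<kappa> m J where fr: "frame (F :: fmat set) (\<kappa> :: fmat \<Rightarrow> fmat) m J d"
    and m1: "\<And>p. p \<in> F \<Longrightarrow> m (\<kappa> p) \<ge> 1"
    and blockM: "\<And>t. t \<in> frame.blocks F \<kappa> m \<Longrightarrow> frame.block F \<kappa> J t \<in> I.M"
    and Mblock: "\<And>x. x \<in> I.M \<Longrightarrow> \<exists>t\<in>frame.blocks F \<kappa> m. x = frame.block F \<kappa> J t"
    by (rule I.commutant_frame[OF refl]) blast
  interpret fr: frame F \<kappa> m J d by (rule fr)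
  define c where "c = \<eta> * sqrt d"
  have Xu: "unitary d (X b)" if "b \<in> B" for b using X that by (simp add: fmat_almost_rep_def)
  have Xm: "norm (X (b \<otimes>\<^bsub>G\<^esub> b') - X b * X b') \<le> c" if "b \<in> B" "b' \<in> B" "b \<otimes>\<^bsub>G\<^esub> b' \<in> B" for b b'
    using X that by (simp add: fmat_almost_rep_def c_def)
  \<comment> \<open>Averaging moves \<open>X b\<close> into the commutant at cost \<open>c\<close>
    but loses unitarity.\<close>
  have "\<forall>b. \<exists>y\<in>fr.blocks. avg (X b) = fr.block y" using Mblock avg_commutant by blast
  then obtain y where y: "\<And>b. y b \<in> fr.blocks" "\<And>b. avg (X b) = fr.block (y b)" by metis
  have YX: "norm (fr.block (y b) - X b) \<le> c" if "b \<in> B" for b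
    unfolding y(2)[symmetric] c_def by (rule avg_close) (rule comm[OF that])
  have yc: "corner (m (\<kappa> p)) (y b (\<kappa> p))" if "p \<in> F" for b p
    using y(1)[of b] that by (simp add: fr.blocks_def)
  \<comment> \<open>Unitarity is restored in each class separately, so that the result stays in the
    commutant.\<close>
  have "\<forall>b. \<forall>r\<in>\<kappa> ` F. \<exists>u. unitary (m r) u \<and> norm (y b r - u) \<le> norm (adj (y b r) * y b r - idm (m r))"
    using unitary_near yc by (metis imageE)
  then obtain u where u: "\<And>b r. r \<in> \<kappa> ` F \<Longrightarrow> unitary (m r) (u b r)"
    "\<And>b r. r \<in> \<kappa> ` F \<Longrightarrow> norm (y b r - u b r) \<le> norm (adj (y b r) * y b r - idm (m r))"
    by metis
  have ub: "u b \<in> fr.blocks" for b using u(1) unitary_corner by (simp add: fr.blocks_def)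
  define Z where "Z b = fr.block (u b)" for b
  have Zu: "unitary d (Z b)" for b unfolding Z_def using u(1) by (intro fr.unitary_block) auto
  have diff_blocks: "(\<lambda>r. s r - t r) \<in> fr.blocks" if "s \<in> fr.blocks" "t \<in> fr.blocks" for s t
    using that by (simp add: fr.blocks_def corner_def left_diff_distrib right_diff_distrib)
  have mult_blocks: "(\<lambda>r. s r * t r) \<in> fr.blocks" if "s \<in> fr.blocks" "t \<in> fr.blocks" for s t
    using that by (simp add: fr.blocks_def corner_def mult.assoc mult_extend[of "idm _"])
  \<comment> \<open>The failure of \<open>?Y\<close> to be unitary is measured against the unitary
    \<open>X b\<close>, which gives the factor 2.\<close>
  have YZ: "norm (fr.block (y b) - Z b) \<le> 2 * c" if b: "b \<in> B" for b
  proof -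
    let ?Y = "fr.block (y b)"
    have adjb: "(\<lambda>r. adj (y b r)) \<in> fr.blocks"
      using y(1)[of b] by (auto simp: fr.blocks_def corner_def) (metis adj_idm adj_mult)+
    have idb: "(\<lambda>r. idm (m r)) \<in> fr.blocks" by (simp add: fr.blocks_def corner_def)
    have yy: "(\<lambda>r. adj (y b r) * y b r - idm (m r)) \<in> fr.blocks"
      by (intro diff_blocks mult_blocks adjb idb y(1))
    have "adj ?Y * ?Y - idm d = fr.block (\<lambda>r. adj (y b r) * y b r - idm (m r))"
      by (simp add: fr.block_adj fr.block_mult[OF adjb] fr.block_diff[symmetric] fr.block_idm)
    then have "(\<Sum>p\<in>F. (norm (adj (y b (\<kappa> p)) * y b (\<kappa> p) - idm (m (\<kappa> p))))\<^sup>2) = (norm (adj ?Y * ?Y - idm d))\<^sup>2"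
      using fr.norm_block[OF yy] by simp
    moreover have "(norm (?Y - Z b))\<^sup>2 \<le> (\<Sum>p\<in>F. (norm (adj (y b (\<kappa> p)) * y b (\<kappa> p) - idm (m (\<kappa> p))))\<^sup>2)"
      unfolding Z_def fr.block_diff fr.norm_block[OF diff_blocks[OF y(1) ub]]
      by (intro sum_mono power_mono u(2)) auto
    ultimately have "norm (?Y - Z b) \<le> norm (adj ?Y * ?Y - idm d)"
      by (metis norm_ge_zero power2_le_imp_le)
    also have "idm d = adj (X b) * X b" using unitaryD[OF Xu[OF b]] by simp
    also have "norm (adj ?Y * ?Y - adj (X b) * X b) \<le> 2 * norm (?Y - X b)"
    proof (rule norm_adj_mult_diff)
      show "contraction (X b)" by (rule unitary_contraction[OF Xu[OF b]])
      then show "contraction ?Y" unfolding y(2)[symmetric] by (rule avg_contraction)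
    qed
    finally show ?thesis using YX[OF b] by simp
  qed
  have XZ: "norm (X b - Z b) \<le> 3 * c" if b: "b \<in> B" for b
  proof -
    have "X b - Z b = (fr.block (y b) - Z b) - (fr.block (y b) - X b)" by simp
    then show ?thesis using norm_triangle_ineq4[of "fr.block (y b) - Z b" "fr.block (y b) - X b"] YZ[OF b] YX[OF b]
      by simp
  qed
  \<comment> \<open>10 = 1 + 3 * 3: the defect of \<open>X\<close>, and three replacements at cost
    \<open>3 * c\<close> each.\<close>
  have Zm: "norm (Z (b \<otimes>\<^bsub>G\<^esub> b') - Z b * Z b') \<le> 10 * c" if b: "b \<in> B" "b' \<in> B" "b \<otimes>\<^bsub>G\<^esub> b' \<in> B" for b b'
    using norm_mult_defect[OF unitary_contraction[OF Zu] unitary_contraction[OF Xu[OF b(2)]] XZ[OF b(1)] XZ[OF b(2)] XZ[OF b(3)]]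
      Xm[OF b] by simp
  define R where "R = {(b, b'). b \<in> B \<and> b' \<in> B \<and> b \<otimes>\<^bsub>G\<^esub> b' \<in> B}"
  have RB: "R \<subseteq> B \<times> B" by (auto simp: R_def)
  have finR: "finite R" using RB B(1) finite_subset by blast
  have cardR: "real (card R) \<le> (real (card B))\<^sup>2"
    using card_mono[OF _ RB] B(1) by (simp add: card_cartesian_product power2_eq_square flip: of_nat_mult)
  define def where "def x r = norm (u (fst x \<otimes>\<^bsub>G\<^esub> snd x) r - u (fst x) r * u (snd x) r)" for x :: "'g \<times> 'g" and r
  have def_sum: "(\<Sum>p\<in>F. (def x (\<kappa> p))\<^sup>2) \<le> (10 * c)\<^sup>2" if x: "x \<in> R" for x
  proof -
    obtain b b' where x': "x = (b, b')" "b \<in> B" "b' \<in> B" "b \<otimes>\<^bsub>G\<^esub> b' \<in> B" using x by (auto simp: R_def)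
    have "Z (b \<otimes>\<^bsub>G\<^esub> b') - Z b * Z b' = fr.block (\<lambda>r. u (b \<otimes>\<^bsub>G\<^esub> b') r - u b r * u b' r)"
      by (simp add: Z_def fr.block_mult[OF ub] fr.block_diff[symmetric])
    then have "(\<Sum>p\<in>F. (def x (\<kappa> p))\<^sup>2) = (norm (Z (b \<otimes>\<^bsub>G\<^esub> b') - Z b * Z b'))\<^sup>2"
      using fr.norm_block[OF diff_blocks[OF ub mult_blocks[OF ub ub]]] by (simp add: def_def x'(1))
    also have "\<dots> \<le> (10 * c)\<^sup>2" by (rule power_mono[OF Zm[OF x'(2-4)] norm_ge_zero])
    finally show ?thesis .
  qed
  \<comment> \<open>The classes whose defect, normalized by their own size, is small enough for
    \<open>stab\<close>.\<close>
  define good where "good r \<longleftrightarrow> (\<forall>x\<in>R. def x r \<le> \<delta> * sqrt (m r))" for r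
  have "\<exists>\<sigma>. urep G (m r) \<sigma> \<and> (\<forall>s\<in>S. (norm (u s r - \<sigma> s))\<^sup>2 \<le> (if good r then \<epsilon>\<^sup>2 * m r else 4 * m r))"
    if r: "r \<in> \<kappa> ` F" for r
  proof (cases "good r")
    case True
    have "fmat_almost_rep G B \<delta> (m r) (\<lambda>b. u b r)"
      using True u(1)[OF r] by (auto simp: fmat_almost_rep_def good_def R_def def_def)
    moreover have "m r \<ge> 1" using r m1 by auto
    ultimately obtain \<sigma> where \<sigma>: "urep G (m r) \<sigma>" "\<And>s. s \<in> S \<Longrightarrow> norm (u s r - \<sigma> s) < \<epsilon> * sqrt (m r)"
      using stab by blast
    have "(norm (u s r - \<sigma> s))\<^sup>2 \<le> \<epsilon>\<^sup>2 * m r" if "s \<in> S" for s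
    proof -
      have "(norm (u s r - \<sigma> s))\<^sup>2 \<le> (\<epsilon> * sqrt (m r))\<^sup>2"
        by (rule power_mono[OF less_imp_le[OF \<sigma>(2)[OF that]] norm_ge_zero])
      then show ?thesis by (simp add: power_mult_distrib)
    qed
    then show ?thesis using \<sigma>(1) True by auto
  next
    case False
    \<comment> \<open>On a bad class the trivial representation is used; two unitaries of size
      \<open>m r\<close> have squared distance at most \<open>4 * m r\<close>.\<close>
    have "urep G (m r) (\<lambda>g. idm (m r))" by (simp add: urep_def)
    moreover have "(norm (u s r - idm (m r)))\<^sup>2 \<le> 4 * m r" for s
    proof -
      have "norm (u s r - idm (m r)) \<le> 2 * sqrt (m r)"
        using norm_triangle_ineq4[of "u s r" "idm (m r)"] unitary_norm[OF u(1)[OF r]] norm_idm[of "m r"] by simp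
      then have "(norm (u s r - idm (m r)))\<^sup>2 \<le> (2 * sqrt (m r))\<^sup>2" by (rule power_mono) simp
      then show ?thesis by (simp add: power_mult_distrib)
    qed
    ultimately show ?thesis using False by auto
  qed
  then obtain \<tau> where \<tau>: "\<And>r. r \<in> \<kappa> ` F \<Longrightarrow> urep G (m r) (\<tau> r)"
    "\<And>r s. r \<in> \<kappa> ` F \<Longrightarrow> s \<in> S \<Longrightarrow> (norm (u s r - \<tau> r s))\<^sup>2 \<le> (if good r then \<epsilon>\<^sup>2 * m r else 4 * m r)"
    by metis
  define \<sigma> where "\<sigma> g = fr.block (\<lambda>r. \<tau> r g)" for g
  have \<tau>u: "unitary (m (\<kappa> p)) (\<tau> (\<kappa> p) g)" if "p \<in> F" "g \<in> carrier G" for p g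
    using \<tau>(1) that by (auto intro: urep_unitary)
  have \<tau>b: "(\<lambda>r. \<tau> r g) \<in> fr.blocks" if "g \<in> carrier G" for g
    using \<tau>u that unitary_corner by (simp add: fr.blocks_def)
  have "urep G d \<sigma>"
    unfolding urep_def
  proof (intro conjI ballI)
    fix g assume g: "g \<in> carrier G"
    show "unitary d (\<sigma> g)" unfolding \<sigma>_def by (rule fr.unitary_block) (rule \<tau>u[OF _ g])
    fix h assume h: "h \<in> carrier G"
    have "\<sigma> g * \<sigma> h = fr.block (\<lambda>r. \<tau> r g * \<tau> r h)"
      by (simp add: \<sigma>_def fr.block_mult[OF \<tau>b[OF g]])
    also have "\<dots> = \<sigma> (g \<otimes>\<^bsub>G\<^esub> h)"
      unfolding \<sigma>_def by (rule fr.block_cong) (use \<tau>(1) g h in \<open>simp add: urep_def\<close>)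
    finally show "\<sigma> (g \<otimes>\<^bsub>G\<^esub> h) = \<sigma> g * \<sigma> h" by simp
  qed
  moreover have "\<sigma> g * \<rho> p = \<rho> p * \<sigma> g" if "g \<in> carrier G" "p \<in> carrier P" for g p
    using I.M_D(3)[OF blockM[OF \<tau>b[OF that(1)]]] that(2) by (simp add: \<sigma>_def)
  moreover have "norm (X s - \<sigma> s) \<le> (3 * \<eta> + 2 * \<epsilon>) * sqrt d" if s: "s \<in> S" for s
  proof -
    \<comment> \<open>Chebyshev: a bad class contributes at least
      \<open>\<delta>\<^sup>2 * m r\<close> to the squared defects summed over
      \<open>R\<close>.\<close>
    have bad: "real (m r) * \<delta>\<^sup>2 \<le> (\<Sum>x\<in>R. (def x r)\<^sup>2)" if nb: "\<not> good r" for r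
    proof -
      obtain x where x: "x \<in> R" "def x r > \<delta> * sqrt (m r)" using nb by (auto simp: good_def not_le)
      have "real (m r) * \<delta>\<^sup>2 = (\<delta> * sqrt (m r))\<^sup>2" by (simp add: power_mult_distrib)
      also have "\<dots> \<le> (def x r)\<^sup>2" using x(2) pos by (intro power_mono) auto
      also have "\<dots> \<le> (\<Sum>x\<in>R. (def x r)\<^sup>2)" by (rule member_le_sum[OF x(1)]) (simp_all add: finR)
      finally show ?thesis .
    qed
    have "\<delta>\<^sup>2 * (\<Sum>p\<in>F. if good (\<kappa> p) then 0 else real (m (\<kappa> p))) \<le> (\<Sum>p\<in>F. \<Sum>x\<in>R. (def x (\<kappa> p))\<^sup>2)"
      unfolding sum_distrib_left
      by (rule sum_mono) (use bad in \<open>auto simp: sum_nonneg mult.commute\<close>)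
    also have "\<dots> = (\<Sum>x\<in>R. \<Sum>p\<in>F. (def x (\<kappa> p))\<^sup>2)" by (rule sum.swap)
    also have "\<dots> \<le> (\<Sum>x\<in>R. (10 * c)\<^sup>2)" by (rule sum_mono) (rule def_sum)
    also have "\<dots> = real (card R) * (10 * c)\<^sup>2" by simp
    also have "\<dots> \<le> (real (card B))\<^sup>2 * (10 * c)\<^sup>2" by (intro mult_right_mono cardR) simp
    \<comment> \<open>The 20 in \<open>small\<close> is 2 * 10: 2 bounds the normalized distance of
      two unitaries on a bad class, and 10 comes from \<open>Zm\<close>.\<close>
    finally have "4 * (\<delta>\<^sup>2 * (\<Sum>p\<in>F. if good (\<kappa> p) then 0 else real (m (\<kappa> p)))) \<le> (20 * real (card B) * \<eta>)\<^sup>2 * d"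
      by (simp add: c_def power_mult_distrib mult_ac)
    also have "\<dots> \<le> (\<epsilon> * \<delta>)\<^sup>2 * d"
      using small pos by (intro mult_right_mono power_mono) auto
    finally have "\<delta>\<^sup>2 * (4 * (\<Sum>p\<in>F. if good (\<kappa> p) then 0 else real (m (\<kappa> p)))) \<le> \<delta>\<^sup>2 * (\<epsilon>\<^sup>2 * d)"
      by (simp add: power_mult_distrib mult_ac)
    then have weight: "4 * (\<Sum>p\<in>F. if good (\<kappa> p) then 0 else real (m (\<kappa> p))) \<le> \<epsilon>\<^sup>2 * d"
      using pos by (simp add: mult_le_cancel_left_pos)
    have sG: "s \<in> carrier G" using s B(3) by blast
    have "(norm (Z s - \<sigma> s))\<^sup>2 = (\<Sum>p\<in>F. (norm (u s (\<kappa> p) - \<tau> (\<kappa> p) s))\<^sup>2)"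
      unfolding Z_def \<sigma>_def fr.block_diff by (rule fr.norm_block[OF diff_blocks[OF ub \<tau>b[OF sG]]])
    also have "\<dots> \<le> (\<Sum>p\<in>F. \<epsilon>\<^sup>2 * real (m (\<kappa> p)) + 4 * (if good (\<kappa> p) then 0 else real (m (\<kappa> p))))"
    proof (rule sum_mono)
      fix p assume "p \<in> F"
      then have "(norm (u s (\<kappa> p) - \<tau> (\<kappa> p) s))\<^sup>2 \<le> (if good (\<kappa> p) then \<epsilon>\<^sup>2 * m (\<kappa> p) else 4 * m (\<kappa> p))"
        using \<tau>(2) s by blast
      then show "(norm (u s (\<kappa> p) - \<tau> (\<kappa> p) s))\<^sup>2
          \<le> \<epsilon>\<^sup>2 * real (m (\<kappa> p)) + 4 * (if good (\<kappa> p) then 0 else real (m (\<kappa> p)))"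
        by (cases "good (\<kappa> p)") (auto intro: order_trans)
    qed
    also have "\<dots> = \<epsilon>\<^sup>2 * (\<Sum>p\<in>F. real (m (\<kappa> p))) + 4 * (\<Sum>p\<in>F. if good (\<kappa> p) then 0 else real (m (\<kappa> p)))"
      by (simp add: sum.distrib sum_distrib_left)
    \<comment> \<open>One share for the good classes and one for the bad classes.\<close>
    also have "\<dots> \<le> \<epsilon>\<^sup>2 * d + \<epsilon>\<^sup>2 * d" using weight unfolding fr.dimension by linarith
    also have "\<dots> \<le> (2 * \<epsilon> * sqrt d)\<^sup>2" by (simp add: power_mult_distrib)
    finally have "norm (Z s - \<sigma> s) \<le> 2 * \<epsilon> * sqrt d"
      by (rule power2_le_imp_le) (use pos in simp)
    moreover have "norm (X s - Z s) \<le> 3 * (\<eta> * sqrt d)" using XZ s B(2) by (auto simp: c_def)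
    moreover have "norm (X s - \<sigma> s) \<le> norm (X s - Z s) + norm (Z s - \<sigma> s)"
      using norm_triangle_ineq[of "X s - Z s" "Z s - \<sigma> s"] by simp
    ultimately show ?thesis by (simp add: algebra_simps)
  qed
  ultimately show ?thesis by blast
qed

section \<open>Word balls\<close>

lemma (in monoid) word_ball_mono: "m \<le> n \<Longrightarrow> word_ball G S m \<subseteq> word_ball G S n"
  unfolding word_ball_def using order_trans by blast

lemma (in group) word_ball_carrier:
  assumes "S \<subseteq> carrier G"
  shows "word_ball G S n \<subseteq> carrier G"
proof -
  have "foldr (\<otimes>) ws \<one> \<in> carrier G" if "set ws \<subseteq> S \<union> (\<lambda>s. inv s) ` S" for ws
    using that assms by (induction ws) auto
  then show ?thesis by (auto simp: word_ball_def)
qed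

lemma finite_word_ball:
  assumes "finite S"
  shows "finite (word_ball G S n)"
proof -
  have "word_ball G S n = (\<lambda>ws. foldr (\<otimes>\<^bsub>G\<^esub>) ws \<one>\<^bsub>G\<^esub>) ` {ws. set ws \<subseteq> S \<union> (\<lambda>s. inv\<^bsub>G\<^esub> s) ` S \<and> length ws \<le> n}"
    by (auto simp: word_ball_def)
  then show ?thesis using assms by (simp add: finite_lists_length_le)
qed

lemma (in group) generate_word_ball:
  assumes "S \<subseteq> carrier G" "x \<in> generate G S"
  shows "\<exists>n. x \<in> word_ball G S n"
  using assms(2)
proof (induction rule: generate.induct)
  case one
  then show ?case using word_ball_one by blast
next
  case (incl h)
  then show ?case using word_ball_gen[OF incl assms(1)] by blast
next
  case (inv h)
  then have "foldr (\<otimes>) [inv h] \<one> \<in> word_ball G S 1"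
    unfolding word_ball_def by (intro CollectI exI[of _ "[inv h]"]) auto
  moreover have "foldr (\<otimes>) [inv h] \<one> = inv h" using inv assms(1) by auto
  ultimately show ?case by metis
next
  case (eng h1 h2)
  then obtain m n u v where w: "h1 = foldr (\<otimes>) u \<one>" "set u \<subseteq> S \<union> (\<lambda>s. inv s) ` S"
    "h2 = foldr (\<otimes>) v \<one>" "set v \<subseteq> S \<union> (\<lambda>s. inv s) ` S"
    by (auto simp: word_ball_def)
  have "h2 \<in> carrier G" using eng(2) assms(1) generate_in_carrier by blast
  \<comment> \<open>Starting the fold at \<open>h2\<close> instead of the identity turns
    concatenation of words into a product.\<close>
  then have "foldr (\<otimes>) u h2 = foldr (\<otimes>) u \<one> \<otimes> h2"
    using w(2)
  proof (induction u)
    case (Cons a u)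
    have c: "a \<in> carrier G" "set u \<subseteq> carrier G" using Cons.prems(2) assms(1) by auto
    then have "foldr (\<otimes>) u \<one> \<in> carrier G" by (induction u) auto
    then show ?case using Cons c by (simp add: m_assoc)
  qed simp
  then have "h1 \<otimes> h2 = foldr (\<otimes>) (u @ v) \<one>" using w by simp
  then have "h1 \<otimes> h2 \<in> word_ball G S (length (u @ v))"
    unfolding word_ball_def using w(2,4) by (intro CollectI exI[of _ "u @ v"]) auto
  then show ?case by blast
qed

lemma (in group) finite_subset_word_ball:
  assumes "S \<subseteq> carrier G" "generate G S = carrier G" "finite W" "W \<subseteq> carrier G"
  obtains n where "n \<ge> 1" "W \<subseteq> word_ball G S n"
proof -
  have "\<forall>x\<in>W. \<exists>n. x \<in> word_ball G S n" using generate_word_ball assms by blast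
  then obtain k where k: "\<And>x. x \<in> W \<Longrightarrow> x \<in> word_ball G S (k x)" by metis
  have "x \<in> word_ball G S (Suc (\<Sum>x\<in>W. k x))" if "x \<in> W" for x
  proof -
    have "k x \<le> (\<Sum>x\<in>W. k x)" by (rule member_le_sum) (use that assms in auto)
    then show ?thesis using word_ball_mono[of "k x" "Suc (\<Sum>x\<in>W. k x)"] k[OF that] by auto
  qed
  then show thesis using that[of "Suc (\<Sum>x\<in>W. k x)"] by auto
qed

text \<open>The generators chosen for the diagonal product include kernel elements, so the identity
  of \<open>G\<close> has to be controlled as well. Multiplicativity there makes its image almost
  idempotent, and an almost idempotent unitary is close to the identity.\<close>

lemma fmat_stable_insert_one:
  assumes G: "group G" and S: "S \<subseteq> carrier G" and st: "fmat_stable G S"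
  shows "fmat_stable G (insert \<one>\<^bsub>G\<^esub> S)"
proof -
  interpret group G by fact
  have sub: "word_ball G S n \<subseteq> word_ball G (insert \<one>\<^bsub>G\<^esub> S) n" for n
    unfolding word_ball_def by blast
  show ?thesis
    unfolding fmat_stable_def
  proof (intro allI impI)
    fix \<epsilon> :: real assume \<epsilon>: "\<epsilon> > 0"
    then obtain \<delta> n where \<delta>: "\<delta> > 0" "n \<ge> 1" and
      *: "\<And>d \<phi>. d \<ge> 1 \<Longrightarrow> fmat_almost_rep G (word_ball G S n) \<delta> d \<phi> \<Longrightarrow>
        \<exists>\<pi>. urep G d \<pi> \<and> (\<forall>s\<in>S. norm (\<phi> s - \<pi> s) < \<epsilon> * sqrt d)"
      using st unfolding fmat_stable_def by metis
    \<comment> \<open>Half of \<open>\<epsilon>\<close>, because the bound at the identity must be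
      strict.\<close>
    define \<delta>' where "\<delta>' = min \<delta> (\<epsilon> / 2)"
    have \<delta>': "\<delta>' > 0" "\<delta>' \<le> \<delta>" "\<delta>' < \<epsilon>" using \<delta> \<epsilon> by (auto simp: \<delta>'_def)
    show "\<exists>\<delta>>0. \<exists>n\<ge>1. \<forall>d\<ge>1. \<forall>\<phi>. fmat_almost_rep G (word_ball G (insert \<one>\<^bsub>G\<^esub> S) n) \<delta> d \<phi> \<longrightarrow>
       (\<exists>\<pi>. urep G d \<pi> \<and> (\<forall>s\<in>insert \<one>\<^bsub>G\<^esub> S. norm (\<phi> s - \<pi> s) < \<epsilon> * sqrt d))"
    proof (intro exI[of _ \<delta>'] exI[of _ n] conjI allI impI \<delta>'(1) \<delta>(2))
      fix d :: nat and \<phi> assume d: "d \<ge> 1"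
        and \<phi>: "fmat_almost_rep G (word_ball G (insert \<one>\<^bsub>G\<^esub> S) n) \<delta>' d \<phi>"
      have le: "\<delta>' * sqrt d \<le> \<delta> * sqrt d" using \<delta>' by (intro mult_right_mono) auto
      have "fmat_almost_rep G (word_ball G S n) \<delta> d \<phi>"
        using \<phi> sub[of n] le unfolding fmat_almost_rep_def by (meson order_trans subsetD)
      then obtain \<pi> where \<pi>: "urep G d \<pi>" "\<And>s. s \<in> S \<Longrightarrow> norm (\<phi> s - \<pi> s) < \<epsilon> * sqrt d"
        using *[OF d] by blast
      let ?u = "\<phi> \<one>\<^bsub>G\<^esub>"
      have u: "unitary d ?u" and "norm (?u - ?u * ?u) \<le> \<delta>' * sqrt d"
        using \<phi> word_ball_one[of G "insert \<one>\<^bsub>G\<^esub> S" n] unfolding fmat_almost_rep_def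
        by (auto, metis one_closed r_one)
      moreover have "?u - idm d = adj ?u * (?u * ?u - ?u)"
        using unitaryD[OF u] by (simp add: right_diff_distrib mult_extend[OF unitaryD(1)[OF u]])
      ultimately have "norm (?u - idm d) \<le> \<delta>' * sqrt d"
        using unitary_norm_le(1)[OF unitary_adj[OF u], of "?u * ?u - ?u"] by (simp add: norm_minus_commute)
      also have "\<dots> < \<epsilon> * sqrt d" using \<delta>' d by (intro mult_strict_right_mono) auto
      finally have "norm (?u - \<pi> \<one>\<^bsub>G\<^esub>) < \<epsilon> * sqrt d" using urep_one[OF \<pi>(1)] by simp
      then show "\<exists>\<pi>. urep G d \<pi> \<and> (\<forall>s\<in>insert \<one>\<^bsub>G\<^esub> S. norm (\<phi> s - \<pi> s) < \<epsilon> * sqrt d)"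
        using \<pi> by blast
    qed
  qed
qed

section \<open>Extensions that split locally\<close>

text \<open>On a finite part of \<open>D\<close> the extension \<open>q\<close> looks like the product of \<open>G\<close> with the finite
  group \<open>P\<close>: the map \<open>t\<close> is a partially multiplicative section of \<open>q\<close> that commutes with \<open>P\<close>.\<close>

definition local_splitting ::
    "('d, 'n) monoid_scheme \<Rightarrow> ('g, 'm) monoid_scheme \<Rightarrow> ('d \<Rightarrow> 'g) \<Rightarrow> 'd set \<Rightarrow> 'g set
      \<Rightarrow> 'd set \<Rightarrow> ('d \<Rightarrow> 'd) \<Rightarrow> ('g \<Rightarrow> 'd) \<Rightarrow> bool"
  where "local_splitting D G q T B P r t \<longleftrightarrow>
    subgroup P D \<and> finite P \<and> r \<in> hom D D \<and> r ` carrier D \<subseteq> P \<and>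
    (\<forall>b\<in>B. t b \<in> carrier D) \<and>
    (\<forall>b\<in>B. \<forall>b'\<in>B. b \<otimes>\<^bsub>G\<^esub> b' \<in> B \<longrightarrow> t (b \<otimes>\<^bsub>G\<^esub> b') = t b \<otimes>\<^bsub>D\<^esub> t b') \<and>
    (\<forall>p\<in>P. \<forall>b\<in>B. p \<otimes>\<^bsub>D\<^esub> t b = t b \<otimes>\<^bsub>D\<^esub> p) \<and>
    (\<forall>x\<in>T. q x \<in> B \<and> x = r x \<otimes>\<^bsub>D\<^esub> t (q x))"

text \<open>The representation of \<open>D\<close> is \<open>\<rho> (r x) * \<sigma> (q x)\<close>.
  It is multiplicative because \<open>r\<close> and \<open>q\<close> are homomorphisms on all of
  \<open>D\<close> and the two factors commute, while \<open>t\<close> serves to extract from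
  \<open>\<phi>\<close> an almost representation on a part of \<open>G\<close>.\<close>

theorem stable_extension:
  fixes D :: "('d, 'n) monoid_scheme" and G :: "('g, 'm) monoid_scheme"
  assumes D: "group D" and G: "group G" and q: "q \<in> hom D G"
    and S: "finite S" "S \<subseteq> carrier G" and stab: "fmat_stable G S"
    and T: "finite T" "T \<subseteq> carrier D" "generate D T = carrier D" "q ` T \<subseteq> S"
    and split: "\<And>B. finite B \<Longrightarrow> B \<subseteq> carrier G \<Longrightarrow> S \<subseteq> B \<Longrightarrow> \<exists>P r t. local_splitting D G q T B P r t"
  shows "fmat_stable D T"
  unfolding fmat_stable_def
proof (intro allI impI)
  interpret D: group D by (rule D)
  interpret G: group G by (rule G)
  fix \<epsilon> :: real assume \<epsilon>: "\<epsilon> > 0"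
  define \<epsilon>1 where "\<epsilon>1 = \<epsilon> / 4"
  have \<epsilon>1: "\<epsilon>1 > 0" using \<epsilon> by (simp add: \<epsilon>1_def)
  obtain \<delta>1 n1 where \<delta>1: "\<delta>1 > 0" "n1 \<ge> 1" and
    stab1: "\<And>d \<phi>. d \<ge> 1 \<Longrightarrow> fmat_almost_rep G (word_ball G S n1) \<delta>1 d \<phi> \<Longrightarrow>
      \<exists>\<pi>. urep G d \<pi> \<and> (\<forall>s\<in>S. norm (\<phi> s - \<pi> s) < \<epsilon>1 * sqrt d)"
    using stab \<epsilon>1 unfolding fmat_stable_def by metis
  define B where "B = word_ball G S n1"
  have B: "finite B" "B \<subseteq> carrier G" "S \<subseteq> B"
    using finite_word_ball[OF S(1)] G.word_ball_carrier[OF S(2)] G.word_ball_gen[OF _ S(2) \<delta>1(2)]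
    by (auto simp: B_def)
  obtain P r t where "local_splitting D G q T B P r t" using split[OF B] by blast
  then have P: "subgroup P D" "finite P" and r: "r \<in> hom D D" "\<And>x. x \<in> carrier D \<Longrightarrow> r x \<in> P"
    and t: "\<And>b. b \<in> B \<Longrightarrow> t b \<in> carrier D"
    "\<And>b b'. b \<in> B \<Longrightarrow> b' \<in> B \<Longrightarrow> b \<otimes>\<^bsub>G\<^esub> b' \<in> B \<Longrightarrow> t (b \<otimes>\<^bsub>G\<^esub> b') = t b \<otimes>\<^bsub>D\<^esub> t b'"
    "\<And>p b. p \<in> P \<Longrightarrow> b \<in> B \<Longrightarrow> p \<otimes>\<^bsub>D\<^esub> t b = t b \<otimes>\<^bsub>D\<^esub> p"
    "\<And>x. x \<in> T \<Longrightarrow> q x \<in> B" "\<And>x. x \<in> T \<Longrightarrow> x = r x \<otimes>\<^bsub>D\<^esub> t (q x)"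
    unfolding local_splitting_def by blast+
  define H where "H = D\<lparr>carrier := P\<rparr>"
  have H: "group H" "carrier H = P" "\<And>x y. x \<otimes>\<^bsub>H\<^esub> y = x \<otimes>\<^bsub>D\<^esub> y"
    using D.subgroup_imp_group[OF P(1)] by (simp_all add: H_def)
  \<comment> \<open>The first term makes \<open>14 * \<epsilon>2\<close> at most a quarter of
    \<open>\<epsilon>\<close>; the second meets the smallness condition of
    \<open>commutant_stability\<close> for \<open>4 * \<epsilon>2\<close>, with 80 = 20 * 4 and
    \<open>+ 1\<close> keeping the denominator positive.\<close>
  define \<epsilon>2 where "\<epsilon>2 = min (\<epsilon> / 56) (\<epsilon>1 * \<delta>1 / (80 * (real (card B) + 1)))"
  have \<epsilon>2: "\<epsilon>2 > 0" using \<epsilon> \<epsilon>1 \<delta>1 by (simp add: \<epsilon>2_def)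
  obtain \<delta>2 where \<delta>2: "\<delta>2 > 0" and
    fstab: "\<And>d \<phi>. (\<forall>g\<in>P. unitary d (\<phi> g)) \<Longrightarrow>
      (\<forall>g\<in>P. \<forall>h\<in>P. norm (\<phi> (g \<otimes>\<^bsub>D\<^esub> h) - \<phi> g * \<phi> h) \<le> \<delta>2 * sqrt d) \<Longrightarrow>
      \<exists>\<pi>. urep H d \<pi> \<and> (\<forall>g\<in>P. norm (\<phi> g - \<pi> g) \<le> \<epsilon>2 * sqrt d)"
    using finite_group_stability[OF H(1) _ \<epsilon>2] P(2) unfolding H(2,3) by metis
  have PD: "P \<subseteq> carrier D" using P(1) by (rule subgroup.subset)
  \<comment> \<open>All arguments at which \<open>\<phi>\<close> is evaluated, including
    \<open>T\<close>; the radius \<open>n\<close> is chosen to cover them.\<close>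
  define W where "W = P \<union> t ` B \<union> (\<lambda>(p, b). p \<otimes>\<^bsub>D\<^esub> t b) ` (P \<times> B)"
  have W: "finite W" "W \<subseteq> carrier D"
    using P(2) B(1) PD t(1) by (auto simp: W_def)
  obtain n where n: "n \<ge> 1" "W \<subseteq> word_ball D T n"
    using D.finite_subset_word_ball[OF T(2,3) W] by blast
  define \<delta> where "\<delta> = min \<delta>2 \<epsilon>2"
  have \<delta>: "\<delta> > 0" "\<delta> \<le> \<delta>2" "\<delta> \<le> \<epsilon>2" using \<delta>2 \<epsilon>2 by (auto simp: \<delta>_def)
  show "\<exists>\<delta>>0. \<exists>n\<ge>1. \<forall>d\<ge>1. \<forall>\<phi>. fmat_almost_rep D (word_ball D T n) \<delta> d \<phi> \<longrightarrow>
       (\<exists>\<pi>. urep D d \<pi> \<and> (\<forall>s\<in>T. norm (\<phi> s - \<pi> s) < \<epsilon> * sqrt d))"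
  proof (intro exI[of _ \<delta>] exI[of _ n] conjI allI impI \<delta>(1) n(1))
    fix d :: nat and \<phi> assume d: "d \<ge> 1" and \<phi>: "fmat_almost_rep D (word_ball D T n) \<delta> d \<phi>"
    have uni: "unitary d (\<phi> x)" if "x \<in> W" for x
      using \<phi> that n(2) by (auto simp: fmat_almost_rep_def)
    have alm: "norm (\<phi> (x \<otimes>\<^bsub>D\<^esub> y) - \<phi> x * \<phi> y) \<le> \<delta> * sqrt d" if "x \<in> W" "y \<in> W" "x \<otimes>\<^bsub>D\<^esub> y \<in> W" for x y
      using \<phi> that n(2) unfolding fmat_almost_rep_def by blast
    have sqd: "sqrt (real d) > 0" using d by simp
    have mono: "a * sqrt d \<le> b * sqrt d" if "a \<le> b" for a b using that by (intro mult_right_mono) auto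
    have PW: "p \<in> W" if "p \<in> P" for p using that by (simp add: W_def)
    have tW: "t b \<in> W" if "b \<in> B" for b using that by (simp add: W_def)
    have ptW: "p \<otimes>\<^bsub>D\<^esub> t b \<in> W" if "p \<in> P" "b \<in> B" for p b using that by (auto simp: W_def)
    have Pm: "p \<otimes>\<^bsub>D\<^esub> p' \<in> P" if "p \<in> P" "p' \<in> P" for p p' using subgroup.m_closed[OF P(1) that] .
    have "\<exists>\<pi>. urep H d \<pi> \<and> (\<forall>g\<in>P. norm (\<phi> g - \<pi> g) \<le> \<epsilon>2 * sqrt d)"
    proof (rule fstab)
      show "\<forall>g\<in>P. unitary d (\<phi> g)" using uni PW by blast
      show "\<forall>g\<in>P. \<forall>h\<in>P. norm (\<phi> (g \<otimes>\<^bsub>D\<^esub> h) - \<phi> g * \<phi> h) \<le> \<delta>2 * sqrt d"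
        using alm PW Pm mono[OF \<delta>(2)] by (meson order_trans)
    qed
    then obtain \<rho> where \<rho>: "urep H d \<rho>" "\<And>p. p \<in> P \<Longrightarrow> norm (\<phi> p - \<rho> p) \<le> \<epsilon>2 * sqrt d" by blast
    interpret R: finite_urep H d \<rho>
      by (intro finite_urep.intro finite_urep_axioms.intro) (use H P(2) \<rho>(1) in auto)
    have \<rho>u: "unitary d (\<rho> p)" if "p \<in> P" for p using R.uni that H(2) by simp
    define X where "X b = \<phi> (t b)" for b
    have Xu: "unitary d (X b)" if "b \<in> B" for b using uni tW that by (simp add: X_def)
    \<comment> \<open>4 = 2 + 2: \<open>p\<close> and \<open>t b\<close> commute in
      \<open>D\<close>, which costs two multiplicativity errors, and exchanging
      \<open>\<phi> p\<close> for \<open>\<rho> p\<close> costs two more.\<close>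
    have comm: "norm (\<rho> p * X b * adj (\<rho> p) - X b) \<le> (4 * \<epsilon>2) * sqrt d" if b: "b \<in> B" and p: "p \<in> P" for b p
    proof -
      have eq: "\<rho> p * X b * adj (\<rho> p) - X b = (\<rho> p * X b - X b * \<rho> p) * adj (\<rho> p)"
        using unitaryD[OF \<rho>u[OF p]] unitaryD[OF Xu[OF b]] by (simp add: left_diff_distrib mult.assoc)
      have "norm (\<rho> p * X b * adj (\<rho> p) - X b) \<le> norm (\<rho> p * X b - X b * \<rho> p)"
        unfolding eq by (rule unitary_norm_le(2)[OF unitary_adj[OF \<rho>u[OF p]]])
      also have "\<rho> p * X b - X b * \<rho> p = (\<phi> (p \<otimes>\<^bsub>D\<^esub> t b) - X b * \<phi> p) - (\<phi> (p \<otimes>\<^bsub>D\<^esub> t b) - \<phi> p * X b)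
          + (X b * (\<phi> p - \<rho> p) - (\<phi> p - \<rho> p) * X b)"
        by (simp add: algebra_simps)
      also have "norm \<dots> \<le> norm (\<phi> (p \<otimes>\<^bsub>D\<^esub> t b) - X b * \<phi> p) + norm (\<phi> (p \<otimes>\<^bsub>D\<^esub> t b) - \<phi> p * X b)
          + (norm (X b * (\<phi> p - \<rho> p)) + norm ((\<phi> p - \<rho> p) * X b))"
        by (meson add_mono norm_triangle_ineq norm_triangle_ineq4 order_trans)
      also have "\<dots> \<le> \<delta> * sqrt d + \<delta> * sqrt d + (\<epsilon>2 * sqrt d + \<epsilon>2 * sqrt d)"
      proof (intro add_mono)
        show "norm (\<phi> (p \<otimes>\<^bsub>D\<^esub> t b) - X b * \<phi> p) \<le> \<delta> * sqrt d"
          unfolding X_def t(3)[OF p b] by (rule alm) (use PW tW ptW p b t(3)[OF p b, symmetric] in auto)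
        show "norm (\<phi> (p \<otimes>\<^bsub>D\<^esub> t b) - \<phi> p * X b) \<le> \<delta> * sqrt d"
          unfolding X_def by (rule alm) (use PW tW ptW p b in auto)
        show "norm (X b * (\<phi> p - \<rho> p)) \<le> \<epsilon>2 * sqrt d"
          by (rule order_trans[OF unitary_norm_le(1)[OF Xu[OF b]] \<rho>(2)[OF p]])
        show "norm ((\<phi> p - \<rho> p) * X b) \<le> \<epsilon>2 * sqrt d"
          by (rule order_trans[OF unitary_norm_le(2)[OF Xu[OF b]] \<rho>(2)[OF p]])
      qed
      also have "\<dots> \<le> (4 * \<epsilon>2) * sqrt d" using mono[OF \<delta>(3)] by simp
      finally show ?thesis .
    qed
    have "\<exists>\<sigma>. urep G d \<sigma> \<and> (\<forall>g\<in>carrier G. \<forall>p\<in>carrier H. \<sigma> g * \<rho> p = \<rho> p * \<sigma> g) \<and>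
      (\<forall>s\<in>S. norm (X s - \<sigma> s) \<le> (3 * (4 * \<epsilon>2) + 2 * \<epsilon>1) * sqrt d)"
    proof (rule R.commutant_stability[of G B \<delta>1 S \<epsilon>1 "4 * \<epsilon>2" X])
      show "\<exists>\<sigma>. urep G k \<sigma> \<and> (\<forall>s\<in>S. norm (u s - \<sigma> s) < \<epsilon>1 * sqrt k)"
        if "k \<ge> 1" "fmat_almost_rep G B \<delta>1 k u" for k u
        using stab1 that by (simp add: B_def)
      show "fmat_almost_rep G B (4 * \<epsilon>2) d X"
        unfolding fmat_almost_rep_def
      proof (intro conjI ballI impI Xu)
        fix b b' assume b: "b \<in> B" "b' \<in> B" "b \<otimes>\<^bsub>G\<^esub> b' \<in> B"
        have "norm (X (b \<otimes>\<^bsub>G\<^esub> b') - X b * X b') \<le> \<delta> * sqrt d"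
          unfolding X_def t(2)[OF b] by (rule alm) (use tW b t(2)[OF b, symmetric] in auto)
        also have "\<dots> \<le> 4 * \<epsilon>2 * sqrt d" using \<delta>(3) \<epsilon>2 by (intro mono) simp
        finally show "norm (X (b \<otimes>\<^bsub>G\<^esub> b') - X b * X b') \<le> 4 * \<epsilon>2 * sqrt d" .
      qed
      show "20 * real (card B) * (4 * \<epsilon>2) \<le> \<epsilon>1 * \<delta>1"
      proof -
        have "\<epsilon>2 \<le> \<epsilon>1 * \<delta>1 / (80 * (real (card B) + 1))" by (simp add: \<epsilon>2_def)
        then have "\<epsilon>2 * (80 * (real (card B) + 1)) \<le> \<epsilon>1 * \<delta>1" by (simp add: pos_le_divide_eq)
        moreover have "\<epsilon>2 * (80 * (real (card B) + 1)) = 20 * real (card B) * (4 * \<epsilon>2) + 80 * \<epsilon>2"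
          by (simp add: algebra_simps)
        ultimately show ?thesis using \<epsilon>2 by linarith
      qed
      show "norm (\<rho> p * X b * adj (\<rho> p) - X b) \<le> 4 * \<epsilon>2 * sqrt d" if "b \<in> B" "p \<in> carrier H" for b p
        using comm that H(2) by simp
    qed (use B S(2) \<delta>1(1) \<epsilon>1 \<epsilon>2 in auto)
    then obtain \<sigma> where \<sigma>: "urep G d \<sigma>" "\<And>g p. g \<in> carrier G \<Longrightarrow> p \<in> P \<Longrightarrow> \<sigma> g * \<rho> p = \<rho> p * \<sigma> g"
      "\<And>s. s \<in> S \<Longrightarrow> norm (X s - \<sigma> s) \<le> (12 * \<epsilon>2 + 2 * \<epsilon>1) * sqrt d"
      using H(2) by auto
    have qc: "q x \<in> carrier G" if "x \<in> carrier D" for x using q that by (auto simp: hom_def)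
    have \<sigma>u: "unitary d (\<sigma> (q x))" if "x \<in> carrier D" for x by (rule urep_unitary[OF \<sigma>(1) qc[OF that]])
    define \<pi> where "\<pi> x = \<rho> (r x) * \<sigma> (q x)" for x
    have "urep D d \<pi>"
      unfolding urep_def
    proof (intro conjI ballI)
      fix x assume x: "x \<in> carrier D"
      show "unitary d (\<pi> x)" unfolding \<pi>_def by (rule unitary_mult[OF \<rho>u[OF r(2)[OF x]] \<sigma>u[OF x]])
      fix y assume y: "y \<in> carrier D"
      have 1: "\<rho> (r (x \<otimes>\<^bsub>D\<^esub> y)) = \<rho> (r x) * \<rho> (r y)"
        using r(1) R.rep_mult r(2)[OF x] r(2)[OF y] x y by (simp add: hom_def H)
      have 2: "\<sigma> (q (x \<otimes>\<^bsub>D\<^esub> y)) = \<sigma> (q x) * \<sigma> (q y)"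
        using q \<sigma>(1) qc[OF x] qc[OF y] x y by (simp add: hom_def urep_def)
      have "\<pi> x * \<pi> y = \<rho> (r x) * (\<sigma> (q x) * \<rho> (r y)) * \<sigma> (q y)" by (simp add: \<pi>_def mult.assoc)
      also have "\<dots> = \<pi> (x \<otimes>\<^bsub>D\<^esub> y)"
        unfolding \<sigma>(2)[OF qc[OF x] r(2)[OF y]] by (simp add: \<pi>_def 1 2 mult.assoc)
      finally show "\<pi> (x \<otimes>\<^bsub>D\<^esub> y) = \<pi> x * \<pi> y" by simp
    qed
    moreover have "norm (\<phi> x - \<pi> x) < \<epsilon> * sqrt d" if x: "x \<in> T" for x
    proof -
      have xD: "x \<in> carrier D" using x T(2) by blast
      have rP: "r x \<in> P" by (rule r(2)[OF xD])
      have qB: "q x \<in> B" by (rule t(4)[OF x])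
      let ?a = "\<phi> (r x)" and ?b = "X (q x)"
      have "\<phi> x - \<pi> x = (\<phi> x - ?a * ?b) + ((?a - \<rho> (r x)) * ?b + \<rho> (r x) * (?b - \<sigma> (q x)))"
        by (simp add: \<pi>_def algebra_simps)
      also have "norm \<dots> \<le> norm (\<phi> x - ?a * ?b) + (norm ((?a - \<rho> (r x)) * ?b) + norm (\<rho> (r x) * (?b - \<sigma> (q x))))"
        by (meson add_left_mono norm_triangle_ineq order_trans)
      also have "\<dots> \<le> \<epsilon>2 * sqrt d + (\<epsilon>2 * sqrt d + (12 * \<epsilon>2 + 2 * \<epsilon>1) * sqrt d)"
      proof (intro add_mono)
        have "norm (\<phi> (r x \<otimes>\<^bsub>D\<^esub> t (q x)) - ?a * ?b) \<le> \<delta> * sqrt d"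
          unfolding X_def by (rule alm) (use PW tW ptW rP qB in auto)
        then show "norm (\<phi> x - ?a * ?b) \<le> \<epsilon>2 * sqrt d"
          using mono[OF \<delta>(3)] t(5)[OF x] by simp
        show "norm ((?a - \<rho> (r x)) * ?b) \<le> \<epsilon>2 * sqrt d"
          by (rule order_trans[OF unitary_norm_le(2)[OF Xu[OF qB]] \<rho>(2)[OF rP]])
        have "q x \<in> S" using x T(4) by blast
        then show "norm (\<rho> (r x) * (?b - \<sigma> (q x))) \<le> (12 * \<epsilon>2 + 2 * \<epsilon>1) * sqrt d"
          by (rule order_trans[OF unitary_norm_le(1)[OF \<rho>u[OF rP]] \<sigma>(3)])
      qed
      \<comment> \<open>14 = 1 + 1 + 12: the product, the representation of \<open>P\<close>, and 3
        * 4 from \<open>commutant_stability\<close>.\<close>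
      also have "\<dots> = (14 * \<epsilon>2 + 2 * \<epsilon>1) * sqrt d" by (simp add: algebra_simps)
      also have "\<dots> < \<epsilon> * sqrt d"
      proof (rule mult_strict_right_mono[OF _ sqd])
        have "\<epsilon>2 \<le> \<epsilon> / 56" unfolding \<epsilon>2_def by (rule min.cobounded1)
        then show "14 * \<epsilon>2 + 2 * \<epsilon>1 < \<epsilon>" using \<epsilon> by (simp add: \<epsilon>1_def)
      qed
      finally show ?thesis .
    qed
    ultimately show "\<exists>\<pi>. urep D d \<pi> \<and> (\<forall>s\<in>T. norm (\<phi> s - \<pi> s) < \<epsilon> * sqrt d)" by blast
  qed
qed

section \<open>The diagonal product as an extension\<close>

locale diagonal =
  fixes G :: "('a, 'm) monoid_scheme" and S :: "'a set"
    and H :: "nat \<Rightarrow> ('b, 'k) monoid_scheme" and \<theta> :: "nat \<Rightarrow> 'a \<Rightarrow> 'b"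
  assumes G: "group G" and gen: "finite_generating_set G S"
    and lef: "LEF_approximation G H \<theta>" and ess: "essential_by_simple_groups G S H \<theta>"
begin

sublocale G: group G by (rule G)

abbreviation "D \<equiv> diagonal_product S H \<theta>"

lemma group_H: "group (H n)" and finite_H: "finite (carrier (H n))"
  and \<theta>_closed: "g \<in> carrier G \<Longrightarrow> \<theta> n g \<in> carrier (H n)"
  using lef unfolding LEF_approximation_def by auto

lemma \<theta>_mult: "g \<in> carrier G \<Longrightarrow> h \<in> carrier G \<Longrightarrow>
    \<forall>\<^sub>F n in sequentially. \<theta> n (g \<otimes>\<^bsub>G\<^esub> h) = \<theta> n g \<otimes>\<^bsub>H n\<^esub> \<theta> n h"
  and \<theta>_faithful: "g \<in> carrier G \<Longrightarrow> g \<noteq> \<one>\<^bsub>G\<^esub> \<Longrightarrow> \<forall>\<^sub>F n in sequentially. \<theta> n g \<noteq> \<one>\<^bsub>H n\<^esub>"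
  using lef unfolding LEF_approximation_def by auto

lemma simple_H: "simple_group (H n)" and H_not_iso: "m \<noteq> n \<Longrightarrow> \<not> H m \<cong> H n"
  and not_extends: "f \<in> hom G (H n) \<Longrightarrow> \<exists>s\<in>S. f s \<noteq> \<theta> n s"
  and \<theta>_generates: "generate (H n) (\<theta> n ` S) = carrier (H n)"
  using ess unfolding essential_by_simple_groups_def by blast+

lemma S: "finite S" "S \<subseteq> carrier G" "generate G S = carrier G"
  using gen by (auto simp: finite_generating_set_def)

lemma H_closed [simp]: "\<one>\<^bsub>H n\<^esub> \<in> carrier (H n)"
  "a \<in> carrier (H n) \<Longrightarrow> b \<in> carrier (H n) \<Longrightarrow> a \<otimes>\<^bsub>H n\<^esub> b \<in> carrier (H n)"
  "a \<in> carrier (H n) \<Longrightarrow> inv\<^bsub>H n\<^esub> a \<in> carrier (H n)"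
  using group_H[of n] by (simp_all add: group.is_monoid monoid.m_closed)

lemma H_one [simp]: "a \<in> carrier (H n) \<Longrightarrow> \<one>\<^bsub>H n\<^esub> \<otimes>\<^bsub>H n\<^esub> a = a"
  "a \<in> carrier (H n) \<Longrightarrow> a \<otimes>\<^bsub>H n\<^esub> \<one>\<^bsub>H n\<^esub> = a"
  using group_H[of n] by (simp_all add: group.is_monoid)

abbreviation "\<Pi>H \<equiv> product_group UNIV H"

lemma group_Pi: "group \<Pi>H"
  by (simp add: group_H)

lemma carrier_Pi: "x \<in> carrier \<Pi>H \<longleftrightarrow> (\<forall>n. x n \<in> carrier (H n))"
  by (auto simp: PiE_iff)

lemma gens_Pi: "(\<lambda>s n. \<theta> n s) ` S \<subseteq> carrier \<Pi>H"
  using \<theta>_closed S(2) by (auto simp: carrier_Pi)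

lemma D_group: "group D"
  unfolding diagonal_product_def by (rule group.group_subgroup_generated[OF group_Pi])

sublocale D: group D by (rule D_group)

lemma D_carrier: "carrier D = generate \<Pi>H ((\<lambda>s n. \<theta> n s) ` S)"
  using gens_Pi by (simp add: diagonal_product_def carrier_subgroup_generated Int_absorb1)

lemma D_mult: "x \<otimes>\<^bsub>D\<^esub> y = (\<lambda>n. x n \<otimes>\<^bsub>H n\<^esub> y n)"
  by (simp add: diagonal_product_def restrict_UNIV)

lemma D_one: "\<one>\<^bsub>D\<^esub> = (\<lambda>n. \<one>\<^bsub>H n\<^esub>)"
  by (simp add: diagonal_product_def restrict_UNIV)

lemma D_Pi: "x \<in> carrier D \<Longrightarrow> x n \<in> carrier (H n)"
  using group.generate_in_carrier[OF group_Pi gens_Pi, of x] by (simp only: D_carrier carrier_Pi)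

lemma Pi_inv: "x \<in> carrier \<Pi>H \<Longrightarrow> inv\<^bsub>\<Pi>H\<^esub> x = (\<lambda>n. inv\<^bsub>H n\<^esub> x n)"
  using group_H by (subst inv_product_group) auto

lemma D_inv: "x \<in> carrier D \<Longrightarrow> inv\<^bsub>D\<^esub> x = (\<lambda>n. inv\<^bsub>H n\<^esub> x n)"
proof -
  assume x: "x \<in> carrier D"
  then have "x \<in> carrier \<Pi>H" using D_Pi carrier_Pi by blast
  then show ?thesis
    using x Pi_inv group.inv_subgroup_generated[OF group_Pi, of x "(\<lambda>s n. \<theta> n s) ` S"]
    by (simp add: diagonal_product_def)
qed

section \<open>The quotient map onto the LEF group\<close>

definition gam :: "'a \<Rightarrow> nat \<Rightarrow> 'b" where "gam s = (\<lambda>n. \<theta> n s)"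

lemma gam_D: "s \<in> S \<Longrightarrow> gam s \<in> carrier D"
  unfolding D_carrier gam_def by (rule generate.incl) blast

text \<open>Every element of \<open>D\<close> is eventually given by \<open>\<theta>\<close>, which defines the quotient map onto \<open>G\<close>.\<close>

definition limit_of :: "(nat \<Rightarrow> 'b) \<Rightarrow> 'a \<Rightarrow> bool"
  where "limit_of x g \<longleftrightarrow> g \<in> carrier G \<and> (\<forall>\<^sub>F n in sequentially. x n = \<theta> n g)"

lemma limit_of_mult:
  assumes "limit_of x g" "limit_of y h"
  shows "limit_of (\<lambda>n. x n \<otimes>\<^bsub>H n\<^esub> y n) (g \<otimes>\<^bsub>G\<^esub> h)"
proof -
  have gh: "g \<in> carrier G" "h \<in> carrier G" using assms by (auto simp: limit_of_def)
  have "\<forall>\<^sub>F n in sequentially. x n \<otimes>\<^bsub>H n\<^esub> y n = \<theta> n (g \<otimes>\<^bsub>G\<^esub> h)"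
    using assms[unfolded limit_of_def, THEN conjunct2] \<theta>_mult[OF gh] by eventually_elim simp
  then show ?thesis using gh by (simp add: limit_of_def)
qed

text \<open>Multiplicativity at the identity makes \<open>\<theta> n \<one>\<close> idempotent for
  large \<open>n\<close>, hence trivial.\<close>

lemma limit_of_one: "limit_of (\<lambda>n. \<one>\<^bsub>H n\<^esub>) \<one>\<^bsub>G\<^esub>"
proof -
  have "\<theta> n \<one>\<^bsub>G\<^esub> = \<one>\<^bsub>H n\<^esub>" if "\<theta> n (\<one>\<^bsub>G\<^esub> \<otimes>\<^bsub>G\<^esub> \<one>\<^bsub>G\<^esub>) = \<theta> n \<one>\<^bsub>G\<^esub> \<otimes>\<^bsub>H n\<^esub> \<theta> n \<one>\<^bsub>G\<^esub>" for n
    using that \<theta>_closed[OF G.one_closed, of n] group.l_cancel_one'[OF group_H] by auto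
  then show ?thesis
    using \<theta>_mult[OF G.one_closed G.one_closed] by (auto simp: limit_of_def elim: eventually_mono)
qed

text \<open>For distinct \<open>g\<close> and \<open>h\<close> the quotient \<open>?k\<close> has
  nontrivial image for large \<open>n\<close>, while multiplicativity and the common values make
  that image trivial.\<close>

lemma limit_of_unique:
  assumes "limit_of x g" "limit_of x h"
  shows "g = h"
proof (rule ccontr)
  assume ne: "g \<noteq> h"
  have gh: "g \<in> carrier G" "h \<in> carrier G" using assms by (auto simp: limit_of_def)
  let ?k = "inv\<^bsub>G\<^esub> g \<otimes>\<^bsub>G\<^esub> h"
  have k: "?k \<in> carrier G" "g \<otimes>\<^bsub>G\<^esub> ?k = h" using gh by (simp_all add: G.m_assoc[symmetric])
  have "?k \<noteq> \<one>\<^bsub>G\<^esub>" using ne k gh by (metis G.r_one)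
  then have "\<forall>\<^sub>F n in sequentially. \<theta> n ?k \<noteq> \<one>\<^bsub>H n\<^esub>" by (rule \<theta>_faithful[OF k(1)])
  then have "\<forall>\<^sub>F n in sequentially. False"
    using \<theta>_mult[OF gh(1) k(1)] assms[unfolded limit_of_def, THEN conjunct2]
  proof eventually_elim
    case (elim n)
    then have "\<theta> n g = \<theta> n g \<otimes>\<^bsub>H n\<^esub> \<theta> n ?k" using k(2) by simp
    then show False
      using elim(1) \<theta>_closed[OF gh(1), of n] \<theta>_closed[OF k(1), of n] group.l_cancel_one'[OF group_H] by metis
  qed
  then show False by simp
qed

lemma limit_of_inv:
  assumes "limit_of x g" "\<And>n. x n \<in> carrier (H n)"
  shows "limit_of (\<lambda>n. inv\<^bsub>H n\<^esub> x n) (inv\<^bsub>G\<^esub> g)"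
proof -
  have g: "g \<in> carrier G" using assms by (auto simp: limit_of_def)
  have "\<forall>\<^sub>F n in sequentially. inv\<^bsub>H n\<^esub> x n = \<theta> n (inv\<^bsub>G\<^esub> g)"
    using assms(1)[unfolded limit_of_def, THEN conjunct2] \<theta>_mult[OF G.inv_closed[OF g] g]
      limit_of_one[unfolded limit_of_def, THEN conjunct2]
  proof eventually_elim
    case (elim n)
    then have "\<theta> n (inv\<^bsub>G\<^esub> g) \<otimes>\<^bsub>H n\<^esub> x n = \<one>\<^bsub>H n\<^esub>" using g by simp
    then show ?case
      using group.inv_equality[OF group_H] \<theta>_closed[of "inv\<^bsub>G\<^esub> g" n] g assms(2)[of n] by simp
  qed
  then show ?thesis using g by (simp add: limit_of_def)
qed

lemma limit_exists: "x \<in> carrier D \<Longrightarrow> \<exists>g. limit_of x g"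
  unfolding D_carrier
proof (induction x rule: generate.induct)
  case one
  then show ?case using limit_of_one by (auto simp: restrict_UNIV)
next
  case (incl x)
  then show ?case using S(2) by (auto simp: limit_of_def)
next
  case (inv x)
  then obtain s where s: "s \<in> S" "x = (\<lambda>n. \<theta> n s)" by blast
  have "limit_of x s" using s S(2) by (auto simp: limit_of_def)
  moreover have x: "x n \<in> carrier (H n)" for n using s S(2) \<theta>_closed by auto
  ultimately show ?case using limit_of_inv Pi_inv[of x] carrier_Pi[of x] by metis
next
  case (eng x y)
  then show ?case using limit_of_mult by (fastforce simp: restrict_UNIV)
qed

definition q :: "(nat \<Rightarrow> 'b) \<Rightarrow> 'a" where "q x = (THE g. limit_of x g)"

lemma q_limit: "x \<in> carrier D \<Longrightarrow> limit_of x (q x)"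
  unfolding q_def using limit_exists limit_of_unique by (metis theI)

lemma q_eqI: "limit_of x g \<Longrightarrow> q x = g"
  unfolding q_def using limit_of_unique by blast

lemma q_closed: "x \<in> carrier D \<Longrightarrow> q x \<in> carrier G"
  using q_limit by (auto simp: limit_of_def)

lemma q_eventually: "x \<in> carrier D \<Longrightarrow> \<forall>\<^sub>F n in sequentially. x n = \<theta> n (q x)"
  using q_limit by (auto simp: limit_of_def)

lemma q_hom: "q \<in> hom D G"
proof (rule homI)
  fix x y assume xy: "x \<in> carrier D" "y \<in> carrier D"
  show "q (x \<otimes>\<^bsub>D\<^esub> y) = q x \<otimes>\<^bsub>G\<^esub> q y"
    unfolding D_mult by (rule q_eqI) (rule limit_of_mult[OF q_limit[OF xy(1)] q_limit[OF xy(2)]])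
qed (rule q_closed)

sublocale q: group_hom D G q
  by unfold_locales (rule q_hom)

lemma q_gam: "s \<in> S \<Longrightarrow> q (gam s) = s"
  by (rule q_eqI) (use S(2) in \<open>auto simp: limit_of_def gam_def\<close>)

lemma q_surj: "q ` carrier D = carrier G"
proof
  show "q ` carrier D \<subseteq> carrier G" using q_closed by blast
  have "subgroup (q ` carrier D) G" by (rule q.img_is_subgroup)
  moreover have "S \<subseteq> q ` carrier D" using q_gam gam_D by (metis image_eqI subsetI)
  ultimately show "carrier G \<subseteq> q ` carrier D" using G.generate_subgroup_incl S(3) by metis
qed

text \<open>A set-theoretic section of \<open>q\<close>, multiplicative up to the kernel, that is,
  in all large coordinates.\<close>

definition lift :: "'a \<Rightarrow> nat \<Rightarrow> 'b" where "lift g = (SOME x. x \<in> carrier D \<and> q x = g)"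

lemma lift: "g \<in> carrier G \<Longrightarrow> lift g \<in> carrier D" "g \<in> carrier G \<Longrightarrow> q (lift g) = g"
proof -
  assume "g \<in> carrier G"
  then have "\<exists>x. x \<in> carrier D \<and> q x = g" using q_surj by (metis imageE)
  from someI_ex[OF this] show "lift g \<in> carrier D" "q (lift g) = g" by (simp_all add: lift_def)
qed

lemma q_ker: "x \<in> carrier D \<Longrightarrow> q x = \<one>\<^bsub>G\<^esub> \<longleftrightarrow> (\<forall>\<^sub>F n in sequentially. x n = \<one>\<^bsub>H n\<^esub>)"
proof
  assume x: "x \<in> carrier D" and "q x = \<one>\<^bsub>G\<^esub>"
  then have "\<forall>\<^sub>F n in sequentially. x n = \<theta> n \<one>\<^bsub>G\<^esub>" using q_eventually by metis
  then show "\<forall>\<^sub>F n in sequentially. x n = \<one>\<^bsub>H n\<^esub>"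
    using limit_of_one[unfolded limit_of_def, THEN conjunct2] by eventually_elim simp
next
  assume "\<forall>\<^sub>F n in sequentially. x n = \<one>\<^bsub>H n\<^esub>"
  then have "\<forall>\<^sub>F n in sequentially. x n = \<theta> n \<one>\<^bsub>G\<^esub>"
    using limit_of_one[unfolded limit_of_def, THEN conjunct2] by eventually_elim simp
  then show "q x = \<one>\<^bsub>G\<^esub>" by (intro q_eqI) (simp add: limit_of_def)
qed

lemma coordinate_surj: "a \<in> carrier (H n) \<Longrightarrow> \<exists>x\<in>carrier D. x n = a"
  unfolding \<theta>_generates[symmetric]
proof (induction a rule: generate.induct)
  case one
  then show ?case by (metis D.one_closed D_one)
next
  case (incl a)
  then show ?case using gam_D by (auto simp: gam_def)
next
  case (inv a)
  then obtain s where s: "s \<in> S" "a = \<theta> n s" by blast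
  have "inv\<^bsub>D\<^esub> (gam s) \<in> carrier D" by (rule D.inv_closed[OF gam_D[OF s(1)]])
  moreover have "(inv\<^bsub>D\<^esub> (gam s)) n = inv\<^bsub>H n\<^esub> a"
    using s(2) by (simp only: D_inv[OF gam_D[OF s(1)]]) (simp add: gam_def)
  ultimately show ?case by blast
next
  case (eng a b)
  then obtain x y where "x \<in> carrier D" "x n = a" "y \<in> carrier D" "y n = b" by blast
  then have "x \<otimes>\<^bsub>D\<^esub> y \<in> carrier D" "(x \<otimes>\<^bsub>D\<^esub> y) n = a \<otimes>\<^bsub>H n\<^esub> b" by (simp_all add: D_mult[symmetric], simp add: D_mult)
  then show ?case by blast
qed

text \<open>If the kernel of \<open>q\<close> were trivial in the coordinate \<open>n\<close>, this coordinate would factor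
  through \<open>G\<close>.\<close>

lemma kernel_nontrivial: "\<exists>x\<in>carrier D. q x = \<one>\<^bsub>G\<^esub> \<and> x n \<noteq> \<one>\<^bsub>H n\<^esub>"
proof (rule ccontr)
  assume "\<not> ?thesis"
  then have triv: "x n = \<one>\<^bsub>H n\<^esub>" if "x \<in> carrier D" "q x = \<one>\<^bsub>G\<^esub>" for x using that by blast
  interpret Hn: group "H n" by (rule group_H)
  \<comment> \<open>Elements with the same image under \<open>q\<close> differ by a kernel element
    and so agree in coordinate \<open>n\<close>.\<close>
  have wd: "x n = y n" if xy: "x \<in> carrier D" "y \<in> carrier D" "q x = q y" for x y
  proof -
    have "q (inv\<^bsub>D\<^esub> x \<otimes>\<^bsub>D\<^esub> y) = \<one>\<^bsub>G\<^esub>" using xy q_closed by simp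
    then have "(inv\<^bsub>D\<^esub> x \<otimes>\<^bsub>D\<^esub> y) n = \<one>\<^bsub>H n\<^esub>" using xy triv by simp
    then have "inv\<^bsub>H n\<^esub> x n \<otimes>\<^bsub>H n\<^esub> y n = \<one>\<^bsub>H n\<^esub>" using xy by (simp add: D_mult D_inv)
    then show ?thesis using D_Pi xy by (metis Hn.inv_equality Hn.inv_inv Hn.inv_closed)
  qed
  \<comment> \<open>Coordinate \<open>n\<close> of a lift is a homomorphism on \<open>G\<close> that
    extends \<open>\<theta> n\<close> on \<open>S\<close>, which essentiality forbids.\<close>
  define f where "f g = lift g n" for g
  have "f \<in> hom G (H n)"
  proof (rule homI)
    fix g h assume gh: "g \<in> carrier G" "h \<in> carrier G"
    show "f g \<in> carrier (H n)" unfolding f_def by (rule D_Pi[OF lift(1)[OF gh(1)]])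
    have "lift (g \<otimes>\<^bsub>G\<^esub> h) n = (lift g \<otimes>\<^bsub>D\<^esub> lift h) n"
      by (rule wd) (use gh lift in auto)
    then show "f (g \<otimes>\<^bsub>G\<^esub> h) = f g \<otimes>\<^bsub>H n\<^esub> f h" by (simp add: f_def D_mult)
  qed
  then obtain s where s: "s \<in> S" "f s \<noteq> \<theta> n s" using not_extends by blast
  have "lift s n = gam s n" by (rule wd) (use s lift gam_D q_gam S(2) in auto)
  then show False using s(2) by (simp add: f_def gam_def)
qed

section \<open>Normal subgroups of the diagonal product\<close>

text \<open>Normality spelled out elementwise, because the conditions are checked coordinate by
  coordinate.\<close>

definition normal_in_D :: "(nat \<Rightarrow> 'b) set \<Rightarrow> bool"
  where "normal_in_D K \<longleftrightarrow> \<one>\<^bsub>D\<^esub> \<in> K \<and> K \<subseteq> carrier D \<and> (\<forall>x\<in>K. \<forall>y\<in>K. x \<otimes>\<^bsub>D\<^esub> y \<in> K) \<and>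
    (\<forall>x\<in>K. inv\<^bsub>D\<^esub> x \<in> K) \<and> (\<forall>x\<in>K. \<forall>d\<in>carrier D. d \<otimes>\<^bsub>D\<^esub> x \<otimes>\<^bsub>D\<^esub> inv\<^bsub>D\<^esub> d \<in> K)"

text \<open>Each coordinate is surjective on \<open>D\<close>, so images of normal subgroups are
  normal in a simple group.\<close>

lemma coordinate_image:
  assumes "normal_in_D K"
  shows "(\<lambda>x. x n) ` K = carrier (H n) \<or> (\<lambda>x. x n) ` K = {\<one>\<^bsub>H n\<^esub>}"
proof -
  have K: "\<one>\<^bsub>D\<^esub> \<in> K" "K \<subseteq> carrier D" "\<And>x y. x \<in> K \<Longrightarrow> y \<in> K \<Longrightarrow> x \<otimes>\<^bsub>D\<^esub> y \<in> K"
    "\<And>x. x \<in> K \<Longrightarrow> inv\<^bsub>D\<^esub> x \<in> K" "\<And>x d. x \<in> K \<Longrightarrow> d \<in> carrier D \<Longrightarrow> d \<otimes>\<^bsub>D\<^esub> x \<otimes>\<^bsub>D\<^esub> inv\<^bsub>D\<^esub> d \<in> K"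
    using assms by (simp_all add: normal_in_D_def)
  interpret Hn: group "H n" by (rule group_H)
  have "(\<lambda>x. x n) ` K \<lhd> H n"
    unfolding Hn.normal_inv_iff
  proof (intro conjI ballI Hn.subgroupI)
    show "(\<lambda>x. x n) ` K \<subseteq> carrier (H n)" using K(2) D_Pi by blast
    show "(\<lambda>x. x n) ` K \<noteq> {}" using K(1) by blast
    fix a assume "a \<in> (\<lambda>x. x n) ` K"
    then obtain x where x: "x \<in> K" "a = x n" by blast
    have "(inv\<^bsub>D\<^esub> x) n = inv\<^bsub>H n\<^esub> a" using x K(2) D_inv[of x] by auto
    then show "inv\<^bsub>H n\<^esub> a \<in> (\<lambda>x. x n) ` K" using K(4)[OF x(1)] by (metis image_eqI)
    show "a \<otimes>\<^bsub>H n\<^esub> b \<in> (\<lambda>x. x n) ` K" if b: "b \<in> (\<lambda>x. x n) ` K" for b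
    proof -
      obtain y where y: "y \<in> K" "b = y n" using b by blast
      have "(x \<otimes>\<^bsub>D\<^esub> y) n = a \<otimes>\<^bsub>H n\<^esub> b" using x y by (simp add: D_mult)
      then show ?thesis using K(3)[OF x(1) y(1)] by (metis image_eqI)
    qed
    fix g assume "g \<in> carrier (H n)"
    then obtain d where d: "d \<in> carrier D" "d n = g" using coordinate_surj by blast
    have "(d \<otimes>\<^bsub>D\<^esub> x \<otimes>\<^bsub>D\<^esub> inv\<^bsub>D\<^esub> d) n = g \<otimes>\<^bsub>H n\<^esub> a \<otimes>\<^bsub>H n\<^esub> inv\<^bsub>H n\<^esub> g"
      using x d D_inv[OF d(1)] by (simp add: D_mult)
    then show "g \<otimes>\<^bsub>H n\<^esub> a \<otimes>\<^bsub>H n\<^esub> inv\<^bsub>H n\<^esub> g \<in> (\<lambda>x. x n) ` K"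
      using K(5)[OF x(1) d(1)] by (metis image_eqI)
  qed
  then show ?thesis using simple_group.no_real_normal_subgroup[OF simple_H] by blast
qed

end

context diagonal
begin

text \<open>Makes \<open>goursat\<close> applicable again after some coordinates have been made
  trivial.\<close>

lemma normal_trivial_on:
  assumes K: "normal_in_D K"
  shows "normal_in_D {x \<in> K. \<forall>i\<in>J. x i = \<one>\<^bsub>H i\<^esub>}"
proof -
  have Hinv: "inv\<^bsub>H i\<^esub> \<one>\<^bsub>H i\<^esub> = \<one>\<^bsub>H i\<^esub>" for i
    by (rule monoid.inv_one[OF group.is_monoid[OF group_H]])
  have Hr: "a \<otimes>\<^bsub>H i\<^esub> inv\<^bsub>H i\<^esub> a = \<one>\<^bsub>H i\<^esub>" if "a \<in> carrier (H i)" for a i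
    using group.r_inv[OF group_H that] .
  have "K \<subseteq> carrier D" using K by (simp add: normal_in_D_def)
  then have inv: "inv\<^bsub>D\<^esub> x = (\<lambda>n. inv\<^bsub>H n\<^esub> x n)" if "x \<in> K" for x using that D_inv by blast
  show ?thesis
    unfolding normal_in_D_def
  proof (intro conjI ballI)
    show "\<one>\<^bsub>D\<^esub> \<in> {x \<in> K. \<forall>i\<in>J. x i = \<one>\<^bsub>H i\<^esub>}" using K by (simp add: normal_in_D_def D_one)
    show "{x \<in> K. \<forall>i\<in>J. x i = \<one>\<^bsub>H i\<^esub>} \<subseteq> carrier D" using K by (auto simp: normal_in_D_def)
    fix x assume x: "x \<in> {x \<in> K. \<forall>i\<in>J. x i = \<one>\<^bsub>H i\<^esub>}"
    then have xK: "x \<in> K" "\<And>i. i \<in> J \<Longrightarrow> x i = \<one>\<^bsub>H i\<^esub>" by auto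
    show "x \<otimes>\<^bsub>D\<^esub> y \<in> {x \<in> K. \<forall>i\<in>J. x i = \<one>\<^bsub>H i\<^esub>}" if "y \<in> {x \<in> K. \<forall>i\<in>J. x i = \<one>\<^bsub>H i\<^esub>}" for y
    proof -
      have "x \<otimes>\<^bsub>D\<^esub> y \<in> K" using K xK that by (simp add: normal_in_D_def)
      moreover have "(x \<otimes>\<^bsub>D\<^esub> y) i = \<one>\<^bsub>H i\<^esub>" if "i \<in> J" for i
        using xK(2)[OF that] \<open>y \<in> _\<close> that by (simp add: D_mult)
      ultimately show ?thesis by blast
    qed
    have "inv\<^bsub>D\<^esub> x \<in> K" using K xK by (simp add: normal_in_D_def)
    moreover have "(inv\<^bsub>D\<^esub> x) i = \<one>\<^bsub>H i\<^esub>" if "i \<in> J" for i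
      using xK(2)[OF that] inv[OF xK(1)] Hinv by simp
    ultimately show "inv\<^bsub>D\<^esub> x \<in> {x \<in> K. \<forall>i\<in>J. x i = \<one>\<^bsub>H i\<^esub>}" by blast
    fix d assume d: "d \<in> carrier D"
    have "d \<otimes>\<^bsub>D\<^esub> x \<otimes>\<^bsub>D\<^esub> inv\<^bsub>D\<^esub> d \<in> K" using K xK d by (simp add: normal_in_D_def)
    moreover have "(d \<otimes>\<^bsub>D\<^esub> x \<otimes>\<^bsub>D\<^esub> inv\<^bsub>D\<^esub> d) i = \<one>\<^bsub>H i\<^esub>" if "i \<in> J" for i
      using xK(2)[OF that] D_Pi[OF d, of i] Hr by (simp add: D_mult D_inv[OF d])
    ultimately show "d \<otimes>\<^bsub>D\<^esub> x \<otimes>\<^bsub>D\<^esub> inv\<^bsub>D\<^esub> d \<in> {x \<in> K. \<forall>i\<in>J. x i = \<one>\<^bsub>H i\<^esub>}" by blast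
  qed
qed

text \<open>Goursat's lemma: two coordinates in which \<open>K\<close> is full are independent, because otherwise one
  would determine the other and give an isomorphism between distinct factors.\<close>

lemma goursat:
  assumes K: "normal_in_D K" and ij: "i \<noteq> j"
    and full: "(\<lambda>x. x i) ` K = carrier (H i)" "(\<lambda>x. x j) ` K = carrier (H j)"
  shows "(\<lambda>x. x i) ` {x \<in> K. x j = \<one>\<^bsub>H j\<^esub>} = carrier (H i)"
proof (rule ccontr)
  interpret Hi: simple_group "H i" by (rule simple_H)
  interpret Hj: simple_group "H j" by (rule simple_H)
  assume "\<not> ?thesis"
  then have triv: "(\<lambda>x. x i) ` {x \<in> K. x j = \<one>\<^bsub>H j\<^esub>} = {\<one>\<^bsub>H i\<^esub>}"
    using coordinate_image[OF normal_trivial_on[OF K, of "{j}"], of i] by simp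
  have KD: "K \<subseteq> carrier D" using K by (simp add: normal_in_D_def)
  have div: "inv\<^bsub>D\<^esub> x \<otimes>\<^bsub>D\<^esub> y \<in> K" if "x \<in> K" "y \<in> K" for x y
    using K that by (simp add: normal_in_D_def)
  have div_n: "(inv\<^bsub>D\<^esub> x \<otimes>\<^bsub>D\<^esub> y) n = \<one>\<^bsub>H n\<^esub> \<longleftrightarrow> x n = y n" if xy: "x \<in> K" "y \<in> K" for x y n
  proof -
    interpret Hn: group "H n" by (rule group_H)
    have c: "x n \<in> carrier (H n)" "y n \<in> carrier (H n)" using xy KD D_Pi by auto
    have "inv\<^bsub>D\<^esub> x = (\<lambda>n. inv\<^bsub>H n\<^esub> x n)" using xy KD D_inv by blast
    then have "(inv\<^bsub>D\<^esub> x \<otimes>\<^bsub>D\<^esub> y) n = inv\<^bsub>H n\<^esub> x n \<otimes>\<^bsub>H n\<^esub> y n" by (simp add: D_mult)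
    then show ?thesis using c by (metis Hn.inv_equality Hn.inv_inv Hn.inv_closed Hn.l_inv)
  qed
  \<comment> \<open>By \<open>triv\<close>, coordinate \<open>j\<close> determines coordinate
    \<open>i\<close>; the map \<open>f\<close> below is this dependence.\<close>
  have wd: "x i = y i" if "x \<in> K" "y \<in> K" "x j = y j" for x y
    using triv div[OF that(1,2)] div_n[OF that(1,2)] that(3) by blast
  have exi: "\<exists>x. x \<in> K \<and> x i = a" if "a \<in> carrier (H i)" for a
    using that unfolding full(1)[symmetric] by blast
  have exj: "\<exists>x. x \<in> K \<and> x j = a" if "a \<in> carrier (H j)" for a
    using that unfolding full(2)[symmetric] by blast
  define f where "f a = (SOME b. \<exists>x\<in>K. x j = a \<and> x i = b)" for a
  have f: "f (x j) = x i" if "x \<in> K" for x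
    unfolding f_def by (rule some_equality) (use that wd in blast)+
  have fhom: "f \<in> hom (H j) (H i)"
  proof (rule homI)
    fix a b assume ab: "a \<in> carrier (H j)" "b \<in> carrier (H j)"
    obtain x where x: "x \<in> K" "x j = a" using exj[OF ab(1)] by blast
    obtain y where y: "y \<in> K" "y j = b" using exj[OF ab(2)] by blast
    show "f a \<in> carrier (H i)" using f[OF x(1)] x(2) D_Pi[OF subsetD[OF KD x(1)], of i] by simp
    have "x \<otimes>\<^bsub>D\<^esub> y \<in> K" using K x y by (simp add: normal_in_D_def)
    from f[OF this] show "f (a \<otimes>\<^bsub>H j\<^esub> b) = f a \<otimes>\<^bsub>H i\<^esub> f b"
      using f[OF x(1)] f[OF y(1)] x y by (simp add: D_mult)
  qed
  have fsurj: "f ` carrier (H j) = carrier (H i)"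
  proof
    show "f ` carrier (H j) \<subseteq> carrier (H i)" using fhom by (simp add: hom_def Pi_iff image_subset_iff)
    show "carrier (H i) \<subseteq> f ` carrier (H j)"
    proof
      fix b assume "b \<in> carrier (H i)"
      then obtain x where x: "x \<in> K" "x i = b" using exi by blast
      have "f (x j) = b" using f[OF x(1)] x(2) by simp
      moreover have "x j \<in> carrier (H j)" by (rule D_Pi[OF subsetD[OF KD x(1)]])
      ultimately show "b \<in> f ` carrier (H j)" by blast
    qed
  qed
  \<comment> \<open>This image is the kernel of \<open>f\<close>; were it everything,
    \<open>f\<close> would be trivial although it is onto a nontrivial group.\<close>
  have "(\<lambda>x. x j) ` {x \<in> K. x i = \<one>\<^bsub>H i\<^esub>} = {\<one>\<^bsub>H j\<^esub>}"
  proof (rule ccontr)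
    assume "\<not> ?thesis"
    then have all: "(\<lambda>x. x j) ` {x \<in> K. x i = \<one>\<^bsub>H i\<^esub>} = carrier (H j)"
      using coordinate_image[OF normal_trivial_on[OF K, of "{i}"], of j] by simp
    have "f a = \<one>\<^bsub>H i\<^esub>" if a: "a \<in> carrier (H j)" for a
    proof -
      have "a \<in> (\<lambda>x. x j) ` {x \<in> K. x i = \<one>\<^bsub>H i\<^esub>}" using a all by simp
      then show ?thesis using f by auto
    qed
    then have "carrier (H i) \<subseteq> {\<one>\<^bsub>H i\<^esub>}" unfolding fsurj[symmetric] by blast
    then show False using Hi.simple_not_triv by auto
  qed
  then have inj': "x j = \<one>\<^bsub>H j\<^esub>" if "x \<in> K" "x i = \<one>\<^bsub>H i\<^esub>" for x using that by blast
  have "inj_on f (carrier (H j))"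
  proof (rule inj_onI)
    fix a b assume ab: "a \<in> carrier (H j)" "b \<in> carrier (H j)" "f a = f b"
    obtain x where x: "x \<in> K" "x j = a" using exj[OF ab(1)] by blast
    obtain y where y: "y \<in> K" "y j = b" using exj[OF ab(2)] by blast
    have "x i = y i" using f[OF x(1)] f[OF y(1)] x y ab(3) by simp
    then show "a = b" using inj'[OF div[OF x(1) y(1)]] div_n[OF x(1) y(1)] x y by simp
  qed
  then have "f \<in> iso (H j) (H i)" using fhom fsurj by (simp add: iso_def bij_betw_def)
  then show False using H_not_iso[of j i] ij by (auto simp: is_iso_def)
qed

text \<open>Induction on \<open>J\<close>, for all \<open>n\<close> at once: with \<open>J\<close>
  made trivial, both \<open>n\<close> and the new index \<open>j\<close> are still full, and
  \<open>goursat\<close> applies to this pair.\<close>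

lemma independent:
  assumes K: "normal_in_D K" and J: "finite J" "n \<notin> J"
    and full: "\<And>i. i \<in> insert n J \<Longrightarrow> (\<lambda>x. x i) ` K = carrier (H i)"
  shows "(\<lambda>x. x n) ` {x \<in> K. \<forall>i\<in>J. x i = \<one>\<^bsub>H i\<^esub>} = carrier (H n)"
  using J full
proof (induction J arbitrary: n rule: finite_induct)
  case empty
  then show ?case by simp
next
  case (insert j J)
  let ?K = "{x \<in> K. \<forall>i\<in>J. x i = \<one>\<^bsub>H i\<^esub>}"
  have "(\<lambda>x. x n) ` ?K = carrier (H n)"
    by (rule insert.IH) (use insert.prems(1) in simp, rule insert.prems(2), blast)
  moreover have "(\<lambda>x. x j) ` ?K = carrier (H j)"
    by (rule insert.IH) (rule insert.hyps(2), rule insert.prems(2), blast)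
  ultimately have "(\<lambda>x. x n) ` {x \<in> ?K. x j = \<one>\<^bsub>H j\<^esub>} = carrier (H n)"
    using goursat[OF normal_trivial_on[OF K, of J], of n j] insert.prems(1) by auto
  moreover have "{x \<in> ?K. x j = \<one>\<^bsub>H j\<^esub>} = {x \<in> K. \<forall>i\<in>insert j J. x i = \<one>\<^bsub>H i\<^esub>}" by auto
  ultimately show ?case by simp
qed

text \<open>A kernel element that is nontrivial at \<open>n\<close> has support below some
  \<open>N\<close>. Among the elements supported there, the coordinates that occur at all are full
  by simplicity, hence independent, and all but \<open>n\<close> can be made trivial.\<close>

lemma single_coordinate:
  assumes a: "a \<in> carrier (H n)"
  shows "(\<lambda>i. if i = n then a else \<one>\<^bsub>H i\<^esub>) \<in> carrier D"
proof -
  obtain x0 where x0: "x0 \<in> carrier D" "q x0 = \<one>\<^bsub>G\<^esub>" "x0 n \<noteq> \<one>\<^bsub>H n\<^esub>" using kernel_nontrivial by blast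
  obtain N where N: "\<And>i. i \<ge> N \<Longrightarrow> x0 i = \<one>\<^bsub>H i\<^esub>"
    using q_ker[OF x0(1)] x0(2) by (auto simp: eventually_sequentially)
  have "normal_in_D (carrier D)" by (simp add: normal_in_D_def)
  from normal_trivial_on[OF this, of "{N..}"]
  have K: "normal_in_D {x \<in> carrier D. \<forall>i\<in>{N..}. x i = \<one>\<^bsub>H i\<^esub>}" (is "normal_in_D ?K") .
  have x0K: "x0 \<in> ?K" using x0 N by auto
  \<comment> \<open>Coordinates outside \<open>I\<close> are trivial on all of \<open>?K\<close>, so
    only the finite set \<open>I - {n}\<close> has to be dealt with.\<close>
  define I where "I = {i. \<exists>x\<in>?K. x i \<noteq> \<one>\<^bsub>H i\<^esub>}"
  have "i < N" if i: "i \<in> I" for i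
  proof -
    obtain x where "x \<in> ?K" "x i \<noteq> \<one>\<^bsub>H i\<^esub>" using i by (auto simp: I_def)
    then show ?thesis by (metis (mono_tags, lifting) atLeast_iff mem_Collect_eq not_less)
  qed
  then have fin: "finite I" by (meson finite_nat_set_iff_bounded)
  have full: "(\<lambda>x. x i) ` ?K = carrier (H i)" if i: "i \<in> I" for i
  proof -
    obtain x where x: "x \<in> ?K" "x i \<noteq> \<one>\<^bsub>H i\<^esub>" using i unfolding I_def by blast
    have "x i \<in> (\<lambda>x. x i) ` ?K" using x(1) by (rule imageI)
    with x(2) have "(\<lambda>x. x i) ` ?K \<noteq> {\<one>\<^bsub>H i\<^esub>}" by (intro notI) (simp only: singleton_iff)
    then show ?thesis using coordinate_image[OF K, of i] by blast
  qed
  have nI: "n \<in> I" using x0K x0(3) unfolding I_def by blast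
  have "(\<lambda>x. x n) ` {x \<in> ?K. \<forall>i\<in>I - {n}. x i = \<one>\<^bsub>H i\<^esub>} = carrier (H n)"
    by (rule independent[OF K]) (use fin nI full in auto)
  then obtain x where x: "x \<in> ?K" "\<forall>i\<in>I - {n}. x i = \<one>\<^bsub>H i\<^esub>" "x n = a"
    using a by (smt (verit, best) imageE mem_Collect_eq)
  have "x = (\<lambda>i. if i = n then a else \<one>\<^bsub>H i\<^esub>)"
  proof
    fix i
    have "x i = \<one>\<^bsub>H i\<^esub>" if "i \<notin> I" using that x(1) unfolding I_def by blast
    then show "x i = (if i = n then a else \<one>\<^bsub>H i\<^esub>)" using x(2,3) by auto
  qed
  then show ?thesis using x(1) by auto
qed

section \<open>Splitting off finitely many coordinates\<close>

definition head :: "nat \<Rightarrow> (nat \<Rightarrow> 'b) \<Rightarrow> nat \<Rightarrow> 'b"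
  where "head m x = (\<lambda>n. if n < m then x n else \<one>\<^bsub>H n\<^esub>)"

definition tail :: "nat \<Rightarrow> (nat \<Rightarrow> 'b) \<Rightarrow> nat \<Rightarrow> 'b"
  where "tail m x = (\<lambda>n. if n < m then \<one>\<^bsub>H n\<^esub> else x n)"

text \<open>Built one coordinate at a time from the single factors contained in
  \<open>D\<close>.\<close>

lemma head_D: "x \<in> carrier D \<Longrightarrow> head m x \<in> carrier D"
proof (induction m)
  case 0
  then show ?case using D.one_closed by (simp add: head_def D_one)
next
  case (Suc m)
  have c: "x n \<in> carrier (H n)" for n using Suc.prems by (rule D_Pi)
  have "head (Suc m) x = head m x \<otimes>\<^bsub>D\<^esub> (\<lambda>i. if i = m then x m else \<one>\<^bsub>H i\<^esub>)"
    using c by (auto simp: head_def D_mult fun_eq_iff less_Suc_eq)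
  then show ?case using Suc single_coordinate[OF c[of m]] by simp
qed

lemma head_tail: "x \<in> carrier D \<Longrightarrow> x = head m x \<otimes>\<^bsub>D\<^esub> tail m x"
  using D_Pi by (auto simp: head_def tail_def D_mult fun_eq_iff)

lemma tail_D:
  assumes x: "x \<in> carrier D"
  shows "tail m x \<in> carrier D"
proof -
  have h: "head m x \<in> carrier D" by (rule head_D[OF x])
  have "tail m x = inv\<^bsub>D\<^esub> (head m x) \<otimes>\<^bsub>D\<^esub> x"
  proof
    fix n
    have c: "x n \<in> carrier (H n)" by (rule D_Pi[OF x])
    show "tail m x n = (inv\<^bsub>D\<^esub> (head m x) \<otimes>\<^bsub>D\<^esub> x) n"
      using c group.l_inv[OF group_H c] monoid.inv_one[OF group.is_monoid[OF group_H]]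
      by (simp add: D_mult D_inv[OF h]) (simp add: head_def tail_def)
  qed
  then show ?thesis using h x by simp
qed

definition heads :: "nat \<Rightarrow> (nat \<Rightarrow> 'b) set"
  where "heads m = {x \<in> carrier D. \<forall>n\<ge>m. x n = \<one>\<^bsub>H n\<^esub>}"

lemma heads_subgroup: "subgroup (heads m) D"
proof (rule D.subgroupI)
  show "heads m \<noteq> {}" using D.one_closed by (auto simp: heads_def D_one)
  show "inv\<^bsub>D\<^esub> x \<in> heads m" if "x \<in> heads m" for x
  proof -
    have x: "x \<in> carrier D" "\<And>n. n \<ge> m \<Longrightarrow> x n = \<one>\<^bsub>H n\<^esub>" using that by (simp_all add: heads_def)
    then have "(inv\<^bsub>D\<^esub> x) n = \<one>\<^bsub>H n\<^esub>" if "n \<ge> m" for n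
      using that monoid.inv_one[OF group.is_monoid[OF group_H]] by (simp add: D_inv[OF x(1)])
    then show ?thesis using D.inv_closed[OF x(1)] by (simp add: heads_def)
  qed
  show "x \<otimes>\<^bsub>D\<^esub> y \<in> heads m" if "x \<in> heads m" "y \<in> heads m" for x y
    using that D.m_closed[of x y] by (simp add: heads_def D_mult)
qed (auto simp: heads_def)

lemma heads_finite: "finite (heads m)"
proof -
  have "heads m \<subseteq> (\<lambda>f n. if n < m then f n else \<one>\<^bsub>H n\<^esub>) ` (\<Pi>\<^sub>E i\<in>{..<m}. carrier (H i))"
  proof
    fix x assume x: "x \<in> heads m"
    have "x = (\<lambda>n. if n < m then restrict x {..<m} n else \<one>\<^bsub>H n\<^esub>)"
      using x by (auto simp: heads_def fun_eq_iff)
    moreover have "restrict x {..<m} \<in> (\<Pi>\<^sub>E i\<in>{..<m}. carrier (H i))"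
      using x D_Pi by (auto simp: heads_def)
    ultimately show "x \<in> (\<lambda>f n. if n < m then f n else \<one>\<^bsub>H n\<^esub>) ` (\<Pi>\<^sub>E i\<in>{..<m}. carrier (H i))"
      by (rule image_eqI)
  qed
  then show ?thesis by (rule finite_surj[rotated]) (simp add: finite_PiE finite_H)
qed

lemma q_kernel_heads: "x \<in> carrier D \<Longrightarrow> q x = \<one>\<^bsub>G\<^esub> \<longleftrightarrow> (\<exists>m. x \<in> heads m)"
  by (simp add: q_ker heads_def eventually_sequentially)

text \<open>The required relations concern finitely many elements and hold in all large coordinates;
  \<open>m\<close> is chosen beyond the exceptions, and \<open>tail\<close> erases what lies below
  \<open>m\<close>.\<close>

lemma diagonal_splitting:
  assumes B: "finite B" "B \<subseteq> carrier G" and T: "finite T" "T \<subseteq> carrier D" "q ` T \<subseteq> B"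
  shows "\<exists>P r t. local_splitting D G q T B P r t"
proof -
  have ev: "\<forall>\<^sub>F n in sequentially. x n = y n" if "x \<in> carrier D" "y \<in> carrier D" "q x = q y" for x y
    using q_eventually[OF that(1)] q_eventually[OF that(2)] by eventually_elim (simp add: that(3))
  have q_mult: "q (x \<otimes>\<^bsub>D\<^esub> y) = q x \<otimes>\<^bsub>G\<^esub> q y" if "x \<in> carrier D" "y \<in> carrier D" for x y
    using q_hom that by (simp add: hom_def)
  have "\<forall>\<^sub>F n in sequentially. \<forall>z\<in>B \<times> B. lift (fst z \<otimes>\<^bsub>G\<^esub> snd z) n = (lift (fst z) \<otimes>\<^bsub>D\<^esub> lift (snd z)) n"
    using B lift by (intro eventually_ball_finite ballI ev) (auto simp: q_mult subset_iff)
  moreover have "\<forall>\<^sub>F n in sequentially. \<forall>x\<in>T. x n = lift (q x) n"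
    using T q_closed lift by (intro eventually_ball_finite ballI ev) auto
  ultimately have "\<forall>\<^sub>F n in sequentially.
      (\<forall>z\<in>B \<times> B. lift (fst z \<otimes>\<^bsub>G\<^esub> snd z) n = (lift (fst z) \<otimes>\<^bsub>D\<^esub> lift (snd z)) n) \<and> (\<forall>x\<in>T. x n = lift (q x) n)"
    by eventually_elim blast
  from this[unfolded eventually_sequentially] obtain m where "\<forall>n\<ge>m. (\<forall>z\<in>B \<times> B. lift (fst z \<otimes>\<^bsub>G\<^esub> snd z) n = (lift (fst z) \<otimes>\<^bsub>D\<^esub> lift (snd z)) n) \<and> (\<forall>x\<in>T. x n = lift (q x) n)"
    by (rule exE)
  then have m: "\<And>b b' n. b \<in> B \<Longrightarrow> b' \<in> B \<Longrightarrow> n \<ge> m \<Longrightarrow> lift (b \<otimes>\<^bsub>G\<^esub> b') n = lift b n \<otimes>\<^bsub>H n\<^esub> lift b' n"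
    "\<And>x n. x \<in> T \<Longrightarrow> n \<ge> m \<Longrightarrow> x n = lift (q x) n"
    by (auto simp: D_mult)
  have "local_splitting D G q T B (heads m) (head m) (\<lambda>b. tail m (lift b))"
    unfolding local_splitting_def
  proof (intro conjI ballI impI)
    show "subgroup (heads m) D" by (rule heads_subgroup)
    show "finite (heads m)" by (rule heads_finite)
    show "head m \<in> hom D D" by (rule homI) (auto simp: head_D, auto simp: head_def D_mult fun_eq_iff)
    show "head m ` carrier D \<subseteq> heads m" using head_D by (auto simp: heads_def) (auto simp: head_def)
    show "tail m (lift b) \<in> carrier D" if "b \<in> B" for b using that B lift tail_D by blast
    show "tail m (lift (b \<otimes>\<^bsub>G\<^esub> b')) = tail m (lift b) \<otimes>\<^bsub>D\<^esub> tail m (lift b')" if "b \<in> B" "b' \<in> B" for b b'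
      using m(1)[OF that] by (auto simp: tail_def D_mult fun_eq_iff)
    show "p \<otimes>\<^bsub>D\<^esub> tail m (lift b) = tail m (lift b) \<otimes>\<^bsub>D\<^esub> p" if p: "p \<in> heads m" and b: "b \<in> B" for p b
    proof -
      have "lift b \<in> carrier D" "p \<in> carrier D" using b B lift p by (auto simp: heads_def)
      then show ?thesis using p D_Pi by (auto simp: heads_def tail_def D_mult fun_eq_iff)
    qed
    fix x assume x: "x \<in> T"
    show "q x \<in> B" using x T(3) by blast
    have "tail m x = tail m (lift (q x))" using m(2)[OF x] by (auto simp: tail_def fun_eq_iff)
    then show "x = head m x \<otimes>\<^bsub>D\<^esub> tail m (lift (q x))" using head_tail[of x m] x T(2) by auto
  qed
  then show ?thesis by blast
qed

text \<open>Lifts of \<open>S0\<close> alone need not generate \<open>D\<close>. For each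
  \<open>s\<close> in \<open>S\<close> the quotient of \<open>gam s\<close> by a word in the lifts
  with the same image is added; it lies in the kernel, so \<open>q\<close> still maps all generators
  into \<open>S0\<close> and the identity.\<close>

lemma diagonal_generators:
  assumes S0: "finite S0" "S0 \<subseteq> carrier G" "generate G S0 = carrier G"
  obtains T where "finite_generating_set D T" "q ` T \<subseteq> insert \<one>\<^bsub>G\<^esub> S0"
proof -
  have L: "lift ` S0 \<subseteq> carrier D" using S0(2) lift by blast
  let ?E = "generate D (lift ` S0)"
  have "subgroup ?E D" by (rule D.generate_is_subgroup[OF L])
  then have "subgroup (q ` ?E) G" by (rule q.subgroup_img_is_subgroup)
  moreover have "S0 \<subseteq> q ` ?E"
  proof
    fix s assume "s \<in> S0"
    then have "lift s \<in> ?E" "q (lift s) = s" using lift S0(2) by (auto intro: generate.incl)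
    then show "s \<in> q ` ?E" by (metis image_eqI)
  qed
  ultimately have "carrier G \<subseteq> q ` ?E" using G.generate_subgroup_incl S0(3) by metis
  then have "\<exists>w. w \<in> ?E \<and> q w = s" if "s \<in> S" for s using that S(2) by blast
  then obtain w where w: "\<And>s. s \<in> S \<Longrightarrow> w s \<in> ?E" "\<And>s. s \<in> S \<Longrightarrow> q (w s) = s" by metis
  have wD: "w s \<in> carrier D" if "s \<in> S" for s using w(1)[OF that] D.generate_in_carrier[OF L] by blast
  define k where "k s = gam s \<otimes>\<^bsub>D\<^esub> inv\<^bsub>D\<^esub> (w s)" for s
  define T where "T = lift ` S0 \<union> k ` S"
  have kD: "k s \<in> carrier D" if "s \<in> S" for s using that gam_D wD by (simp add: k_def)
  have TD: "T \<subseteq> carrier D" using L kD by (auto simp: T_def)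
  interpret E: subgroup "generate D T" D by (rule D.generate_is_subgroup[OF TD])
  have "?E \<subseteq> generate D T" by (rule D.mono_generate) (simp add: T_def)
  then have gamT: "gam s \<in> generate D T" if "s \<in> S" for s
  proof -
    have "k s \<in> generate D T" using that by (auto simp: T_def intro: generate.incl)
    moreover have "w s \<in> generate D T" using w(1)[OF that] \<open>?E \<subseteq> _\<close> by blast
    ultimately have "k s \<otimes>\<^bsub>D\<^esub> w s \<in> generate D T" by (rule E.m_closed)
    then show ?thesis using gam_D[OF that] wD[OF that] by (simp add: k_def D.m_assoc)
  qed
  have "x \<in> generate D T" if "x \<in> carrier D" for x
    using that unfolding D_carrier
  proof (induction x rule: generate.induct)
    case one
    then show ?case using E.one_closed by (simp add: diagonal_product_def restrict_UNIV)
  next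
    case (incl x)
    then show ?case using gamT by (auto simp: gam_def)
  next
    case (inv x)
    then obtain s where s: "s \<in> S" "x = gam s" by (auto simp: gam_def)
    have "x \<in> carrier \<Pi>H" using inv gens_Pi by blast
    then have "inv\<^bsub>\<Pi>H\<^esub> x = inv\<^bsub>D\<^esub> x" using Pi_inv D_inv[OF gam_D[OF s(1)]] s(2) by simp
    then show ?case using E.m_inv_closed[OF gamT[OF s(1)]] s(2) by simp
  next
    case (eng x y)
    then show ?case using E.m_closed[of x y] by (simp add: diagonal_product_def restrict_UNIV)
  qed
  then have "generate D T = carrier D" using D.generate_incl[OF TD] by blast
  moreover have "finite T" using S0(1) S(1) by (simp add: T_def)
  moreover have "q ` T \<subseteq> insert \<one>\<^bsub>G\<^esub> S0"
  proof -
    have "q (k s) = \<one>\<^bsub>G\<^esub>" if "s \<in> S" for s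
      using that gam_D wD w(2) q_gam S(2) by (auto simp: k_def)
    moreover have "q (lift s) = s" if "s \<in> S0" for s using lift(2) S0(2) that by blast
    ultimately show ?thesis by (auto simp: T_def)
  qed
  ultimately show thesis using that TD by (simp add: finite_generating_set_def)
qed

theorem diagonal_stable:
  assumes "hs_stable G"
  shows "hs_stable D"
proof -
  obtain S0 where S0: "finite S0" "S0 \<subseteq> carrier G" "generate G S0 = carrier G" "hs_stable_wrt G S0"
    using assms by (auto simp: hs_stable_def finite_generating_set_def)
  have st: "fmat_stable G (insert \<one>\<^bsub>G\<^esub> S0)"
    by (rule fmat_stable_insert_one[OF G S0(2)]) (use G.hs_stable_wrt_fmat[OF S0(2)] S0(4) in simp)
  obtain T where T: "finite_generating_set D T" "q ` T \<subseteq> insert \<one>\<^bsub>G\<^esub> S0"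
    using diagonal_generators[OF S0(1-3)] by blast
  have T': "finite T" "T \<subseteq> carrier D" "generate D T = carrier D"
    using T(1) by (auto simp: finite_generating_set_def)
  have "fmat_stable D T"
  proof (rule stable_extension[OF D_group G q_hom _ _ st T' T(2)])
    show "finite (insert \<one>\<^bsub>G\<^esub> S0)" "insert \<one>\<^bsub>G\<^esub> S0 \<subseteq> carrier G" using S0 by auto
    show "\<exists>P r t. local_splitting D G q T B P r t"
      if "finite B" "B \<subseteq> carrier G" "insert \<one>\<^bsub>G\<^esub> S0 \<subseteq> B" for B
      using diagonal_splitting[OF that(1,2) T'(1,2)] that(3) T(2) by blast
  qed
  then have "hs_stable_wrt D T" using D.hs_stable_wrt_fmat[OF T'(2)] by simp
  then show ?thesis using T(1) by (auto simp: hs_stable_def)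
qed

end

section \<open>Amenability of the diagonal product\<close>

text \<open>Zorn's lemma for filters ordered by fineness: a minimal proper filter is an
  ultrafilter.\<close>

lemma ultrafilter_exists:
  obtains F :: "nat filter" where "F \<noteq> bot" "F \<le> sequentially"
    "\<And>F'. F' \<noteq> bot \<Longrightarrow> F' \<le> F \<Longrightarrow> F' = F"
proof -
  let ?A = "{F :: nat filter. F \<noteq> bot \<and> F \<le> sequentially}"
  let ?R = "relation_of (\<lambda>F F'. F' \<le> F) ?A"
  have "\<exists>m\<in>?A. \<forall>a\<in>?A. a \<le> m \<longrightarrow> a = m"
  proof (rule predicate_Zorn)
    show "partial_order_on ?A ?R"
      by (auto simp: partial_order_on_def preorder_on_def refl_on_def trans_def antisym_def relation_of_def)
    fix C assume C: "C \<in> Chains ?R"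
    have CA: "C \<subseteq> ?A" and ch: "\<And>a b. a \<in> C \<Longrightarrow> b \<in> C \<Longrightarrow> a \<le> b \<or> b \<le> a"
      using C by (auto simp: Chains_def relation_of_def)
    \<comment> \<open>Inserting \<open>sequentially\<close> covers the empty chain; finitely many
      members of a chain have a least one, so no finite infimum is trivial.\<close>
    have "Inf (insert sequentially C) \<noteq> bot"
    proof (rule Inf_filter_not_bot)
      fix X assume X: "X \<subseteq> insert sequentially C" "finite X"
      have "\<exists>u\<in>?A. (u = sequentially \<or> u \<in> C) \<and> u \<le> Inf X"
        using X(2,1)
      proof (induction X rule: finite_induct)
        case empty
        then show ?case by (intro bexI[of _ sequentially]) auto
      next
        case (insert x X)
        then obtain u where u: "u \<in> ?A" "u = sequentially \<or> u \<in> C" "u \<le> Inf X" by auto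
        have x: "x = sequentially \<or> x \<in> C" "x \<in> ?A" using insert.prems CA by auto
        have "u \<le> x \<or> x \<le> u" using u x ch by auto
        then show ?case using u x by (auto intro: order_trans)
      qed
      then show "Inf X \<noteq> bot" by (auto simp: bot_unique)
    qed
    moreover have "Inf (insert sequentially C) \<le> sequentially" by (rule Inf_lower) simp
    ultimately have "Inf (insert sequentially C) \<in> ?A" by blast
    moreover have "Inf (insert sequentially C) \<le> a" if "a \<in> C" for a by (rule Inf_lower) (use that in simp)
    ultimately show "\<exists>u\<in>?A. \<forall>a\<in>C. u \<le> a" by blast
  qed
  then obtain F where F: "F \<in> ?A" "\<And>F'. F' \<in> ?A \<Longrightarrow> F' \<le> F \<Longrightarrow> F' = F" by blast
  show thesis by (rule that[of F]) (use F order_trans in auto)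
qed

text \<open>Compactness of the interval gives a cluster point, and minimality of the filter turns it
  into a limit.\<close>

lemma bounded_limit_exists:
  obtains F :: "nat filter" where "F \<noteq> bot" "F \<le> sequentially"
    "\<And>(f :: nat \<Rightarrow> real) a b. (\<And>n. a \<le> f n \<and> f n \<le> b) \<Longrightarrow> \<exists>l. (f \<longlongrightarrow> l) F"
proof -
  obtain F :: "nat filter" where F: "F \<noteq> bot" "F \<le> sequentially"
    "\<And>F'. F' \<noteq> bot \<Longrightarrow> F' \<le> F \<Longrightarrow> F' = F" by (rule ultrafilter_exists) blast
  have "\<exists>l. (f \<longlongrightarrow> l) F" if f: "\<And>n. a \<le> f n \<and> f n \<le> b" for f :: "nat \<Rightarrow> real" and a b
  proof -
    have "\<exists>x\<in>{a..b}. \<forall>U. open U \<longrightarrow> x \<in> U \<longrightarrow> \<not> eventually (\<lambda>n. f n \<notin> U) F"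
    proof (rule ccontr)
      assume "\<not> ?thesis"
      then have "\<forall>x\<in>{a..b}. \<exists>U. open U \<and> x \<in> U \<and> eventually (\<lambda>n. f n \<notin> U) F" by blast
      from bchoice[OF this] obtain U
        where "\<forall>x\<in>{a..b}. open (U x) \<and> x \<in> U x \<and> eventually (\<lambda>n. f n \<notin> U x) F" ..
      then have U: "\<And>x. x \<in> {a..b} \<Longrightarrow> open (U x)" "\<And>x. x \<in> {a..b} \<Longrightarrow> x \<in> U x"
        "\<And>x. x \<in> {a..b} \<Longrightarrow> eventually (\<lambda>n. f n \<notin> U x) F"
        by simp_all
      obtain C where C: "C \<subseteq> {a..b}" "finite C" "{a..b} \<subseteq> (\<Union>x\<in>C. U x)"
      proof (rule compactE_image[of "{a..b}" "{a..b}" U])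
        show "compact {a..b}" by (rule compact_Icc)
        show "open (U y)" if "y \<in> {a..b}" for y by (rule U(1)[OF that])
        show "{a..b} \<subseteq> (\<Union>y\<in>{a..b}. U y)" using U(2) by blast
      qed (rule that)
      have "eventually (\<lambda>n. \<forall>x\<in>C. f n \<notin> U x) F"
        by (rule eventually_ball_finite[OF C(2)]) (use C(1) U(3) in blast)
      then have "eventually (\<lambda>n. False) F"
      proof eventually_elim
        case (elim n)
        moreover have "f n \<in> {a..b}" using f by simp
        ultimately show False using C(3) by blast
      qed
      then show False using F(1) by simp
    qed
    then obtain x where x: "\<And>U. open U \<Longrightarrow> x \<in> U \<Longrightarrow> \<not> eventually (\<lambda>n. f n \<notin> U) F" by blast
    \<comment> \<open>Refining \<open>F\<close> by preimages of neighbourhoods of \<open>x\<close>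
      keeps it proper, so by minimality \<open>F\<close> already contains them.\<close>
    have "inf F (filtercomap f (nhds x)) \<noteq> bot"
    proof
      assume "inf F (filtercomap f (nhds x)) = bot"
      then have "eventually (\<lambda>_. False) (inf F (filtercomap f (nhds x)))" by simp
      then obtain Q R where QR: "eventually Q F" "eventually R (filtercomap f (nhds x))" "\<And>n. Q n \<Longrightarrow> R n \<Longrightarrow> False"
        unfolding eventually_inf by blast
      obtain U where U: "open U" "x \<in> U" "\<And>n. f n \<in> U \<Longrightarrow> R n"
        using QR(2) unfolding eventually_filtercomap eventually_nhds by metis
      have "eventually (\<lambda>n. f n \<notin> U) F"
        using QR(1) by eventually_elim (use QR(3) U(3) in blast)
      then show False using x U(1,2) by blast
    qed
    then have "inf F (filtercomap f (nhds x)) = F" by (rule F(3)) simp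
    then have "F \<le> filtercomap f (nhds x)" by (metis inf.cobounded2)
    then have "filterlim f (nhds x) F" by (simp add: filterlim_iff_le_filtercomap)
    then show ?thesis by blast
  qed
  then show thesis using that F(1,2) by blast
qed

section \<open>Integration against a finitely additive mean\<close>

text \<open>The filter is fixed along with the mean because it serves twice: for integrals of
  functions with infinitely many values and for densities along finite subgroups.\<close>

locale mean =
  fixes X :: "'a set" and \<mu> :: "'a set \<Rightarrow> real" and F :: "nat filter"
  assumes nonneg: "A \<subseteq> X \<Longrightarrow> 0 \<le> \<mu> A" and total: "\<mu> X = 1"
    and additive: "A \<subseteq> X \<Longrightarrow> B \<subseteq> X \<Longrightarrow> A \<inter> B = {} \<Longrightarrow> \<mu> (A \<union> B) = \<mu> A + \<mu> B"
    and F: "F \<noteq> bot" "F \<le> sequentially"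
    and limit: "\<And>(f :: nat \<Rightarrow> real) a b. (\<And>n. a \<le> f n \<and> f n \<le> b) \<Longrightarrow> \<exists>l. (f \<longlongrightarrow> l) F"
begin

definition U :: "(nat \<Rightarrow> real) \<Rightarrow> real" where "U f = Lim F f"

lemma U_eq: "(f \<longlongrightarrow> l) F \<Longrightarrow> U f = l"
  unfolding U_def by (rule tendsto_Lim[OF F(1)])

lemma U_tendsto: "(\<And>n. a \<le> f n \<and> f n \<le> b) \<Longrightarrow> (f \<longlongrightarrow> U f) F"
  using limit[of a f b] U_eq by metis

lemma empty: "\<mu> {} = 0"
  using additive[of "{}" "{}"] by simp

lemma finite_additive:
  "finite Z \<Longrightarrow> (\<And>z. z \<in> Z \<Longrightarrow> A z \<subseteq> X) \<Longrightarrow> (\<And>y z. y \<in> Z \<Longrightarrow> z \<in> Z \<Longrightarrow> y \<noteq> z \<Longrightarrow> A y \<inter> A z = {}) \<Longrightarrow>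
    \<mu> (\<Union>z\<in>Z. A z) = (\<Sum>z\<in>Z. \<mu> (A z))"
proof (induction Z rule: finite_induct)
  case (insert x Z)
  have "A x \<inter> (\<Union>z\<in>Z. A z) = {}" using insert.prems(2) insert.hyps(2) by blast
  then have "\<mu> (A x \<union> (\<Union>z\<in>Z. A z)) = \<mu> (A x) + \<mu> (\<Union>z\<in>Z. A z)"
    using insert.prems(1) by (intro additive) auto
  then show ?case using insert by simp
qed (simp add: empty)

text \<open>The integral of a function with finitely many values.\<close>

definition J :: "('a \<Rightarrow> real) \<Rightarrow> real" where "J g = (\<Sum>v\<in>g ` X. v * \<mu> {x \<in> X. g x = v})"

text \<open>Allows a sum over any finer finite partition, hence over a common refinement for several
  functions.\<close>

lemma J_factor:
  assumes fin: "finite (p ` X)" and g: "\<And>x. x \<in> X \<Longrightarrow> g x = c (p x)"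
  shows "J g = (\<Sum>z\<in>p ` X. c z * \<mu> {x \<in> X. p x = z})"
proof -
  have gX: "g ` X = c ` (p ` X)" using g by (auto simp: image_image)
  have "(\<Sum>z\<in>p ` X. c z * \<mu> {x \<in> X. p x = z})
      = (\<Sum>v\<in>c ` (p ` X). \<Sum>z\<in>{z \<in> p ` X. c z = v}. c z * \<mu> {x \<in> X. p x = z})"
    by (rule sum.image_gen[OF fin])
  also have "\<dots> = (\<Sum>v\<in>g ` X. v * \<mu> {x \<in> X. g x = v})"
    unfolding gX
  proof (rule sum.cong[OF refl])
    fix v
    have "{x \<in> X. g x = v} = (\<Union>z\<in>{z \<in> p ` X. c z = v}. {x \<in> X. p x = z})" using g by auto
    also have "\<mu> \<dots> = (\<Sum>z\<in>{z \<in> p ` X. c z = v}. \<mu> {x \<in> X. p x = z})"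
      by (rule finite_additive) (use fin in auto)
    finally show "(\<Sum>z\<in>{z \<in> p ` X. c z = v}. c z * \<mu> {x \<in> X. p x = z}) = v * \<mu> {x \<in> X. g x = v}"
      by (simp add: sum_distrib_left)
  qed
  finally show ?thesis by (simp add: J_def)
qed

lemma level_sum:
  assumes "finite (p ` X)"
  shows "(\<Sum>z\<in>p ` X. \<mu> {x \<in> X. p x = z}) = 1"
proof -
  have "X = (\<Union>z\<in>p ` X. {x \<in> X. p x = z})" by auto
  also have "\<mu> \<dots> = (\<Sum>z\<in>p ` X. \<mu> {x \<in> X. p x = z})"
    by (rule finite_additive) (use assms in auto)
  finally show ?thesis using total by simp
qed

text \<open>Additivity with an error term, as rounding is not additive; the map \<open>p\<close>
  provides the common refinement.\<close>

lemma J_close: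
  assumes fin: "finite (f ` X)" "finite (g ` X)" "finite (h ` X)"
    and c: "\<And>x. x \<in> X \<Longrightarrow> \<bar>h x - f x - g x\<bar> \<le> c"
  shows "\<bar>J h - J f - J g\<bar> \<le> c"
proof -
  define p where "p x = (f x, g x, h x)" for x
  have "p ` X \<subseteq> f ` X \<times> g ` X \<times> h ` X" by (auto simp: p_def)
  then have pfin: "finite (p ` X)" using fin by (meson finite_SigmaI finite_subset)
  have "J h - J f - J g = (\<Sum>z\<in>p ` X. (snd (snd z) - fst z - fst (snd z)) * \<mu> {x \<in> X. p x = z})"
    using J_factor[OF pfin, of f fst] J_factor[OF pfin, of g "\<lambda>z. fst (snd z)"] J_factor[OF pfin, of h "\<lambda>z. snd (snd z)"]
    by (simp add: p_def left_diff_distrib sum_subtractf)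
  also have "\<bar>\<dots>\<bar> \<le> (\<Sum>z\<in>p ` X. \<bar>(snd (snd z) - fst z - fst (snd z)) * \<mu> {x \<in> X. p x = z}\<bar>)" by (rule sum_abs)
  also have "\<dots> \<le> (\<Sum>z\<in>p ` X. c * \<mu> {x \<in> X. p x = z})"
  proof (rule sum_mono)
    fix z assume "z \<in> p ` X"
    then have "\<bar>snd (snd z) - fst z - fst (snd z)\<bar> \<le> c" using c by (auto simp: p_def)
    moreover have "0 \<le> \<mu> {x \<in> X. p x = z}" by (rule nonneg) blast
    ultimately show "\<bar>(snd (snd z) - fst z - fst (snd z)) * \<mu> {x \<in> X. p x = z}\<bar> \<le> c * \<mu> {x \<in> X. p x = z}"
      by (simp add: abs_mult mult_right_mono)
  qed
  also have "\<dots> = c" using level_sum[OF pfin] by (simp flip: sum_distrib_left)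
  finally show ?thesis .
qed

definition round_down :: "nat \<Rightarrow> real \<Rightarrow> real" where "round_down k t = of_int \<lfloor>real (Suc k) * t\<rfloor> / real (Suc k)"

text \<open>Rounding acts on values pointwise, so invariance under transformations of
  \<open>X\<close> is inherited from \<open>J\<close>; additivity is recovered in the limit.\<close>

definition integral :: "('a \<Rightarrow> real) \<Rightarrow> real" where "integral f = U (\<lambda>k. J (\<lambda>x. round_down k (f x)))"

lemma round_down_range:
  assumes "0 \<le> t" "t \<le> 1"
  shows "round_down k t \<in> (\<lambda>i. real i / real (Suc k)) ` {..Suc k}"
proof -
  have "0 \<le> \<lfloor>real (Suc k) * t\<rfloor>" using assms by simp
  moreover have "real (Suc k) * t \<le> real (Suc k) * 1" using assms by (intro mult_left_mono) auto
  then have "\<lfloor>real (Suc k) * t\<rfloor> \<le> \<lfloor>real (Suc k) * 1\<rfloor>" by (rule floor_mono)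
  then have "\<lfloor>real (Suc k) * t\<rfloor> \<le> int (Suc k)" by (simp only: mult_1_right floor_of_nat)
  ultimately show ?thesis
    by (intro image_eqI[of _ _ "nat \<lfloor>real (Suc k) * t\<rfloor>"]) (auto simp: round_down_def nat_le_iff)
qed

lemma round_down_error: "round_down k t \<le> t" "t < round_down k t + 1 / real (Suc k)"
proof -
  have "of_int \<lfloor>real (Suc k) * t\<rfloor> \<le> real (Suc k) * t" "real (Suc k) * t < of_int \<lfloor>real (Suc k) * t\<rfloor> + 1"
    by linarith+
  then show "round_down k t \<le> t" "t < round_down k t + 1 / real (Suc k)"
    unfolding round_down_def by (simp_all only: add_divide_distrib[symmetric] pos_divide_le_eq pos_less_divide_eq of_nat_0_less_iff zero_less_Suc mult.commute)
qed

lemma round_down_finite: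
  assumes "\<And>x. x \<in> X \<Longrightarrow> 0 \<le> f x \<and> f x \<le> 1"
  shows "finite ((\<lambda>x. round_down k (f x)) ` X)"
  by (rule finite_subset[of _ "(\<lambda>i. real i / real (Suc k)) ` {..Suc k}"]) (use round_down_range assms in auto)

lemma J_bounds:
  assumes fin: "finite (g ` X)" and g: "\<And>x. x \<in> X \<Longrightarrow> 0 \<le> g x \<and> g x \<le> 1"
  shows "0 \<le> J g \<and> J g \<le> 1"
proof
  have nn: "0 \<le> \<mu> {x \<in> X. g x = v}" for v by (rule nonneg) blast
  show "0 \<le> J g" unfolding J_def using g nn by (intro sum_nonneg mult_nonneg_nonneg) auto
  have "J g \<le> (\<Sum>v\<in>g ` X. 1 * \<mu> {x \<in> X. g x = v})"
    unfolding J_def using g nn by (intro sum_mono mult_right_mono) auto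
  then show "J g \<le> 1" using level_sum[OF fin] by simp
qed

lemma integral_tendsto:
  assumes f: "\<And>x. x \<in> X \<Longrightarrow> 0 \<le> f x \<and> f x \<le> 1"
  shows "((\<lambda>k. J (\<lambda>x. round_down k (f x))) \<longlongrightarrow> integral f) F" "0 \<le> integral f"
proof -
  have b: "0 \<le> J (\<lambda>x. round_down k (f x)) \<and> J (\<lambda>x. round_down k (f x)) \<le> 1" for k
  proof (rule J_bounds[OF round_down_finite[OF f]])
    fix x assume "x \<in> X"
    then have fx: "0 \<le> f x" "f x \<le> 1" using f by auto
    have "0 \<le> round_down k (f x)" using fx by (simp add: round_down_def)
    moreover have "round_down k (f x) \<le> 1" using round_down_error(1)[of k "f x"] fx by linarith
    ultimately show "0 \<le> round_down k (f x) \<and> round_down k (f x) \<le> 1" ..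
  qed
  show t: "((\<lambda>k. J (\<lambda>x. round_down k (f x))) \<longlongrightarrow> integral f) F"
    unfolding integral_def by (rule U_tendsto[OF b])
  show "0 \<le> integral f"
    by (rule tendsto_lowerbound[OF t _ F(1)]) (use b in simp)
qed

lemma integral_one: "integral (\<lambda>x. 1) = 1"
proof -
  have X: "X \<noteq> {}" using total empty by auto
  have "J (\<lambda>x. round_down k 1) = 1" for k
    using X total by (simp add: J_def round_down_def image_constant_conv)
  then show ?thesis unfolding integral_def by (intro U_eq) simp
qed

text \<open>Three rounding errors between 0 and \<open>1 / Suc k\<close>, two of them with the same
  sign, amount to at most \<open>2 / Suc k\<close>, which vanishes in the limit.\<close>

lemma integral_add:
  assumes f: "\<And>x. x \<in> X \<Longrightarrow> 0 \<le> f x \<and> f x \<le> 1" and g: "\<And>x. x \<in> X \<Longrightarrow> 0 \<le> g x \<and> g x \<le> 1"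
    and h: "\<And>x. x \<in> X \<Longrightarrow> 0 \<le> h x \<and> h x \<le> 1" and eq: "\<And>x. x \<in> X \<Longrightarrow> h x = f x + g x"
  shows "integral h = integral f + integral g"
proof -
  let ?d = "\<lambda>k. J (\<lambda>x. round_down k (h x)) - J (\<lambda>x. round_down k (f x)) - J (\<lambda>x. round_down k (g x))"
  have "(?d \<longlongrightarrow> integral h - integral f - integral g) F"
    by (intro tendsto_diff integral_tendsto f g h)
  moreover have "(?d \<longlongrightarrow> 0) F"
  proof (rule tendsto_0_le)
    show "((\<lambda>k. 1 / real (Suc k)) \<longlongrightarrow> 0) F"
      using F(2) LIMSEQ_Suc[OF lim_1_over_n] by (rule tendsto_mono)
    have "\<bar>?d k\<bar> \<le> 2 * (1 / real (Suc k))" for k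
    proof (rule J_close[OF round_down_finite[OF f] round_down_finite[OF g] round_down_finite[OF h]])
      fix x assume x: "x \<in> X"
      show "\<bar>round_down k (h x) - round_down k (f x) - round_down k (g x)\<bar> \<le> 2 * (1 / real (Suc k))"
        using round_down_error[where k = k and t = "h x"] round_down_error[where k = k and t = "f x"] round_down_error[where k = k and t = "g x"] eq[OF x] by linarith
    qed
    then show "\<forall>\<^sub>F k in F. norm (?d k) \<le> norm (1 / real (Suc k)) * 2" by simp
  qed
  ultimately have "integral h - integral f - integral g = 0" using tendsto_unique F(1) by blast
  then show ?thesis by simp
qed

lemma integral_cong:
  assumes "\<And>x. x \<in> X \<Longrightarrow> f x = g x"
  shows "integral f = integral g"
proof -
  have "J (\<lambda>x. round_down k (f x)) = J (\<lambda>x. round_down k (g x))" for k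
    unfolding J_def using assms by (intro sum.cong arg_cong2[where f = "(*)"] arg_cong[where f = \<mu>]) auto
  then show ?thesis by (simp add: integral_def)
qed

lemma integral_transform:
  assumes T: "bij_betw T X X" and inv: "\<And>A. A \<subseteq> X \<Longrightarrow> \<mu> (T ` A) = \<mu> A"
  shows "integral (\<lambda>x. f (T x)) = integral f"
proof -
  have TX: "T ` X = X" using T by (simp add: bij_betw_def)
  have *: "J (\<lambda>x. g (T x)) = J g" for g
  proof -
    have im: "(\<lambda>x. g (T x)) ` X = g ` X" using TX by (metis image_image)
    have "\<mu> {x \<in> X. g (T x) = v} = \<mu> {x \<in> X. g x = v}" for v
    proof -
      have "T ` {x \<in> X. g (T x) = v} = {x \<in> X. g x = v}" using TX by auto
      then show ?thesis using inv[of "{x \<in> X. g (T x) = v}"] by auto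
    qed
    then show ?thesis by (simp add: J_def im)
  qed
  show ?thesis unfolding integral_def by (simp only: *[of "\<lambda>x. round_down _ (f x)"])
qed

end

section \<open>Amenability of extensions\<close>

text \<open>\<open>dens A x m\<close> is the share of the translate of \<open>P m\<close> by
  \<open>x\<close> that lies in \<open>A\<close>. Its generalized limit depends only on the coset of
  \<open>x\<close> modulo the kernel, because a kernel element lies in \<open>P m\<close> for large
  \<open>m\<close> and then merely permutes it. So the limit is a function on \<open>G\<close>, and
  left translation in \<open>D\<close> becomes left translation in \<open>G\<close>.\<close>

theorem amenable_extension:
  fixes D :: "('d, 'n) monoid_scheme" and G :: "('g, 'm) monoid_scheme" and P :: "nat \<Rightarrow> 'd set"
  assumes D: "group D" and G: "group G" and q: "q \<in> hom D G" "q ` carrier D = carrier G"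
    and am: "amenable G"
    and P: "\<And>m. subgroup (P m) D" "\<And>m. finite (P m)" "\<And>m n. m \<le> n \<Longrightarrow> P m \<subseteq> P n"
    and ker: "\<And>x. x \<in> carrier D \<Longrightarrow> q x = \<one>\<^bsub>G\<^esub> \<Longrightarrow> \<exists>m. x \<in> P m"
  shows "amenable D"
proof -
  interpret D: group D by (rule D)
  interpret G: group G by (rule G)
  interpret q: group_hom D G q by unfold_locales (rule q(1))
  obtain F :: "nat filter" where F: "F \<noteq> bot" "F \<le> sequentially"
    "\<And>(f :: nat \<Rightarrow> real) a b. (\<And>n. a \<le> f n \<and> f n \<le> b) \<Longrightarrow> \<exists>l. (f \<longlongrightarrow> l) F"
    by (rule bounded_limit_exists) blast
  obtain \<mu> :: "'g set \<Rightarrow> real" where m: "(\<forall>A\<subseteq>carrier G. 0 \<le> \<mu> A) \<and> \<mu> (carrier G) = 1 \<and>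
    (\<forall>A B. A \<subseteq> carrier G \<longrightarrow> B \<subseteq> carrier G \<longrightarrow> A \<inter> B = {} \<longrightarrow> \<mu> (A \<union> B) = \<mu> A + \<mu> B) \<and>
    (\<forall>g\<in>carrier G. \<forall>A\<subseteq>carrier G. \<mu> ((\<lambda>x. g \<otimes>\<^bsub>G\<^esub> x) ` A) = \<mu> A)"
    using am unfolding amenable_def by (rule exE)
  have \<mu>: "\<And>A. A \<subseteq> carrier G \<Longrightarrow> 0 \<le> \<mu> A" "\<mu> (carrier G) = 1"
    "\<And>A B. A \<subseteq> carrier G \<Longrightarrow> B \<subseteq> carrier G \<Longrightarrow> A \<inter> B = {} \<Longrightarrow> \<mu> (A \<union> B) = \<mu> A + \<mu> B"
    "\<And>g A. g \<in> carrier G \<Longrightarrow> A \<subseteq> carrier G \<Longrightarrow> \<mu> ((\<lambda>x. g \<otimes>\<^bsub>G\<^esub> x) ` A) = \<mu> A"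
    using m by simp_all
  interpret mean "carrier G" \<mu> F
  proof unfold_locales
    show "\<exists>l. (f \<longlongrightarrow> l) F" if "\<And>n. a \<le> f n \<and> f n \<le> b" for f :: "nat \<Rightarrow> real" and a b
      by (rule F(3)) (rule that)
  qed (use \<mu>(1-3) F(1,2) in auto)
  have PD: "P m \<subseteq> carrier D" for m using P(1) by (rule subgroup.subset)
  have cP: "card (P m) > 0" for m using subgroup.one_closed[OF P(1)] P(2) by (auto simp: card_gt_0_iff)
  define dens where "dens A x m = real (card {p \<in> P m. x \<otimes>\<^bsub>D\<^esub> p \<in> A}) / real (card (P m))" for A x m
  have dens01: "0 \<le> dens A x m \<and> dens A x m \<le> 1" for A x m
    using card_mono[OF P(2), of "{p \<in> P m. x \<otimes>\<^bsub>D\<^esub> p \<in> A}" m] cP[of m] by (auto simp: dens_def divide_le_eq)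
  define lim where "lim A x = U (dens A x)" for A x
  have lim: "(dens A x \<longlongrightarrow> lim A x) F" for A x
    unfolding lim_def by (rule U_tendsto[OF dens01])
  have lim01: "0 \<le> lim A x \<and> lim A x \<le> 1" for A x
    using tendsto_lowerbound[OF lim[of A x] _ F(1), of 0] tendsto_upperbound[OF lim[of A x] _ F(1), of 1] dens01 by simp
  have lim_add: "lim (A \<union> B) x = lim A x + lim B x" if "A \<inter> B = {}" for A B x
  proof -
    have "dens (A \<union> B) x m = dens A x m + dens B x m" for m
    proof -
      have "{p \<in> P m. x \<otimes>\<^bsub>D\<^esub> p \<in> A \<union> B} = {p \<in> P m. x \<otimes>\<^bsub>D\<^esub> p \<in> A} \<union> {p \<in> P m. x \<otimes>\<^bsub>D\<^esub> p \<in> B}" by auto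
      moreover have "card ({p \<in> P m. x \<otimes>\<^bsub>D\<^esub> p \<in> A} \<union> {p \<in> P m. x \<otimes>\<^bsub>D\<^esub> p \<in> B})
          = card {p \<in> P m. x \<otimes>\<^bsub>D\<^esub> p \<in> A} + card {p \<in> P m. x \<otimes>\<^bsub>D\<^esub> p \<in> B}"
        by (rule card_Un_disjoint) (use P(2) that in auto)
      ultimately show ?thesis by (simp add: dens_def add_divide_distrib)
    qed
    then have "dens (A \<union> B) x = (\<lambda>m. dens A x m + dens B x m)" by blast
    then show ?thesis unfolding lim_def[of "A \<union> B"] by (intro U_eq) (simp add: tendsto_add lim)
  qed
  have lim_total: "lim (carrier D) x = 1" if x: "x \<in> carrier D" for x
  proof -
    have "{p \<in> P m. x \<otimes>\<^bsub>D\<^esub> p \<in> carrier D} = P m" for m using PD x by auto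
    then have "dens (carrier D) x = (\<lambda>m. 1)" using cP by (auto simp: dens_def fun_eq_iff)
    then show ?thesis unfolding lim_def by (intro U_eq) simp
  qed
  have lim_right: "lim A (x \<otimes>\<^bsub>D\<^esub> k) = lim A x" if x: "x \<in> carrier D" and k: "k \<in> carrier D" "q k = \<one>\<^bsub>G\<^esub>" for A x k
  proof -
    obtain m0 where m0: "k \<in> P m0" using ker k by blast
    have "dens A (x \<otimes>\<^bsub>D\<^esub> k) m = dens A x m" if m: "m \<ge> m0" for m
    proof -
      interpret Pm: subgroup "P m" D by (rule P(1))
      have kP: "k \<in> P m" using m0 P(3)[OF m] by blast
      have "bij_betw (\<lambda>p. k \<otimes>\<^bsub>D\<^esub> p) {p \<in> P m. x \<otimes>\<^bsub>D\<^esub> k \<otimes>\<^bsub>D\<^esub> p \<in> A} {p \<in> P m. x \<otimes>\<^bsub>D\<^esub> p \<in> A}"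
        by (rule bij_betwI[where g = "\<lambda>p. inv\<^bsub>D\<^esub> k \<otimes>\<^bsub>D\<^esub> p"])
          (use kP x k(1) Pm.mem_carrier Pm.m_closed Pm.m_inv_closed in \<open>auto simp: D.m_assoc[symmetric]\<close>,
           (simp_all add: D.m_assoc))
      then show ?thesis by (simp add: dens_def bij_betw_same_card)
    qed
    then have "\<forall>\<^sub>F m in sequentially. dens A x m = dens A (x \<otimes>\<^bsub>D\<^esub> k) m"
      unfolding eventually_sequentially by metis
    then have "\<forall>\<^sub>F m in F. dens A x m = dens A (x \<otimes>\<^bsub>D\<^esub> k) m" using F(2) filter_leD by blast
    then have "(dens A (x \<otimes>\<^bsub>D\<^esub> k) \<longlongrightarrow> lim A x) F" by (rule Lim_transform_eventually[OF lim])
    then show ?thesis unfolding lim_def[of A "x \<otimes>\<^bsub>D\<^esub> k"] by (rule U_eq)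
  qed
  have lim_left: "lim ((\<lambda>x. y \<otimes>\<^bsub>D\<^esub> x) ` A) x = lim A (inv\<^bsub>D\<^esub> y \<otimes>\<^bsub>D\<^esub> x)"
    if x: "x \<in> carrier D" and y: "y \<in> carrier D" and A: "A \<subseteq> carrier D" for A x y
  proof -
    have "x \<otimes>\<^bsub>D\<^esub> p \<in> (\<lambda>x. y \<otimes>\<^bsub>D\<^esub> x) ` A \<longleftrightarrow> inv\<^bsub>D\<^esub> y \<otimes>\<^bsub>D\<^esub> x \<otimes>\<^bsub>D\<^esub> p \<in> A" if p: "p \<in> P m" for p m
    proof
      have pD: "p \<in> carrier D" using p PD by blast
      show "inv\<^bsub>D\<^esub> y \<otimes>\<^bsub>D\<^esub> x \<otimes>\<^bsub>D\<^esub> p \<in> A" if xp: "x \<otimes>\<^bsub>D\<^esub> p \<in> (\<lambda>x. y \<otimes>\<^bsub>D\<^esub> x) ` A"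
      proof -
        obtain a where a: "a \<in> A" "x \<otimes>\<^bsub>D\<^esub> p = y \<otimes>\<^bsub>D\<^esub> a" using xp by blast
        then have "inv\<^bsub>D\<^esub> y \<otimes>\<^bsub>D\<^esub> (x \<otimes>\<^bsub>D\<^esub> p) = a" using y A by (simp add: D.m_assoc[symmetric] subset_iff)
        then show ?thesis using a x y pD by (simp add: D.m_assoc)
      qed
      have "x \<otimes>\<^bsub>D\<^esub> p = y \<otimes>\<^bsub>D\<^esub> (inv\<^bsub>D\<^esub> y \<otimes>\<^bsub>D\<^esub> x \<otimes>\<^bsub>D\<^esub> p)" using x y pD by (simp add: D.m_assoc[symmetric])
      then show "inv\<^bsub>D\<^esub> y \<otimes>\<^bsub>D\<^esub> x \<otimes>\<^bsub>D\<^esub> p \<in> A \<Longrightarrow> x \<otimes>\<^bsub>D\<^esub> p \<in> (\<lambda>x. y \<otimes>\<^bsub>D\<^esub> x) ` A" by (rule image_eqI)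
    qed
    then have "{p \<in> P m. x \<otimes>\<^bsub>D\<^esub> p \<in> (\<lambda>x. y \<otimes>\<^bsub>D\<^esub> x) ` A} = {p \<in> P m. inv\<^bsub>D\<^esub> y \<otimes>\<^bsub>D\<^esub> x \<otimes>\<^bsub>D\<^esub> p \<in> A}" for m
      by blast
    then have "dens ((\<lambda>x. y \<otimes>\<^bsub>D\<^esub> x) ` A) x = dens A (inv\<^bsub>D\<^esub> y \<otimes>\<^bsub>D\<^esub> x)"
      unfolding dens_def by presburger
    then show ?thesis by (simp add: lim_def)
  qed
  define sec where "sec g = (SOME x. x \<in> carrier D \<and> q x = g)" for g
  have sec: "sec g \<in> carrier D" "q (sec g) = g" if "g \<in> carrier G" for g
  proof -
    have "\<exists>x. x \<in> carrier D \<and> q x = g" using q(2) that by (metis imageE)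
    from someI_ex[OF this] show "sec g \<in> carrier D" "q (sec g) = g" by (simp_all add: sec_def)
  qed
  define \<nu> where "\<nu> A = integral (\<lambda>g. lim A (sec g))" for A
  show ?thesis
    unfolding amenable_def
  proof (intro exI[of _ \<nu>] conjI allI impI ballI)
    show "0 \<le> \<nu> A" for A unfolding \<nu>_def by (rule integral_tendsto(2)) (rule lim01)
    have "\<nu> (carrier D) = integral (\<lambda>g. 1)"
      unfolding \<nu>_def by (rule integral_cong) (simp add: lim_total sec)
    then show "\<nu> (carrier D) = 1" by (simp add: integral_one)
    show "\<nu> (A \<union> B) = \<nu> A + \<nu> B" if "A \<inter> B = {}" for A B
      unfolding \<nu>_def by (rule integral_add) (rule lim01 lim_add[OF that])+
    fix y A assume y: "y \<in> carrier D" and A: "A \<subseteq> carrier D"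
    let ?h = "inv\<^bsub>G\<^esub> (q y)"
    have h: "?h \<in> carrier G" using y by simp
    have "lim ((\<lambda>x. y \<otimes>\<^bsub>D\<^esub> x) ` A) (sec g) = lim A (sec (?h \<otimes>\<^bsub>G\<^esub> g))" if g: "g \<in> carrier G" for g
    proof -
      let ?z = "sec (?h \<otimes>\<^bsub>G\<^esub> g)" and ?w = "inv\<^bsub>D\<^esub> y \<otimes>\<^bsub>D\<^esub> sec g"
      have z: "?z \<in> carrier D" "q ?z = ?h \<otimes>\<^bsub>G\<^esub> g" using sec h g by auto
      have w: "?w \<in> carrier D" "q ?w = ?h \<otimes>\<^bsub>G\<^esub> g" using y sec g by auto
      have "lim ((\<lambda>x. y \<otimes>\<^bsub>D\<^esub> x) ` A) (sec g) = lim A ?w" by (rule lim_left[OF sec(1)[OF g] y A])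
      \<comment> \<open>\<open>?w\<close> and \<open>?z\<close> have the same image in
        \<open>G\<close>, so they differ by a kernel element on the right, which \<open>lim\<close>
        ignores.\<close>
      also have "?w = ?z \<otimes>\<^bsub>D\<^esub> (inv\<^bsub>D\<^esub> ?z \<otimes>\<^bsub>D\<^esub> ?w)" using z w by (simp add: D.m_assoc[symmetric])
      also have "lim A \<dots> = lim A ?z"
        by (rule lim_right) (use z w h g in \<open>auto simp: q.hom_mult q.hom_inv\<close>)
      finally show ?thesis .
    qed
    then have "\<nu> ((\<lambda>x. y \<otimes>\<^bsub>D\<^esub> x) ` A) = integral (\<lambda>g. lim A (sec (?h \<otimes>\<^bsub>G\<^esub> g)))"
      unfolding \<nu>_def by (rule integral_cong)
    also have "\<dots> = \<nu> A"
      unfolding \<nu>_def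
    proof (rule integral_transform[where f = "\<lambda>g. lim A (sec g)"])
      show "bij_betw (\<lambda>g. ?h \<otimes>\<^bsub>G\<^esub> g) (carrier G) (carrier G)"
        using G.inj_on_cmult[OF h] G.surj_const_mult[OF h] by (simp add: bij_betw_def)
    qed (rule \<mu>(4)[OF h])
    finally show "\<nu> ((\<lambda>x. y \<otimes>\<^bsub>D\<^esub> x) ` A) = \<nu> A" .
  qed
qed

theorem (in diagonal) diagonal_amenable:
  assumes "amenable G"
  shows "amenable D"
proof (rule amenable_extension[OF D_group G q_hom q_surj assms, of heads])
  show "heads m \<subseteq> heads n" if "m \<le> n" for m n using that by (auto simp: heads_def)
qed (use heads_subgroup heads_finite q_kernel_heads in auto)

theorem theorem1p5:
  fixes G :: "('a, 'm) monoid_scheme"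
    and S :: "'a set"
    and H :: "nat \<Rightarrow> ('b, 'k) monoid_scheme"
    and \<theta> :: "nat \<Rightarrow> 'a \<Rightarrow> 'b"
  assumes "group G"
    and "finite_generating_set G S"
    and "LEF_approximation G H \<theta>"
    and "essential_by_simple_groups G S H \<theta>"
    and "amenable G"
    and "hs_stable G"
  shows "amenable (diagonal_product S H \<theta>) \<and> hs_stable (diagonal_product S H \<theta>)"
proof -
  interpret diagonal G S H \<theta>
    using assms(1-4) by (rule diagonal.intro)
  show ?thesis using diagonal_amenable[OF assms(5)] diagonal_stable[OF assms(6)] by simp
qed

end
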